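(* Let $W$ be a finite subgroup of $\mathrm{GL}(\mathfrak h)$, $\mathfrak h$ a finite-dimensional complex vector space, and let $\mathcal H_{1,c}$, $\mathcal H_{1,c'}$ be rational Cherednik algebras of $(\mathfrak h,W)$ with parameters $c,c'$. Let $\mathcal M$ be an $\mathcal H_{1,c}$-$\mathcal H_{1,c'}$-bimodule admitting a filtration $\mathrm F_i\mathcal M$, compatible with the filtrations of $\mathcal H_{1,c},\mathcal H_{1,c'}$, such that $R_\hbar(\mathcal M)=\bigoplus_i\hbar^i\mathrm F_i\mathcal M$, considered as an $\tilde{\mathbf H}$-bimodule with bracket $\{z,m\}=\hbar^{-2}[z,m]$, is a Harish-Chandra $\tilde{\mathbf H}$-bimodule. Then $\mathcal M$ is a Harish-Chandra bimodule in the sense of Berest–Etingof–Ginzburg: it is a finitely generated bimodule and the operators $\mathrm{ad}(a):m\mapsto am-ma$ and $\mathrm{ad}(b)$ are locally nilpotent on $\mathcal M$ for all $a\in(S\mathfrak h^* )^W$, $b\in(S\mathfrak h)^W$.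
   Context: $S\subset W$ is the set of complex reflections, $S_1,\dots,S_r$ its $W$-conjugacy classes. For $s\in S$, $\alpha_s\in\mathfrak h^*$ and $\alpha_s^\vee\in\mathfrak h$ vanish on $\mathfrak h^s$, $(\mathfrak h^* )^s$ respectively and $\langle\alpha_s,\alpha_s^\vee\rangle=2$. $\mathbf H$ is the quotient of $\mathbb C[\mathbf t,\mathbf c_1,\dots,\mathbf c_r]\otimes T(\mathfrak h\oplus\mathfrak h^* )\#W$ by $[x,x']=[y,y']=0$, $[y,x]=\mathbf t\langle y,x\rangle-\sum_{s\in S}\mathbf c(s)\langle x,\alpha_s^\vee\rangle\langle y,\alpha_s\rangle s$ ($x,x'\in\mathfrak h^*$, $y,y'\in\mathfrak h$; $\mathbf c(s)=\mathbf c_i$ for $s\in S_i$). $\mathcal H_{1,c}$, $c\in\mathbb C^r$, is the specialization $\mathbf t=1$, $\mathbf c_i=c_i$, filtered with $\mathbb CW$ in degree $0$ and $\mathfrak h\oplus\mathfrak h^*$ in degree $1$. $(S\mathfrak h^* )^W,(S\mathfrak h)^W$ are subalgebras of both $\mathcal H_{1,c}$ and $\mathcal H_{1,c'}$. $\tilde{\mathbf H}=\mathbf H[\hbar]/(\mathbf t-\hbar^2)$, graded with $W$ in degree $0$, $\mathfrak h,\mathfrak h^*,\hbar$ in degree $1$, $\mathbf c_i$ in degree $2$. There is a surjection $\tilde{\mathbf H}\to R_\hbar(\mathcal H_{1,c})=\bigoplus_i\hbar^i\mathrm F_i\mathcal H_{1,c}$, $w\mapsto w$, $\hbar\mapsto\hbar$,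 $v\mapsto\hbar v$, $\mathbf c_i\mapsto c_i\hbar^2$; thus $R_\hbar(\mathcal M)$ (with $\hbar^im$ of degree $i$) is a graded $\tilde{\mathbf H}$-bimodule, left action via $c$, right action via $c'$. $\mathfrak z^{\mathbf t}(\mathbf H)$ is the preimage in $\mathbf H$ of the center of $\mathbf H/(\mathbf t)$; for $z\in\mathfrak z^{\mathbf t}(\mathbf H)$, $\{z,a\}=\frac1{\mathbf t}[z,a]$. A Poisson $\tilde{\mathbf H}$-bimodule is a bimodule $\mathbf M$ with equal left and right actions of $\mathbb C[\hbar]$ and a map $\{\cdot,\cdot\}:\mathfrak z^{\mathbf t}(\mathbf H)\otimes\mathbf M\to\mathbf M$, $\mathbb C[\mathbf t]$-linear in the first and $\mathbb C[\hbar]$-linear in the second argument, such that $\{\mathbf ta,m\}=[a,m]$, $\{z,am\}=\{z,a\}m+a\{z,m\}$, $\{z,ma\}=\{z,m\}a+m\{z,a\}$, $\{z_1z_2,m\}=\{z_1,m\}z_2+z_1\{z_2,m\}$, $\{\{z_1,z_2\},m\}=\{z_1,\{z_2,m\}\}-\{z_2,\{z_1,m\}\}$. A Harish-Chandra $\tilde{\mathbf H}$-bimodule is a graded Poisson bimodule (grading compatible with multiplication, bracket of degree $-2$) that is finitely generated as a bimodule. *)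

theory Defs
  imports Complex_Main "HOL-Library.Poly_Mapping" "HOL-Algebra.QuotRing" "HOL-Algebra.UnivPoly"
begin

section \<open>Free associative complex algebras\<close>

datatype 'g word = Word (letters: "'g list")

instantiation word :: (type) monoid_add
begin

definition zero_word :: "'a word" where "zero_word = Word []"

definition plus_word :: "'a word \<Rightarrow> 'a word \<Rightarrow> 'a word" where
  "plus_word u v = Word (letters u @ letters v)"

instance
proof
qed (simp_all add: zero_word_def plus_word_def)

end

text \<open>The monoid algebra of the word monoid; multiplication of words is written additively because
  this is what the convolution product of \<open>Poly_Mapping\<close> expects.\<close>

type_synonym 'g free_algebra = "'g word \<Rightarrow>\<^sub>0 complex"

definition gen :: "'g \<Rightarrow> 'g free_algebra" where
  "gen g = Poly_Mapping.single (Word [g]) 1"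

definition scalar :: "complex \<Rightarrow> 'g free_algebra" where
  "scalar a = Poly_Mapping.single 0 a"

definition free_alg :: "'g set \<Rightarrow> 'g free_algebra ring" where
  "free_alg G = \<lparr>carrier = {p. \<forall>w \<in> Poly_Mapping.keys p. set (letters w) \<subseteq> G},
     mult = (*), one = 1, zero = 0, add = (+)\<rparr>"

definition comm_rels :: "'g set \<Rightarrow> 'g free_algebra set" where
  "comm_rels G = {gen g * gen g' - gen g' * gen g | g g'. g \<in> G \<and> g' \<in> G}"


section \<open>Complex reflections\<close>

text \<open>\<open>scl\<close> is the scalar multiplication of the complex vector space \<open>'v\<close> (the space
  \<open>\<hh>\<close>), \<open>grp\<close> is the group \<open>W\<close>.\<close>

record 'v refl_data =
  scl :: "complex \<Rightarrow> 'v \<Rightarrow> 'v"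
  grp :: "('v \<Rightarrow> 'v) set"
  alpha :: "('v \<Rightarrow> 'v) \<Rightarrow> 'v \<Rightarrow> complex"
  alpha_chk :: "('v \<Rightarrow> 'v) \<Rightarrow> 'v"

definition GL_group :: "(complex \<Rightarrow> 'v::ab_group_add \<Rightarrow> 'v) \<Rightarrow> ('v \<Rightarrow> 'v) monoid" where
  "GL_group s = \<lparr>carrier = {f. Vector_Spaces.linear s s f \<and> bij f}, monoid.mult = (\<circ>), one = id\<rparr>"

definition covectors :: "'v::ab_group_add refl_data \<Rightarrow> ('v \<Rightarrow> complex) set" where
  "covectors D = {\<xi>. Vector_Spaces.linear (scl D) (*) \<xi>}"

definition coact :: "('v \<Rightarrow> 'v) \<Rightarrow> ('v \<Rightarrow> complex) \<Rightarrow> 'v \<Rightarrow> complex" where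
  "coact w \<xi> = \<xi> \<circ> inv_into UNIV w"

definition fixed_space :: "('v \<Rightarrow> 'v) \<Rightarrow> 'v set" where
  "fixed_space w = {v. w v = v}"

definition reflections :: "'v::ab_group_add refl_data \<Rightarrow> ('v \<Rightarrow> 'v) set" where
  "reflections D =
     {s \<in> grp D. vector_space.dim (scl D) (fixed_space s) + 1 = vector_space.dim (scl D) UNIV}"

definition conj_class :: "'v::ab_group_add refl_data \<Rightarrow> ('v \<Rightarrow> 'v) \<Rightarrow> ('v \<Rightarrow> 'v) set" where
  "conj_class D s = {w \<circ> s \<circ> inv_into UNIV w | w. w \<in> grp D}"

definition refl_classes :: "'v::ab_group_add refl_data \<Rightarrow> ('v \<Rightarrow> 'v) set set" where
  "refl_classes D = conj_class D ` reflections D"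

locale refl_group =
  fixes D :: "'v::ab_group_add refl_data"
  assumes fin_dim: "\<exists>B. finite_dimensional_vector_space (scl D) B"
    and finite_grp: "finite (grp D)"
    and grp_subgroup: "subgroup (grp D) (GL_group (scl D))"
    and alpha_covector: "s \<in> reflections D \<Longrightarrow> alpha D s \<in> covectors D"
    and alpha_vanishes: "s \<in> reflections D \<Longrightarrow> v \<in> fixed_space s \<Longrightarrow> alpha D s v = 0"
    and alpha_chk_vanishes:
      "s \<in> reflections D \<Longrightarrow> \<xi> \<in> covectors D \<Longrightarrow> coact s \<xi> = \<xi> \<Longrightarrow> \<xi> (alpha_chk D s) = 0"
    and alpha_pairing: "s \<in> reflections D \<Longrightarrow> alpha D s (alpha_chk D s) = 2"


section \<open>The universal rational Cherednik algebra\<close>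

text \<open>The parameters \<open>\<c>\<^sub>1, \<dots>, \<c>\<^sub>r\<close> are indexed by the conjugacy classes of reflections
  themselves instead of by numbers.\<close>

datatype 'v letter =
    Par_t
  | Par_c "('v \<Rightarrow> 'v) set"
  | Grp "'v \<Rightarrow> 'v"
  | Vec 'v
  | Cov "'v \<Rightarrow> complex"

type_synonym 'v tensor = "'v letter free_algebra"

definition vec_letters :: "'v letter set" where
  "vec_letters = range Vec"

definition cov_letters :: "'v::ab_group_add refl_data \<Rightarrow> 'v letter set" where
  "cov_letters D = Cov ` covectors D"

definition par_letters :: "'v::ab_group_add refl_data \<Rightarrow> 'v letter set" where
  "par_letters D = insert Par_t (Par_c ` refl_classes D)"

definition all_letters :: "'v::ab_group_add refl_data \<Rightarrow> 'v letter set" where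
  "all_letters D = par_letters D \<union> Grp ` grp D \<union> vec_letters \<union> cov_letters D"

definition vec_lin_rels :: "'v::ab_group_add refl_data \<Rightarrow> 'v tensor set" where
  "vec_lin_rels D =
     {gen (Vec (y + y')) - gen (Vec y) - gen (Vec y') | y y'. True} \<union>
     {gen (Vec (scl D a y)) - scalar a * gen (Vec y) | a y. True}"

definition cov_lin_rels :: "'v::ab_group_add refl_data \<Rightarrow> 'v tensor set" where
  "cov_lin_rels D =
     {gen (Cov (\<lambda>v. x v + x' v)) - gen (Cov x) - gen (Cov x') | x x'.
        x \<in> covectors D \<and> x' \<in> covectors D} \<union>
     {gen (Cov (\<lambda>v. a * x v)) - scalar a * gen (Cov x) | a x. x \<in> covectors D}"

text \<open>Modulo \<open>smash_rels\<close> the free algebra becomes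
  \<open>\<complex>[\<t>, \<c>\<^sub>1, \<dots>, \<c>\<^sub>r] \<otimes> T(\<hh> \<oplus> \<hh>\<^sup>*) # W\<close>.\<close>

definition smash_rels :: "'v::ab_group_add refl_data \<Rightarrow> 'v tensor set" where
  "smash_rels D =
     {gen p * gen g - gen g * gen p | p g. p \<in> par_letters D \<and> g \<in> all_letters D} \<union>
     vec_lin_rels D \<union> cov_lin_rels D \<union>
     {gen (Grp id) - 1} \<union>
     {gen (Grp w) * gen (Grp w') - gen (Grp (w \<circ> w')) | w w'. w \<in> grp D \<and> w' \<in> grp D} \<union>
     {gen (Grp w) * gen (Vec y) - gen (Vec (w y)) * gen (Grp w) | w y. w \<in> grp D} \<union>
     {gen (Grp w) * gen (Cov x) - gen (Cov (coact w x)) * gen (Grp w) | w x.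
        w \<in> grp D \<and> x \<in> covectors D}"

definition commutation_rels :: "'v::ab_group_add refl_data \<Rightarrow> 'v tensor set" where
  "commutation_rels D =
     comm_rels (cov_letters D) \<union> comm_rels vec_letters \<union>
     {(gen (Vec y) * gen (Cov x) - gen (Cov x) * gen (Vec y))
        - (gen Par_t * scalar (x y)
            - (\<Sum>s\<in>reflections D. gen (Par_c (conj_class D s))
                 * scalar (x (alpha_chk D s) * alpha D s y) * gen (Grp s))) | x y.
        x \<in> covectors D}"

type_synonym 'v univ_elem = "'v tensor set"

definition univ_ideal :: "'v::ab_group_add refl_data \<Rightarrow> 'v tensor set" where
  "univ_ideal D = Idl\<^bsub>free_alg (all_letters D)\<^esub> (smash_rels D \<union> commutation_rels D)"

definition univ_alg :: "'v::ab_group_add refl_data \<Rightarrow> 'v univ_elem ring" where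
  "univ_alg D = free_alg (all_letters D) Quot univ_ideal D"

definition univ_cls :: "'v::ab_group_add refl_data \<Rightarrow> 'v tensor \<Rightarrow> 'v univ_elem" where
  "univ_cls D p = univ_ideal D +>\<^bsub>free_alg (all_letters D)\<^esub> p"

definition univ_t :: "'v::ab_group_add refl_data \<Rightarrow> 'v univ_elem" where
  "univ_t D = univ_cls D (gen Par_t)"

text \<open>The degree in \<open>\<^bold>H\<close>; since \<open>\<t> = hbar\<^sup>2\<close> in the extended algebra, \<open>\<t>\<close> has degree 2.\<close>

fun letter_deg :: "'v letter \<Rightarrow> nat" where
  "letter_deg Par_t = 2"
| "letter_deg (Par_c K) = 2"
| "letter_deg (Grp w) = 0"
| "letter_deg (Vec y) = 1"
| "letter_deg (Cov x) = 1"

definition word_deg :: "'v letter word \<Rightarrow> nat" where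
  "word_deg u = (\<Sum>g\<leftarrow>letters u. letter_deg g)"

definition univ_comp :: "'v::ab_group_add refl_data \<Rightarrow> nat \<Rightarrow> 'v univ_elem set" where
  "univ_comp D d = univ_cls D `
     {p \<in> carrier (free_alg (all_letters D)). \<forall>u \<in> Poly_Mapping.keys p. word_deg u = d}"

definition commutator :: "('a, 'b) ring_scheme \<Rightarrow> 'a \<Rightarrow> 'a \<Rightarrow> 'a" where
  "commutator R a b = (a \<otimes>\<^bsub>R\<^esub> b) \<ominus>\<^bsub>R\<^esub> (b \<otimes>\<^bsub>R\<^esub> a)"

definition ring_center :: "('a, 'b) ring_scheme \<Rightarrow> 'a set" where
  "ring_center R = {z \<in> carrier R. \<forall>a \<in> carrier R. z \<otimes>\<^bsub>R\<^esub> a = a \<otimes>\<^bsub>R\<^esub> z}"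

definition poisson_center :: "'v::ab_group_add refl_data \<Rightarrow> 'v univ_elem set" where
  "poisson_center D = (let I = Idl\<^bsub>univ_alg D\<^esub> {univ_t D} in
     {z \<in> carrier (univ_alg D). I +>\<^bsub>univ_alg D\<^esub> z \<in> ring_center (univ_alg D Quot I)})"

definition univ_bracket ::
    "'v::ab_group_add refl_data \<Rightarrow> 'v univ_elem \<Rightarrow> 'v univ_elem \<Rightarrow> 'v univ_elem" where
  "univ_bracket D z a =
     (THE b. b \<in> carrier (univ_alg D) \<and> univ_t D \<otimes>\<^bsub>univ_alg D\<^esub> b = commutator (univ_alg D) z a)"


section \<open>The specialized algebras\<close>

text \<open>Only the values of \<open>c\<close> on conjugacy classes of reflections matter.\<close>

type_synonym 'v param = "('v \<Rightarrow> 'v) set \<Rightarrow> complex"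

type_synonym 'v chered_elem = "'v univ_elem set"

definition chered_ideal :: "'v::ab_group_add refl_data \<Rightarrow> 'v param \<Rightarrow> 'v univ_elem set" where
  "chered_ideal D c = Idl\<^bsub>univ_alg D\<^esub>
     (insert (univ_cls D (gen Par_t - 1))
       ((\<lambda>K. univ_cls D (gen (Par_c K) - scalar (c K))) ` refl_classes D))"

definition chered_alg :: "'v::ab_group_add refl_data \<Rightarrow> 'v param \<Rightarrow> 'v chered_elem ring" where
  "chered_alg D c = univ_alg D Quot chered_ideal D c"

definition chered_cls ::
    "'v::ab_group_add refl_data \<Rightarrow> 'v param \<Rightarrow> 'v tensor \<Rightarrow> 'v chered_elem" where
  "chered_cls D c p = chered_ideal D c +>\<^bsub>univ_alg D\<^esub> univ_cls D p"

text \<open>In the filtration the parameters are scalars, of degree 0, unlike in \<open>letter_deg\<close>.\<close>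

fun letter_order :: "'v letter \<Rightarrow> nat" where
  "letter_order (Vec y) = 1"
| "letter_order (Cov x) = 1"
| "letter_order _ = 0"

definition word_order :: "'v letter word \<Rightarrow> nat" where
  "word_order u = (\<Sum>g\<leftarrow>letters u. letter_order g)"

definition chered_filt ::
    "'v::ab_group_add refl_data \<Rightarrow> 'v param \<Rightarrow> nat \<Rightarrow> 'v chered_elem set" where
  "chered_filt D c i = chered_cls D c `
     {p \<in> carrier (free_alg (all_letters D)). \<forall>u \<in> Poly_Mapping.keys p. word_order u \<le> i}"


section \<open>The extended algebra and its map to the Rees algebra\<close>

type_synonym 'v ext_elem = "(nat \<Rightarrow> 'v univ_elem) set"

definition ext_ideal :: "'v::ab_group_add refl_data \<Rightarrow> (nat \<Rightarrow> 'v univ_elem) set" where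
  "ext_ideal D = (let P = UP (univ_alg D) in
     Idl\<^bsub>P\<^esub> {up_ring.monom P (univ_t D) 0 \<ominus>\<^bsub>P\<^esub> up_ring.monom P \<one>\<^bsub>univ_alg D\<^esub> 2})"

definition ext_alg :: "'v::ab_group_add refl_data \<Rightarrow> 'v ext_elem ring" where
  "ext_alg D = UP (univ_alg D) Quot ext_ideal D"

definition ext_cls ::
    "'v::ab_group_add refl_data \<Rightarrow> (nat \<Rightarrow> 'v univ_elem) \<Rightarrow> 'v ext_elem" where
  "ext_cls D p = ext_ideal D +>\<^bsub>UP (univ_alg D)\<^esub> p"

definition ext_hbar :: "'v::ab_group_add refl_data \<Rightarrow> 'v ext_elem" where
  "ext_hbar D = ext_cls D (up_ring.monom (UP (univ_alg D)) \<one>\<^bsub>univ_alg D\<^esub> 1)"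

definition ext_emb :: "'v::ab_group_add refl_data \<Rightarrow> 'v univ_elem \<Rightarrow> 'v ext_elem" where
  "ext_emb D a = ext_cls D (up_ring.monom (UP (univ_alg D)) a 0)"

definition ext_scalar :: "'v::ab_group_add refl_data \<Rightarrow> complex \<Rightarrow> 'v ext_elem" where
  "ext_scalar D a = ext_emb D (univ_cls D (scalar a))"

definition ext_comp :: "'v::ab_group_add refl_data \<Rightarrow> nat \<Rightarrow> 'v ext_elem set" where
  "ext_comp D d = ext_cls D `
     {p \<in> carrier (UP (univ_alg D)).
        \<forall>j. if j \<le> d then p j \<in> univ_comp D (d - j) else p j = \<zero>\<^bsub>univ_alg D\<^esub>}"

definition ext_bracket ::
    "'v::ab_group_add refl_data \<Rightarrow> 'v univ_elem \<Rightarrow> 'v ext_elem \<Rightarrow> 'v ext_elem" where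
  "ext_bracket D z a =
     (THE b. b \<in> carrier (ext_alg D) \<and>
        ext_hbar D \<otimes>\<^bsub>ext_alg D\<^esub> ext_hbar D \<otimes>\<^bsub>ext_alg D\<^esub> b = commutator (ext_alg D) (ext_emb D z) a)"

text \<open>The Rees algebra of \<open>H\<^bsub>1,c\<^esub>\<close> consists of the polynomials in \<open>UP (chered_alg D c)\<close> whose
  \<open>i\<close>-th coefficient lies in \<open>chered_filt D c i\<close>. \<open>rees_map\<close> is the homomorphism to it from the
  extended algebra: a letter \<open>g\<close> goes to \<open>hbar\<^sup>d g\<close> where \<open>d\<close> is its degree; since \<open>\<t>\<close> and
  \<open>\<c>\<^sub>i\<close> are \<open>1\<close> and \<open>c\<^sub>i\<close> in \<open>H\<^bsub>1,c\<^esub>\<close>, this sends \<open>\<t>\<close> to \<open>hbar\<^sup>2\<close> and \<open>\<c>\<^sub>i\<close> to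
  \<open>c\<^sub>i hbar\<^sup>2\<close>. The maps on the two quotients are the induced ones, as in \<open>FactRing_iso\<close>.\<close>

definition rees_letter ::
    "'v::ab_group_add refl_data \<Rightarrow> 'v param \<Rightarrow> 'v letter \<Rightarrow> nat \<Rightarrow> 'v chered_elem" where
  "rees_letter D c g = up_ring.monom (UP (chered_alg D c)) (chered_cls D c (gen g)) (letter_deg g)"

definition rees_tensor ::
    "'v::ab_group_add refl_data \<Rightarrow> 'v param \<Rightarrow> 'v tensor \<Rightarrow> nat \<Rightarrow> 'v chered_elem" where
  "rees_tensor D c p = (let R = UP (chered_alg D c) in
     \<Oplus>\<^bsub>R\<^esub>u \<in> Poly_Mapping.keys p.
       up_ring.monom R (chered_cls D c (scalar (Poly_Mapping.lookup p u))) 0 \<otimes>\<^bsub>R\<^esub>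
       foldr (\<lambda>g r. rees_letter D c g \<otimes>\<^bsub>R\<^esub> r) (letters u) \<one>\<^bsub>R\<^esub>)"

definition rees_univ ::
    "'v::ab_group_add refl_data \<Rightarrow> 'v param \<Rightarrow> 'v univ_elem \<Rightarrow> nat \<Rightarrow> 'v chered_elem" where
  "rees_univ D c X = the_elem (rees_tensor D c ` X)"

definition rees_map ::
    "'v::ab_group_add refl_data \<Rightarrow> 'v param \<Rightarrow> 'v ext_elem \<Rightarrow> nat \<Rightarrow> 'v chered_elem" where
  "rees_map D c X = the_elem
     (eval (univ_alg D) (UP (chered_alg D c)) (rees_univ D c)
        (up_ring.monom (UP (chered_alg D c)) \<one>\<^bsub>chered_alg D c\<^esub> 1) ` X)"


section \<open>Bimodules\<close>

text \<open>As in \<open>HOL-Algebra.Module\<close>, the record extends \<open>ring\<close> only for the additive notation; the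
  fields \<open>mult\<close> and \<open>one\<close> are not used.\<close>

record ('a, 'b, 'm) bimod = "'m ring" +
  lact :: "'a \<Rightarrow> 'm \<Rightarrow> 'm"
  ract :: "'m \<Rightarrow> 'b \<Rightarrow> 'm"

locale bimodule = A?: ring A + B?: ring B + M?: abelian_group M
  for A :: "('a, 'x) ring_scheme" and B :: "('b, 'y) ring_scheme"
    and M :: "('a, 'b, 'm, 'z) bimod_scheme" (structure) +
  assumes lact_closed: "a \<in> carrier A \<Longrightarrow> m \<in> carrier M \<Longrightarrow> lact M a m \<in> carrier M"
    and ract_closed: "b \<in> carrier B \<Longrightarrow> m \<in> carrier M \<Longrightarrow> ract M m b \<in> carrier M"
    and lact_add: "a \<in> carrier A \<Longrightarrow> m \<in> carrier M \<Longrightarrow> m' \<in> carrier M \<Longrightarrow>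
      lact M a (m \<oplus> m') = lact M a m \<oplus> lact M a m'"
    and ract_add: "b \<in> carrier B \<Longrightarrow> m \<in> carrier M \<Longrightarrow> m' \<in> carrier M \<Longrightarrow>
      ract M (m \<oplus> m') b = ract M m b \<oplus> ract M m' b"
    and add_lact: "a \<in> carrier A \<Longrightarrow> a' \<in> carrier A \<Longrightarrow> m \<in> carrier M \<Longrightarrow>
      lact M (a \<oplus>\<^bsub>A\<^esub> a') m = lact M a m \<oplus> lact M a' m"
    and add_ract: "b \<in> carrier B \<Longrightarrow> b' \<in> carrier B \<Longrightarrow> m \<in> carrier M \<Longrightarrow>
      ract M m (b \<oplus>\<^bsub>B\<^esub> b') = ract M m b \<oplus> ract M m b'"
    and mult_lact: "a \<in> carrier A \<Longrightarrow> a' \<in> carrier A \<Longrightarrow> m \<in> carrier M \<Longrightarrow>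
      lact M (a \<otimes>\<^bsub>A\<^esub> a') m = lact M a (lact M a' m)"
    and mult_ract: "b \<in> carrier B \<Longrightarrow> b' \<in> carrier B \<Longrightarrow> m \<in> carrier M \<Longrightarrow>
      ract M m (b \<otimes>\<^bsub>B\<^esub> b') = ract M (ract M m b) b'"
    and one_lact: "m \<in> carrier M \<Longrightarrow> lact M \<one>\<^bsub>A\<^esub> m = m"
    and one_ract: "m \<in> carrier M \<Longrightarrow> ract M m \<one>\<^bsub>B\<^esub> = m"
    and lact_ract: "a \<in> carrier A \<Longrightarrow> b \<in> carrier B \<Longrightarrow> m \<in> carrier M \<Longrightarrow>
      ract M (lact M a m) b = lact M a (ract M m b)"

definition subbimodule ::
    "('a, 'x) ring_scheme \<Rightarrow> ('b, 'y) ring_scheme \<Rightarrow> ('a, 'b, 'm, 'z) bimod_scheme \<Rightarrow> 'm set \<Rightarrow> bool"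
  where "subbimodule A B M N \<longleftrightarrow> additive_subgroup N M \<and>
    (\<forall>a \<in> carrier A. \<forall>n \<in> N. lact M a n \<in> N) \<and> (\<forall>b \<in> carrier B. \<forall>n \<in> N. ract M n b \<in> N)"

definition fin_gen_bimodule ::
    "('a, 'x) ring_scheme \<Rightarrow> ('b, 'y) ring_scheme \<Rightarrow> ('a, 'b, 'm, 'z) bimod_scheme \<Rightarrow> bool" where
  "fin_gen_bimodule A B M \<longleftrightarrow>
     (\<exists>X. finite X \<and> X \<subseteq> carrier M \<and> \<Inter>{N. subbimodule A B M N \<and> X \<subseteq> N} = carrier M)"

text \<open>Bimodules over \<open>\<complex>\<close>-algebras: the scalars act equally from both sides.\<close>

locale chered_bimodule = bimodule "chered_alg D c" "chered_alg D c'" M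
  for D :: "'v::ab_group_add refl_data" and c c' :: "'v param"
    and M :: "('v chered_elem, 'v chered_elem, 'm, 'z) bimod_scheme" (structure) +
  assumes scalar_central: "m \<in> carrier M \<Longrightarrow>
    lact M (chered_cls D c (scalar a)) m = ract M m (chered_cls D c' (scalar a))"

text \<open>Since \<open>chered_filt D c 0\<close> contains the scalars, every \<open>F i\<close> is a complex subspace.\<close>

locale bimodule_filtration =
  fixes D :: "'v::ab_group_add refl_data" and c c' :: "'v param"
    and M :: "('v chered_elem, 'v chered_elem, 'm, 'z) bimod_scheme" (structure)
    and F :: "int \<Rightarrow> 'm set"
  assumes filt_subgroup: "additive_subgroup (F i) M"
    and filt_mono: "i \<le> j \<Longrightarrow> F i \<subseteq> F j"
    and filt_exhaustive: "(\<Union>i. F i) = carrier M"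
    and filt_lact: "a \<in> chered_filt D c i \<Longrightarrow> m \<in> F j \<Longrightarrow> lact M a m \<in> F (int i + j)"
    and filt_ract: "b \<in> chered_filt D c' i \<Longrightarrow> m \<in> F j \<Longrightarrow> ract M m b \<in> F (j + int i)"


section \<open>Poisson and Harish-Chandra bimodules over the extended algebra\<close>

locale poisson_bimodule = bimodule "ext_alg D" "ext_alg D" M
  for D :: "'v::ab_group_add refl_data"
    and M :: "('v ext_elem, 'v ext_elem, 'm, 'z) bimod_scheme" (structure) +
  fixes br :: "'v univ_elem \<Rightarrow> 'm \<Rightarrow> 'm"
  assumes scalar_central: "m \<in> carrier M \<Longrightarrow>
      lact M (ext_scalar D k) m = ract M m (ext_scalar D k)"
    and hbar_central: "m \<in> carrier M \<Longrightarrow> lact M (ext_hbar D) m = ract M m (ext_hbar D)"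
    and br_closed: "z \<in> poisson_center D \<Longrightarrow> m \<in> carrier M \<Longrightarrow> br z m \<in> carrier M"
    and br_add_left: "z \<in> poisson_center D \<Longrightarrow> z' \<in> poisson_center D \<Longrightarrow> m \<in> carrier M \<Longrightarrow>
      br (z \<oplus>\<^bsub>univ_alg D\<^esub> z') m = br z m \<oplus> br z' m"
    and br_scalar_left: "z \<in> poisson_center D \<Longrightarrow> m \<in> carrier M \<Longrightarrow>
      br (univ_cls D (scalar k) \<otimes>\<^bsub>univ_alg D\<^esub> z) m = lact M (ext_scalar D k) (br z m)"
    and br_t_left: "z \<in> poisson_center D \<Longrightarrow> m \<in> carrier M \<Longrightarrow>
      br (univ_t D \<otimes>\<^bsub>univ_alg D\<^esub> z) m = lact M (ext_emb D (univ_t D)) (br z m)"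
    and br_add_right: "z \<in> poisson_center D \<Longrightarrow> m \<in> carrier M \<Longrightarrow> m' \<in> carrier M \<Longrightarrow>
      br z (m \<oplus> m') = br z m \<oplus> br z m'"
    and br_scalar_right: "z \<in> poisson_center D \<Longrightarrow> m \<in> carrier M \<Longrightarrow>
      br z (lact M (ext_scalar D k) m) = lact M (ext_scalar D k) (br z m)"
    and br_hbar_right: "z \<in> poisson_center D \<Longrightarrow> m \<in> carrier M \<Longrightarrow>
      br z (lact M (ext_hbar D) m) = lact M (ext_hbar D) (br z m)"
    and br_t_mult: "u \<in> carrier (univ_alg D) \<Longrightarrow> m \<in> carrier M \<Longrightarrow>
      br (univ_t D \<otimes>\<^bsub>univ_alg D\<^esub> u) m = lact M (ext_emb D u) m \<ominus> ract M m (ext_emb D u)"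
    and br_lact: "z \<in> poisson_center D \<Longrightarrow> a \<in> carrier (ext_alg D) \<Longrightarrow> m \<in> carrier M \<Longrightarrow>
      br z (lact M a m) = lact M (ext_bracket D z a) m \<oplus> lact M a (br z m)"
    and br_ract: "z \<in> poisson_center D \<Longrightarrow> a \<in> carrier (ext_alg D) \<Longrightarrow> m \<in> carrier M \<Longrightarrow>
      br z (ract M m a) = ract M (br z m) a \<oplus> ract M m (ext_bracket D z a)"
    and br_mult: "z \<in> poisson_center D \<Longrightarrow> z' \<in> poisson_center D \<Longrightarrow> m \<in> carrier M \<Longrightarrow>
      br (z \<otimes>\<^bsub>univ_alg D\<^esub> z') m
        = ract M (br z m) (ext_emb D z') \<oplus> lact M (ext_emb D z) (br z' m)"
    and br_jacobi: "z \<in> poisson_center D \<Longrightarrow> z' \<in> poisson_center D \<Longrightarrow> m \<in> carrier M \<Longrightarrow>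
      br (univ_bracket D z z') m = br z (br z' m) \<ominus> br z' (br z m)"

locale harish_chandra_bimodule = poisson_bimodule D M br
  for D :: "'v::ab_group_add refl_data"
    and M :: "('v ext_elem, 'v ext_elem, 'm, 'z) bimod_scheme" (structure)
    and br :: "'v univ_elem \<Rightarrow> 'm \<Rightarrow> 'm" +
  fixes gr :: "int \<Rightarrow> 'm set"
  assumes gr_subgroup: "additive_subgroup (gr i) M"
    and gr_decomp: "m \<in> carrier M \<Longrightarrow>
      \<exists>!f. (\<forall>i. f i \<in> gr i) \<and> finite {i. f i \<noteq> \<zero>} \<and> m = (\<Oplus>i \<in> {i. f i \<noteq> \<zero>}. f i)"
    and gr_lact: "a \<in> ext_comp D i \<Longrightarrow> m \<in> gr j \<Longrightarrow> lact M a m \<in> gr (int i + j)"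
    and gr_ract: "a \<in> ext_comp D i \<Longrightarrow> m \<in> gr j \<Longrightarrow> ract M m a \<in> gr (j + int i)"
    and gr_br: "z \<in> poisson_center D \<Longrightarrow> z \<in> univ_comp D i \<Longrightarrow> m \<in> gr j \<Longrightarrow>
      br z m \<in> gr (int i + j - 2)"
    and fin_gen: "fin_gen_bimodule (ext_alg D) (ext_alg D) M"


section \<open>The Rees bimodule\<close>

text \<open>The element \<open>\<Sum>\<^sub>i hbar\<^sup>i m\<^sub>i\<close> is represented by the family \<open>m\<close>.\<close>

definition rees_bimod ::
    "'v::ab_group_add refl_data \<Rightarrow> 'v param \<Rightarrow> 'v param \<Rightarrow>
     ('v chered_elem, 'v chered_elem, 'm, 'z) bimod_scheme \<Rightarrow> (int \<Rightarrow> 'm set) \<Rightarrow>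
     ('v ext_elem, 'v ext_elem, int \<Rightarrow> 'm) bimod" where
  "rees_bimod D c c' M F =
     \<lparr>carrier = {f. (\<forall>i. f i \<in> F i) \<and> finite {i. f i \<noteq> \<zero>\<^bsub>M\<^esub>}},
      mult = undefined, one = undefined,
      zero = (\<lambda>i. \<zero>\<^bsub>M\<^esub>),
      add = (\<lambda>f g i. f i \<oplus>\<^bsub>M\<^esub> g i),
      lact = (\<lambda>X f k. let p = rees_map D c X in
        \<Oplus>\<^bsub>M\<^esub>i \<in> {..deg (chered_alg D c) p}. lact M (p i) (f (k - int i))),
      ract = (\<lambda>f X k. let p = rees_map D c' X in
        \<Oplus>\<^bsub>M\<^esub>i \<in> {..deg (chered_alg D c') p}. ract M (f (k - int i)) (p i))\<rparr>"

definition rees_grading ::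
    "('a, 'b, 'm, 'z) bimod_scheme \<Rightarrow> (int \<Rightarrow> 'm set) \<Rightarrow> int \<Rightarrow> (int \<Rightarrow> 'm) set" where
  "rees_grading M F i = {f. f i \<in> F i \<and> (\<forall>j. j \<noteq> i \<longrightarrow> f j = \<zero>\<^bsub>M\<^esub>)}"

text \<open>\<open>hbar\<^sup>-\<^sup>2 [z, m]\<close>: dividing by \<open>hbar\<^sup>2\<close> shifts the coefficients by two. The outcome need not
  belong to the Rees bimodule; that it does is part of the requirement \<open>br_closed\<close>.\<close>

definition rees_bracket ::
    "'v::ab_group_add refl_data \<Rightarrow> 'v param \<Rightarrow> 'v param \<Rightarrow>
     ('v chered_elem, 'v chered_elem, 'm, 'z) bimod_scheme \<Rightarrow> (int \<Rightarrow> 'm set) \<Rightarrow>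
     'v univ_elem \<Rightarrow> (int \<Rightarrow> 'm) \<Rightarrow> int \<Rightarrow> 'm" where
  "rees_bracket D c c' M F z f k = (let R = rees_bimod D c c' M F in
     lact R (ext_emb D z) f (k + 2) \<ominus>\<^bsub>M\<^esub> ract R f (ext_emb D z) (k + 2))"


section \<open>Invariants of symmetric algebras and the Berest--Etingof--Ginzburg condition\<close>

text \<open>The symmetric algebra on the vector space with letters \<open>L\<close> and linear relations \<open>R\<close>.\<close>

definition sym_alg :: "'g set \<Rightarrow> 'g free_algebra set \<Rightarrow> 'g free_algebra set ring" where
  "sym_alg L R = free_alg L Quot (Idl\<^bsub>free_alg L\<^esub> (R \<union> comm_rels L))"

text \<open>The action of \<open>w\<close> on \<open>T(\<hh> \<oplus> \<hh>\<^sup>*)\<close>; the remaining letters play no role.\<close>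

fun letter_act :: "('v \<Rightarrow> 'v) \<Rightarrow> 'v letter \<Rightarrow> 'v letter" where
  "letter_act w (Vec y) = Vec (w y)"
| "letter_act w (Cov x) = Cov (coact w x)"
| "letter_act w g = g"

definition tensor_act :: "('v \<Rightarrow> 'v) \<Rightarrow> 'v tensor \<Rightarrow> 'v tensor" where
  "tensor_act w p = (\<Sum>u \<in> Poly_Mapping.keys p.
     Poly_Mapping.single (map_word (letter_act w) u) (Poly_Mapping.lookup p u))"

text \<open>The induced automorphism of the symmetric algebra maps a coset to its image.\<close>

definition sym_invariants ::
    "'v::ab_group_add refl_data \<Rightarrow> 'v letter set \<Rightarrow> 'v tensor set \<Rightarrow> 'v tensor set set" where
  "sym_invariants D L R = {X \<in> carrier (sym_alg L R). \<forall>w \<in> grp D. tensor_act w ` X = X}"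

definition sym_emb ::
    "'v::ab_group_add refl_data \<Rightarrow> 'v param \<Rightarrow> 'v tensor set \<Rightarrow> 'v chered_elem" where
  "sym_emb D c X = the_elem (chered_cls D c ` X)"

definition loc_nilpotent_on :: "'m set \<Rightarrow> 'm \<Rightarrow> ('m \<Rightarrow> 'm) \<Rightarrow> bool" where
  "loc_nilpotent_on V z T \<longleftrightarrow> (\<forall>m \<in> V. \<exists>n. (T ^^ n) m = z)"

definition ad_op ::
    "'v::ab_group_add refl_data \<Rightarrow> 'v param \<Rightarrow> 'v param \<Rightarrow>
     ('v chered_elem, 'v chered_elem, 'm, 'z) bimod_scheme \<Rightarrow> 'v tensor set \<Rightarrow> 'm \<Rightarrow> 'm" where
  "ad_op D c c' M a m = lact M (sym_emb D c a) m \<ominus>\<^bsub>M\<^esub> ract M m (sym_emb D c' a)"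

definition BEG_harish_chandra ::
    "'v::ab_group_add refl_data \<Rightarrow> 'v param \<Rightarrow> 'v param \<Rightarrow>
     ('v chered_elem, 'v chered_elem, 'm, 'z) bimod_scheme \<Rightarrow> bool" where
  "BEG_harish_chandra D c c' M \<longleftrightarrow>
     fin_gen_bimodule (chered_alg D c) (chered_alg D c') M \<and>
     (\<forall>a \<in> sym_invariants D (cov_letters D) (cov_lin_rels D).
        loc_nilpotent_on (carrier M) \<zero>\<^bsub>M\<^esub> (ad_op D c c' M a)) \<and>
     (\<forall>b \<in> sym_invariants D vec_letters (vec_lin_rels D).
        loc_nilpotent_on (carrier M) \<zero>\<^bsub>M\<^esub> (ad_op D c c' M b))"

end

theory Submission
  imports Defs "HOL-Computational_Algebra.Fundamental_Theorem_Algebra"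
begin

text \<open>
  The proof tracks the weights of the operator \<open>E m = eu m - m eu\<close> on \<open>M\<close>, where \<open>eu\<close> is the Euler
  element: \<open>\<Sum>\<^sub>i x\<^sub>i y\<^sub>i\<close> corrected by a combination of reflections so that \<open>[eu, x] = t x\<close>,
  \<open>[eu, y] = - t y\<close> and \<open>[eu, w] = 0\<close> (\<open>euler_cov\<close>, \<open>euler_vec\<close>, \<open>euler_grp\<close>).  Left and right
  multiplication by \<open>x\<close> raise the eigenvalues of \<open>E\<close> by 1, multiplication by \<open>y\<close> lowers them by 1,
  and multiplication by \<open>w\<close> preserves them.

  The element \<open>eu\<close> commutes with everything modulo \<open>t\<close> and has degree 2, so that the bracket
  hypothesis makes \<open>E\<close> preserve each \<open>F\<^sub>j\<close>.  Finite generation of the Rees bimodule says that the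
  filtration is generated by finitely many vectors (\<open>filtration_generated\<close>); this gives finite
  generation of \<open>M\<close> at once, and it makes every \<open>F\<^sub>j\<close> finite dimensional.  Hence every vector of
  \<open>F\<^sub>j\<close> is killed by a product of factors \<open>E - l\<close>, and since a letter shifts weights by at most its
  degree, \<open>\<bar>Re l\<bar> \<le> j + C\<close> with one constant \<open>C\<close> for all \<open>j\<close> (\<open>weights_bounded\<close>).

  Let \<open>a\<close> be an invariant and \<open>a\<^sub>d\<close> its part of degree \<open>d\<close>.  Invariants too commute with everything
  modulo \<open>t\<close>, so the bracket hypothesis gives \<open>[a\<^sub>d, F\<^sub>j] \<subseteq> F\<^bsub>j+d-2\<^esub>\<close>, whereas the weight moves by \<open>d\<close>
  in one fixed direction.  After \<open>k\<close> such steps the weight has moved by \<open>\<Sum> d\<^sub>i\<close> but the bound on it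
  has grown by \<open>\<Sum> d\<^sub>i - 2 k\<close> only; for large \<open>k\<close> nothing is left (\<open>locally_nilpotent\<close>).

  That invariants commute with everything modulo \<open>t\<close> is shown without the
  Poincare-Birkhoff-Witt theorem.  For a word \<open>u\<close> in \<open>\<hh>\<^sup>*\<close> one has, modulo \<open>t\<close>,
  \<open>[y, u] = - \<Sum>\<^sub>s c(s) \<alpha>\<^sub>s(y) \<Delta>\<^sub>s(u) s\<close> with a twisted derivation \<open>\<Delta>\<^sub>s\<close>, and \<open>\<Delta>\<^sub>s\<close> of the average of
  \<open>u\<close> over \<open>W\<close> vanishes: on a word of eigenvectors of \<open>s\<close> containing \<open>a\<close> factors of the eigenvalue
  \<open>\<mu> \<noteq> 1\<close>, \<open>\<Delta>\<^sub>s\<close> is a multiple of \<open>1 + \<mu> + \<dots> + \<mu>\<^bsup>a-1\<^esup>\<close>, which is zero if \<open>\<mu>\<^sup>a = 1\<close>, while the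
  average over the powers of \<open>s\<close> is zero if \<open>\<mu>\<^sup>a \<noteq> 1\<close> (\<open>reflected_deriv_average\<close>).

  Calculations with generators take place in the free algebra modulo two-sided ideals.  The Rees
  map turns out to separate a tensor into its homogeneous components (\<open>rees_map_emb\<close>), which is how
  the bracket hypothesis yields a statement about each \<open>a\<^sub>d\<close> separately.
\<close>

section \<open>Two-sided ideals of the free algebra\<close>

lemma letters_plus_word: "letters (u + v) = letters u @ letters v"
  by (simp add: plus_word_def)

lemma letters_zero_word: "letters 0 = []"
  by (simp add: zero_word_def)

lemma word_sum_induct:
  fixes p :: "'g free_algebra"
  assumes "Q 0" "\<And>x y. Q x \<Longrightarrow> Q y \<Longrightarrow> Q (x + y)"
    and "\<And>u a. u \<in> Poly_Mapping.keys p \<Longrightarrow> Q (Poly_Mapping.single u a)"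
  shows "Q p"
proof -
  have p: "p = (\<Sum>u\<in>Poly_Mapping.keys p. Poly_Mapping.single u (Poly_Mapping.lookup p u))"
    by (rule poly_mapping_eqI)
      (auto simp: lookup_sum lookup_single when_def in_keys_iff)
  have "Q (\<Sum>u\<in>A. Poly_Mapping.single u (Poly_Mapping.lookup p u))"
    if "finite A" "A \<subseteq> Poly_Mapping.keys p" for A
    using that by (induction A rule: finite_induct) (auto intro: assms)
  then show ?thesis
    by (subst p) auto
qed

lemma word_expansion:
  fixes p :: "'g free_algebra"
  shows "p = (\<Sum>u\<in>Poly_Mapping.keys p. scalar (Poly_Mapping.lookup p u) * Poly_Mapping.single u 1)"
  by (rule poly_mapping_eqI)
    (auto simp: lookup_sum lookup_single when_def in_keys_iff scalar_def mult_single)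

lemma single_Cons_word:
  "Poly_Mapping.single (Word (g # gs)) a = gen g * Poly_Mapping.single (Word gs) a"
  by (simp add: gen_def mult_single plus_word_def)

lemma single_Nil_word: "Poly_Mapping.single (Word []) a = scalar a"
  by (simp add: scalar_def zero_word_def)

lemma scalar_commutes: "scalar a * p = p * scalar a"
proof (induction p rule: word_sum_induct)
  case (3 u b)
  then show ?case by (simp add: scalar_def mult_single mult.commute)
qed (auto simp: algebra_simps)

lemma scalar_simps:
  "scalar (a + b) = scalar a + scalar b" "scalar (a - b) = scalar a - scalar b"
  "scalar (a * b) = scalar a * scalar b" "scalar (- a) = - scalar a"
  "scalar 1 = 1" "scalar 0 = 0"
  by (simp_all add: scalar_def single_add single_diff mult_single single_uminus)

text \<open>Moves scalars to the front of a product of generators; \<open>scalar_commutes\<close> itself would loop as a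
  rewrite rule on products of scalars.\<close>

lemma scalar_norm:
  "gen g * scalar a = scalar a * gen g" "gen g * (scalar a * p) = scalar a * (gen g * p)"
  "scalar a * scalar b = scalar (a * b)" "scalar a * (scalar b * p) = scalar (a * b) * p"
  by (simp_all add: scalar_simps mult.assoc)
    (metis scalar_commutes, metis mult.assoc scalar_commutes)

lemma scalar_sum: "scalar (sum f A) = (\<Sum>i\<in>A. scalar (f i))"
  by (induction A rule: infinite_finite_induct) (auto simp: scalar_simps)

text \<open>Used both to extract homogeneous components and to delete the words that contain letters
  foreign to a reflection datum.\<close>

definition keep_words :: "('g word \<Rightarrow> bool) \<Rightarrow> 'g free_algebra \<Rightarrow> 'g free_algebra" where
  "keep_words P p = Abs_poly_mapping (\<lambda>u. Poly_Mapping.lookup p u when P u)"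

lemma lookup_keep_words:
  "Poly_Mapping.lookup (keep_words P p) u = (Poly_Mapping.lookup p u when P u)"
proof -
  have "finite {u. (Poly_Mapping.lookup p u when P u) \<noteq> 0}"
    by (rule finite_subset[of _ "Poly_Mapping.keys p"]) (auto simp: in_keys_iff)
  then show ?thesis
    by (simp add: keep_words_def)
qed

lemma keep_words_add: "keep_words P (p + q) = keep_words P p + keep_words P q"
  by (rule poly_mapping_eqI) (simp add: lookup_keep_words lookup_add when_def)

lemma keep_words_uminus: "keep_words P (- p) = - keep_words P p"
  by (rule poly_mapping_eqI) (simp add: lookup_keep_words when_def)

lemma keep_words_diff: "keep_words P (p - q) = keep_words P p - keep_words P q"
  by (rule poly_mapping_eqI) (simp add: lookup_keep_words lookup_minus when_def)

lemma keep_words_zero [simp]: "keep_words P 0 = 0"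
  by (rule poly_mapping_eqI) (simp add: lookup_keep_words when_def)

lemma keep_words_single: "keep_words P (Poly_Mapping.single u a) = (if P u then Poly_Mapping.single u a else 0)"
  by (rule poly_mapping_eqI) (auto simp: lookup_keep_words when_def lookup_single)

lemma keep_words_id: "(\<And>u. u \<in> Poly_Mapping.keys p \<Longrightarrow> P u) \<Longrightarrow> keep_words P p = p"
  by (rule poly_mapping_eqI) (auto simp: lookup_keep_words when_def in_keys_iff)

lemma keep_words_none: "(\<And>u. u \<in> Poly_Mapping.keys p \<Longrightarrow> \<not> P u) \<Longrightarrow> keep_words P p = 0"
  by (rule poly_mapping_eqI) (auto simp: lookup_keep_words when_def in_keys_iff)

lemma keys_keep_words: "Poly_Mapping.keys (keep_words P p) = {u \<in> Poly_Mapping.keys p. P u}"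
  by (auto simp: in_keys_iff lookup_keep_words when_def split: if_splits)

lemma keep_words_mult:
  assumes "\<And>u v. P (u + v) \<longleftrightarrow> P u \<and> P v"
  shows "keep_words P (p * q) = keep_words P p * keep_words P q"
proof (induction p rule: word_sum_induct)
  case (3 u a)
  show ?case
  proof (induction q rule: word_sum_induct)
    case (3 v b)
    then show ?case by (auto simp: mult_single keep_words_single assms)
  qed (auto simp: algebra_simps keep_words_add)
qed (auto simp: algebra_simps keep_words_add)

text \<open>Congruences modulo an ideal of a ring type, rather than equations in a quotient ring with a
  carrier, so that the simplifier can do the noncommutative arithmetic.\<close>

locale two_sided_ideal =
  fixes J :: "'a::ring_1 set"
  assumes zero_mem: "0 \<in> J"
    and add_mem: "a \<in> J \<Longrightarrow> b \<in> J \<Longrightarrow> a + b \<in> J"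
    and mult_left_mem: "a \<in> J \<Longrightarrow> x * a \<in> J"
    and mult_right_mem: "a \<in> J \<Longrightarrow> a * x \<in> J"
begin

definition cong :: "'a \<Rightarrow> 'a \<Rightarrow> bool" (infix "\<doteq>" 50) where
  "a \<doteq> b \<longleftrightarrow> a - b \<in> J"

lemma uminus_mem: "a \<in> J \<Longrightarrow> - a \<in> J"
  using mult_left_mem[of a "-1"] by simp

lemma diff_mem: "a \<in> J \<Longrightarrow> b \<in> J \<Longrightarrow> a - b \<in> J"
  using add_mem[of a "-b"] uminus_mem[of b] by simp

lemma sum_mem: "(\<And>i. i \<in> A \<Longrightarrow> f i \<in> J) \<Longrightarrow> sum f A \<in> J"
  by (induction A rule: infinite_finite_induct) (auto simp: zero_mem add_mem)

lemma cong_refl [simp]: "a \<doteq> a"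
  by (simp add: cong_def zero_mem)

lemma cong_sym: "a \<doteq> b \<Longrightarrow> b \<doteq> a"
  using uminus_mem[of "a - b"] by (simp add: cong_def)

lemma cong_trans [trans]: "a \<doteq> b \<Longrightarrow> b \<doteq> c \<Longrightarrow> a \<doteq> c"
  using add_mem[of "a - b" "b - c"] by (simp add: cong_def)

lemma cong_eq_trans [trans]: "a \<doteq> b \<Longrightarrow> b = c \<Longrightarrow> a \<doteq> c"
  by simp

lemma eq_cong_trans [trans]: "a = b \<Longrightarrow> b \<doteq> c \<Longrightarrow> a \<doteq> c"
  by simp

lemma cong_add: "a \<doteq> b \<Longrightarrow> c \<doteq> d \<Longrightarrow> a + c \<doteq> b + d"
  using add_mem[of "a - b" "c - d"] by (simp add: cong_def algebra_simps)

lemma cong_diff: "a \<doteq> b \<Longrightarrow> c \<doteq> d \<Longrightarrow> a - c \<doteq> b - d"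
  using diff_mem[of "a - b" "c - d"] by (simp add: cong_def algebra_simps)

lemma cong_uminus: "a \<doteq> b \<Longrightarrow> - a \<doteq> - b"
  using uminus_mem[of "a - b"] by (simp add: cong_def algebra_simps)

lemma cong_mult: "a \<doteq> b \<Longrightarrow> c \<doteq> d \<Longrightarrow> a * c \<doteq> b * d"
  using add_mem[OF mult_right_mem[of "a - b" c] mult_left_mem[of "c - d" b]]
  by (simp add: cong_def algebra_simps)

lemma cong_sum: "(\<And>i. i \<in> A \<Longrightarrow> f i \<doteq> g i) \<Longrightarrow> sum f A \<doteq> sum g A"
  using sum_mem[of A "\<lambda>i. f i - g i"] by (simp add: cong_def sum_subtractf)

lemma cong_zero_iff: "a \<doteq> 0 \<longleftrightarrow> a \<in> J"
  by (simp add: cong_def)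

lemma cong_mem: "a \<doteq> b \<Longrightarrow> b \<in> J \<Longrightarrow> a \<in> J"
  using add_mem[of "a - b" b] by (simp add: cong_def)

end

text \<open>The commutator with a fixed element is a derivation, so it suffices to control it on letters.\<close>

lemma (in two_sided_ideal) commutator_mem_mult:
  assumes "z * a - a * z \<in> J" "z * b - b * z \<in> J"
  shows "z * (a * b) - (a * b) * z \<in> J"
proof -
  have "z * (a * b) - (a * b) * z = (z * a - a * z) * b + a * (z * b - b * z)"
    by (simp add: algebra_simps)
  then show ?thesis
    using assms by (simp add: add_mem mult_left_mem mult_right_mem)
qed

lemma free_algebra_commutator_mem:
  fixes J :: "'g free_algebra set"
  assumes "two_sided_ideal J" and gens: "\<And>g. z * gen g - gen g * z \<in> J"
  shows "z * p - p * z \<in> J"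
proof -
  interpret two_sided_ideal J by fact
  have word: "z * Poly_Mapping.single (Word gs) a - Poly_Mapping.single (Word gs) a * z \<in> J" for gs a
  proof (induction gs)
    case Nil
    then show ?case by (simp add: single_Nil_word scalar_commutes zero_mem)
  next
    case (Cons g gs)
    then show ?case
      unfolding single_Cons_word by (intro commutator_mem_mult gens)
  qed
  show ?thesis
  proof (induction p rule: word_sum_induct)
    case 1
    then show ?case by (simp add: zero_mem)
  next
    case (2 x y)
    have "z * (x + y) - (x + y) * z = (z * x - x * z) + (z * y - y * z)"
      by (simp add: algebra_simps)
    with 2 show ?case by (simp add: add_mem)
  next
    case (3 u a)
    then show ?case using word[of "letters u" a] by simp
  qed
qed

section \<open>The Cherednik algebra as a quotient of the free algebra\<close>

definition free_carrier :: "'g set \<Rightarrow> 'g free_algebra set" where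
  "free_carrier G = {p. \<forall>w \<in> Poly_Mapping.keys p. set (letters w) \<subseteq> G}"

lemma carrier_free_alg: "carrier (free_alg G) = free_carrier G"
  by (simp add: free_alg_def free_carrier_def)

lemma free_alg_simps [simp]:
  "monoid.mult (free_alg G) = (*)" "one (free_alg G) = 1" "zero (free_alg G) = 0" "add (free_alg G) = (+)"
  by (simp_all add: free_alg_def)

lemma free_carrier_closed [simp, intro]:
  "0 \<in> free_carrier G" "1 \<in> free_carrier G" "scalar a \<in> free_carrier G"
  "p \<in> free_carrier G \<Longrightarrow> q \<in> free_carrier G \<Longrightarrow> p + q \<in> free_carrier G"
  "p \<in> free_carrier G \<Longrightarrow> - p \<in> free_carrier G"
  "p \<in> free_carrier G \<Longrightarrow> q \<in> free_carrier G \<Longrightarrow> p - q \<in> free_carrier G"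
  "p \<in> free_carrier G \<Longrightarrow> q \<in> free_carrier G \<Longrightarrow> p * q \<in> free_carrier G"
proof -
  show "scalar a \<in> free_carrier G" for a
    by (auto simp: free_carrier_def scalar_def letters_zero_word split: if_splits)
  show add: "p + q \<in> free_carrier G" if "p \<in> free_carrier G" "q \<in> free_carrier G" for p q
    using that keys_add[of p q] by (auto simp: free_carrier_def)
  show uminus: "- p \<in> free_carrier G" if "p \<in> free_carrier G" for p
    using that by (auto simp: free_carrier_def in_keys_iff)
  show "p - q \<in> free_carrier G" if "p \<in> free_carrier G" "q \<in> free_carrier G" for p q
    using add[OF that(1) uminus[OF that(2)]] by simp
  show "p * q \<in> free_carrier G" if "p \<in> free_carrier G" "q \<in> free_carrier G" for p q
    using that keys_mult[of p q] by (fastforce simp: free_carrier_def letters_plus_word)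
qed (auto simp: free_carrier_def letters_zero_word)

lemma gen_free_carrier [simp]: "gen g \<in> free_carrier G \<longleftrightarrow> g \<in> G"
  by (auto simp: free_carrier_def gen_def)

lemma single_free_carrier: "set (letters u) \<subseteq> G \<Longrightarrow> Poly_Mapping.single u a \<in> free_carrier G"
  by (auto simp: free_carrier_def split: if_splits)

lemma sum_free_carrier: "(\<And>i. i \<in> A \<Longrightarrow> f i \<in> free_carrier G) \<Longrightarrow> sum f A \<in> free_carrier G"
  by (induction A rule: infinite_finite_induct) auto

lemma keep_words_free_carrier: "p \<in> free_carrier G \<Longrightarrow> keep_words P p \<in> free_carrier G"
  by (auto simp: free_carrier_def keys_keep_words)

lemma ring_free_alg: "ring (free_alg G)"
proof (rule ringI)
  show "abelian_group (free_alg G)"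
  proof (rule abelian_groupI)
    fix x assume "x \<in> carrier (free_alg G)"
    then show "\<exists>y\<in>carrier (free_alg G). y \<oplus>\<^bsub>free_alg G\<^esub> x = \<zero>\<^bsub>free_alg G\<^esub>"
      by (intro bexI[of _ "- x"]) (auto simp: carrier_free_alg)
  qed (auto simp: carrier_free_alg algebra_simps)
  show "Group.monoid (free_alg G)"
    by (rule monoidI) (auto simp: carrier_free_alg algebra_simps)
qed (auto simp: carrier_free_alg algebra_simps)

lemma free_alg_a_inv: "p \<in> free_carrier G \<Longrightarrow> a_inv (free_alg G) p = - p"
  by (rule abelian_group.minus_equality[OF ring.is_abelian_group[OF ring_free_alg]])
    (auto simp: carrier_free_alg)

lemma free_alg_a_minus:
  "p \<in> free_carrier G \<Longrightarrow> q \<in> free_carrier G \<Longrightarrow> a_minus (free_alg G) p q = p - q"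
  by (simp add: a_minus_def free_alg_a_inv)

lemma ideal_free_algI:
  assumes "0 \<in> I" "I \<subseteq> free_carrier G"
    and "\<And>a b. a \<in> I \<Longrightarrow> b \<in> I \<Longrightarrow> a + b \<in> I"
    and "\<And>a x. a \<in> I \<Longrightarrow> x \<in> free_carrier G \<Longrightarrow> x * a \<in> I"
    and "\<And>a x. a \<in> I \<Longrightarrow> x \<in> free_carrier G \<Longrightarrow> a * x \<in> I"
  shows "ideal I (free_alg G)"
proof (rule idealI)
  show "subgroup I (add_monoid (free_alg G))"
  proof
    fix x assume x: "x \<in> I"
    have "inv\<^bsub>add_monoid (free_alg G)\<^esub> x = - x"
      using free_alg_a_inv[of x G] x assms(2) by (auto simp: a_inv_def)
    moreover have "- x \<in> I"
      using assms(4)[OF x, of "-1"] by simp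
    ultimately show "inv\<^bsub>add_monoid (free_alg G)\<^esub> x \<in> I"
      by simp
  qed (use assms in \<open>auto simp: carrier_free_alg\<close>)
qed (use assms ring_free_alg in \<open>auto simp: carrier_free_alg\<close>)

lemma reflections_subset: "reflections D \<subseteq> grp D"
  by (auto simp: reflections_def)

lemma letters_memI [simp, intro]:
  "Par_t \<in> all_letters D"
  "s \<in> reflections D \<Longrightarrow> Par_c (conj_class D s) \<in> all_letters D"
  "K \<in> refl_classes D \<Longrightarrow> Par_c K \<in> all_letters D"
  "w \<in> grp D \<Longrightarrow> Grp w \<in> all_letters D"
  "Vec y \<in> all_letters D"
  "x \<in> covectors D \<Longrightarrow> Cov x \<in> all_letters D"
  by (auto simp: all_letters_def par_letters_def refl_classes_def vec_letters_def cov_letters_def)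

context refl_group
begin

lemma vector_space_scl: "vector_space (scl D)"
  using fin_dim unfolding finite_dimensional_vector_space_def by blast

lemma grp_closed:
  "id \<in> grp D" "w \<in> grp D \<Longrightarrow> w' \<in> grp D \<Longrightarrow> w \<circ> w' \<in> grp D"
  "w \<in> grp D \<Longrightarrow> Vector_Spaces.linear (scl D) (scl D) w" "w \<in> grp D \<Longrightarrow> bij w"
proof -
  interpret W: subgroup "grp D" "GL_group (scl D)" by (rule grp_subgroup)
  show "id \<in> grp D"
    using W.one_closed by (simp add: GL_group_def)
  show "w \<circ> w' \<in> grp D" if "w \<in> grp D" "w' \<in> grp D" for w w'
    using W.m_closed[OF that] by (simp add: GL_group_def)
  show "Vector_Spaces.linear (scl D) (scl D) w" "bij w" if "w \<in> grp D" for w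
    using W.mem_carrier[OF that] by (auto simp: GL_group_def)
qed

lemma covectors_iff:
  "x \<in> covectors D \<longleftrightarrow> (\<forall>u v. x (u + v) = x u + x v) \<and> (\<forall>a v. x (scl D a v) = a * x v)"
  using vector_space_scl
  by (auto simp: covectors_def Vector_Spaces.linear_def module_hom_def module_hom_axioms_def
      vector_space_def Modules.module_def algebra_simps)

lemma linear_grp:
  assumes "w \<in> grp D"
  shows "w (u + v) = w u + w v" "w (scl D a v) = scl D a (w v)"
    "inv_into UNIV w (u + v) = inv_into UNIV w u + inv_into UNIV w v" "inv_into UNIV w (scl D a v) = scl D a (inv_into UNIV w v)"
proof -
  interpret w: Vector_Spaces.linear "scl D" "scl D" w by (rule grp_closed) fact
  show *: "w (u + v) = w u + w v" "w (scl D a v) = scl D a (w v)" for u v a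
    by (rule w.add w.scale)+
  have "inj w" "surj w" using grp_closed(4)[OF assms] by (auto simp: bij_def)
  then have "inv_into UNIV w (w z) = z" "w (inv_into UNIV w z) = z" for z
    by (simp_all add: surj_f_inv_f)
  note inv = this
  have "inv_into UNIV w (w (inv_into UNIV w u + inv_into UNIV w v)) = inv_into UNIV w u + inv_into UNIV w v"
    by (rule inv)
  then show "inv_into UNIV w (u + v) = inv_into UNIV w u + inv_into UNIV w v"
    by (simp only: * inv)
  have "inv_into UNIV w (w (scl D a (inv_into UNIV w v))) = scl D a (inv_into UNIV w v)"
    by (rule inv)
  then show "inv_into UNIV w (scl D a v) = scl D a (inv_into UNIV w v)"
    by (simp only: * inv)
qed

lemma coact_covector: "w \<in> grp D \<Longrightarrow> x \<in> covectors D \<Longrightarrow> coact w x \<in> covectors D"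
  by (simp add: covectors_iff coact_def linear_grp)

lemma covectors_closed:
  "x \<in> covectors D \<Longrightarrow> x' \<in> covectors D \<Longrightarrow> (\<lambda>v. x v + x' v) \<in> covectors D"
  "x \<in> covectors D \<Longrightarrow> (\<lambda>v. a * x v) \<in> covectors D"
  by (simp_all add: covectors_iff algebra_simps)

lemma smash_rels_carrier: "smash_rels D \<subseteq> free_carrier (all_letters D)"
proof -
  have par: "p \<in> all_letters D" if "p \<in> par_letters D" for p
    using that by (auto simp: all_letters_def)
  show ?thesis
    unfolding smash_rels_def vec_lin_rels_def cov_lin_rels_def
    by (auto intro!: free_carrier_closed simp: covectors_closed coact_covector grp_closed par)
qed

end

lemma commutation_rels_carrier: "commutation_rels D \<subseteq> free_carrier (all_letters D)"
  unfolding commutation_rels_def comm_rels_def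
  by (auto intro!: free_carrier_closed sum_free_carrier simp: cov_letters_def vec_letters_def
      dest: subsetD[OF reflections_subset])

section \<open>Complex reflections\<close>

context refl_group
begin

text \<open>Both sides are hyperplanes.  A vector of the kernel outside the fixed space would, together with
  \<open>\<alpha>\<^sub>s\<^sup>\<or>\<close>, extend a basis of the fixed space by two vectors.\<close>

lemma fixed_space_reflection:
  assumes s: "s \<in> reflections D"
  shows "fixed_space s = {v. alpha D s v = 0}"
proof (rule ccontr)
  assume ne: "fixed_space s \<noteq> {v. alpha D s v = 0}"
  have sub: "fixed_space s \<subseteq> {v. alpha D s v = 0}"
    using alpha_vanishes[OF s] by blast
  with ne obtain v where v: "alpha D s v = 0" "v \<notin> fixed_space s" by blast
  have sW: "s \<in> grp D" using s reflections_subset by blast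
  obtain B0 where "finite_dimensional_vector_space (scl D) B0" using fin_dim by blast
  then interpret V: finite_dimensional_vector_space "scl D" B0 .
  have \<alpha>: "alpha D s \<in> covectors D" by (rule alpha_covector[OF s])
  have ker: "V.subspace {v. alpha D s v = 0}"
  proof (rule V.subspaceI)
    show "0 \<in> {v. alpha D s v = 0}"
      using \<alpha> by (metis (mono_tags) add_cancel_right_right covectors_iff mem_Collect_eq)
  qed (use \<alpha> in \<open>auto simp: covectors_iff\<close>)
  have fixsub: "V.subspace (fixed_space s)"
  proof (rule V.subspaceI)
    show "0 \<in> fixed_space s"
      using linear_grp(1)[OF sW, of 0 0] by (simp add: fixed_space_def)
  qed (auto simp: fixed_space_def linear_grp[OF sW])
  obtain BK where BK: "BK \<subseteq> fixed_space s" "V.independent BK" "fixed_space s \<subseteq> V.span BK"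
    "card BK = V.dim (fixed_space s)"
    using V.basis_exists[of "fixed_space s"] by blast
  have span: "V.span BK = fixed_space s"
    using BK fixsub V.span_minimal by blast
  have "finite BK" by (rule V.finiteI_independent[OF BK(2)])
  have ind1: "V.independent (insert v BK)"
    using BK(2) v(2) span by (simp add: V.independent_insert)
  have sub1: "insert v BK \<subseteq> {v. alpha D s v = 0}"
    using v(1) BK(1) sub by auto
  have chk: "alpha_chk D s \<notin> {v. alpha D s v = 0}"
    using alpha_pairing[OF s] by simp
  then have notin: "alpha_chk D s \<notin> V.span (insert v BK)"
    using V.span_minimal[OF sub1 ker] by blast
  with ind1 have ind2: "V.independent (insert (alpha_chk D s) (insert v BK))"
    by (meson V.independent_insertI)
  have "v \<notin> BK" using v(2) BK(1) by blast
  moreover have "alpha_chk D s \<notin> insert v BK" using chk sub1 by blast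
  ultimately have "card (insert (alpha_chk D s) (insert v BK)) = V.dim (fixed_space s) + 2"
    using \<open>finite BK\<close> BK(4) by simp
  moreover have "card (insert (alpha_chk D s) (insert v BK)) \<le> V.dim UNIV"
    by (rule V.independent_card_le_dim[OF _ ind2]) simp
  ultimately show False
    using s by (simp add: reflections_def)
qed

text \<open>The map \<open>s - 1\<close> kills the hyperplane \<open>\<alpha>\<^sub>s = 0\<close>, so its image is a line.  A covector is fixed by \<open>s\<close>
  iff it kills that line, and then it kills \<open>\<alpha>\<^sub>s\<^sup>\<or>\<close>; hence \<open>\<alpha>\<^sub>s\<^sup>\<or>\<close> spans the line.  The eigenvalue \<open>l\<close> is not 1
  because \<open>\<alpha>\<^sub>s\<^sup>\<or>\<close> is not fixed.\<close>

lemma reflection_formula_ex: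
  assumes s: "s \<in> reflections D"
  shows "\<exists>l. l \<noteq> 0 \<and> l \<noteq> 1 \<and> (\<forall>v. s v = v + scl D ((l - 1) / 2 * alpha D s v) (alpha_chk D s))"
proof -
  have sW: "s \<in> grp D" using s reflections_subset by blast
  obtain B0 where "finite_dimensional_vector_space (scl D) B0" using fin_dim by blast
  then interpret V: finite_dimensional_vector_space "scl D" B0 .
  have \<alpha>: "alpha D s \<in> covectors D" by (rule alpha_covector[OF s])
  define u where "u = s (alpha_chk D s) - alpha_chk D s"
  have u0: "u \<noteq> 0"
  proof
    assume "u = 0"
    then have "alpha_chk D s \<in> fixed_space s" by (simp add: u_def fixed_space_def)
    then show False using fixed_space_reflection[OF s] alpha_pairing[OF s] by auto
  qed
  have chk0: "alpha_chk D s \<noteq> 0"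
  proof
    assume "alpha_chk D s = 0"
    moreover have "alpha D s 0 = 0"
      using \<alpha> by (metis add_cancel_right_right covectors_iff)
    ultimately show False using alpha_pairing[OF s] by simp
  qed
  have sv: "s v = v + scl D (alpha D s v / 2) u" for v
  proof -
    let ?k = "alpha D s v / 2"
    define k where "k = v - scl D ?k (alpha_chk D s)"
    have v: "v = k + scl D ?k (alpha_chk D s)" by (simp add: k_def)
    have "alpha D s v = alpha D s k + ?k * 2"
      by (subst v) (use \<alpha> alpha_pairing[OF s] in \<open>simp only: covectors_iff\<close>)
    then have "k \<in> fixed_space s"
      using fixed_space_reflection[OF s] by simp
    then have "s k = k" by (simp add: fixed_space_def)
    moreover have "s v = s k + scl D ?k (s (alpha_chk D s))"
      by (subst v) (simp only: linear_grp[OF sW])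
    ultimately have "s v = k + scl D ?k (alpha_chk D s + u)"
      by (simp add: u_def)
    also have "\<dots> = v + scl D ?k u"
      by (simp add: k_def V.scale_right_distrib)
    finally show ?thesis .
  qed
  have "alpha_chk D s \<in> V.span {u}"
  proof (rule ccontr)
    assume n: "alpha_chk D s \<notin> V.span {u}"
    then have ind: "V.independent {alpha_chk D s, u}"
      using u0 by (intro V.independent_insertI) (auto simp: V.independent_empty)
    define E where "E = V.extend_basis {alpha_chk D s, u}"
    have E: "V.independent E" "V.span E = UNIV" "{alpha_chk D s, u} \<subseteq> E"
      using V.independent_extend_basis[OF ind] V.span_extend_basis[OF ind]
        V.extend_basis_superset[OF ind] by (auto simp: E_def)
    define \<xi> where "\<xi> = (\<lambda>v. V.representation E v (alpha_chk D s))"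
    have \<xi>: "\<xi> \<in> covectors D"
      unfolding covectors_iff \<xi>_def
      using E by (simp add: V.representation_add V.representation_scale)
    have "alpha_chk D s \<noteq> u" using n V.span_base[of u "{u}"] by auto
    then have \<xi>u: "\<xi> u = 0" and \<xi>c: "\<xi> (alpha_chk D s) = 1"
      using E by (auto simp: \<xi>_def V.representation_basis)
    have "\<xi> (s v) = \<xi> v" for v
      using \<xi> \<xi>u by (subst sv) (simp add: covectors_iff)
    moreover have "s (inv_into UNIV s v) = v" for v
      using grp_closed(4)[OF sW] by (simp add: bij_def surj_f_inv_f)
    ultimately have "coact s \<xi> = \<xi>"
      unfolding coact_def by (metis comp_apply ext)
    with alpha_chk_vanishes[OF s \<xi>] \<xi>c show False by simp
  qed
  then obtain r where r: "alpha_chk D s = scl D r u"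
    by (auto simp: V.span_singleton)
  with chk0 have r0: "r \<noteq> 0" by auto
  have u: "u = scl D (1 / r) (alpha_chk D s)"
    using r r0 by simp
  define l where "l = 1 + 1 / r"
  have f: "s v = v + scl D ((l - 1) / 2 * alpha D s v) (alpha_chk D s)" for v
    unfolding sv[of v] u by (simp add: l_def field_simps)
  have "l \<noteq> 0"
  proof
    assume "l = 0"
    with f[of "alpha_chk D s"] alpha_pairing[OF s] have "s (alpha_chk D s) = 0"
      by simp
    moreover have "s 0 = 0" using linear_grp(1)[OF sW, of 0 0] by simp
    ultimately show False
      using chk0 grp_closed(4)[OF sW] by (metis bij_pointE)
  qed
  moreover have "l \<noteq> 1" using r0 by (simp add: l_def)
  ultimately show ?thesis using f by blast
qed

definition refl_eig :: "('v \<Rightarrow> 'v) \<Rightarrow> complex" where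
  "refl_eig s = (SOME l. l \<noteq> 0 \<and> l \<noteq> 1 \<and>
     (\<forall>v. s v = v + scl D ((l - 1) / 2 * alpha D s v) (alpha_chk D s)))"

lemma refl_eig:
  assumes "s \<in> reflections D"
  shows "refl_eig s \<noteq> 0" "refl_eig s \<noteq> 1"
    "s v = v + scl D ((refl_eig s - 1) / 2 * alpha D s v) (alpha_chk D s)"
  using someI_ex[OF reflection_formula_ex[OF assms]] unfolding refl_eig_def by blast+

lemma alpha_chk_nonzero:
  assumes "s \<in> reflections D" shows "alpha_chk D s \<noteq> 0"
proof
  assume "alpha_chk D s = 0"
  moreover have "alpha D s 0 = 0"
    using alpha_covector[OF assms] by (metis add_cancel_right_right covectors_iff)
  ultimately show False using alpha_pairing[OF assms] by simp
qed

lemma refl_alpha_chk: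
  assumes "s \<in> reflections D" shows "s (alpha_chk D s) = scl D (refl_eig s) (alpha_chk D s)"
proof -
  interpret V: vector_space "scl D" by (rule vector_space_scl)
  have "s (alpha_chk D s) = scl D 1 (alpha_chk D s) + scl D (refl_eig s - 1) (alpha_chk D s)"
    using refl_eig(3)[OF assms, of "alpha_chk D s"] alpha_pairing[OF assms] by simp
  also have "\<dots> = scl D (refl_eig s) (alpha_chk D s)"
    by (simp only: V.scale_left_distrib[symmetric]) simp
  finally show ?thesis .
qed

lemma refl_power:
  assumes s: "s \<in> reflections D"
  shows "(s ^^ i) v = v + scl D ((refl_eig s ^ i - 1) / 2 * alpha D s v) (alpha_chk D s)"
proof (induction i)
  case 0
  interpret V: vector_space "scl D" by (rule vector_space_scl)
  show ?case by simp
next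
  case (Suc i)
  interpret V: vector_space "scl D" by (rule vector_space_scl)
  have sW: "s \<in> grp D" using s reflections_subset by blast
  have "(s ^^ Suc i) v = s v + scl D ((refl_eig s ^ i - 1) / 2 * alpha D s v) (s (alpha_chk D s))"
    by (simp add: Suc.IH linear_grp[OF sW])
  also have "\<dots> = v + scl D ((refl_eig s - 1) / 2 * alpha D s v
      + (refl_eig s ^ i - 1) / 2 * alpha D s v * refl_eig s) (alpha_chk D s)"
    by (simp add: refl_eig(3)[OF s, of v] refl_alpha_chk[OF s] V.scale_left_distrib add.assoc)
  also have "(refl_eig s - 1) / 2 * alpha D s v + (refl_eig s ^ i - 1) / 2 * alpha D s v * refl_eig s
     = (refl_eig s ^ Suc i - 1) / 2 * alpha D s v"
    by (simp add: field_simps)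
  finally show ?case .
qed

lemma grp_power: "w \<in> grp D \<Longrightarrow> w ^^ i \<in> grp D"
  by (induction i) (auto simp: grp_closed)

lemma coact_refl_power:
  assumes s: "s \<in> reflections D" and x: "x \<in> covectors D"
  shows "coact (s ^^ i) x =
    (\<lambda>v. x v + (inverse (refl_eig s) ^ i - 1) / 2 * x (alpha_chk D s) * alpha D s v)"
proof
  fix v
  interpret V: vector_space "scl D" by (rule vector_space_scl)
  have sW: "s ^^ i \<in> grp D" using s reflections_subset grp_power by blast
  let ?l = "refl_eig s ^ i"
  let ?u = "v + scl D ((inverse ?l - 1) / 2 * alpha D s v) (alpha_chk D s)"
  have l: "?l \<noteq> 0" using refl_eig(1)[OF s] by simp
  have \<alpha>u: "alpha D s ?u = inverse ?l * alpha D s v"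
    using alpha_covector[OF s] alpha_pairing[OF s] by (simp add: covectors_iff field_simps)
  have "(s ^^ i) ?u = v + scl D ((inverse ?l - 1) / 2 * alpha D s v +
      (?l - 1) / 2 * (inverse ?l * alpha D s v)) (alpha_chk D s)"
    unfolding refl_power[OF s, of i ?u] \<alpha>u by (simp add: V.scale_left_distrib add.assoc)
  also have "(inverse ?l - 1) / 2 * alpha D s v + (?l - 1) / 2 * (inverse ?l * alpha D s v) = 0"
    using l by (simp add: field_simps)
  finally have "(s ^^ i) ?u = v" by simp
  then have "inv_into UNIV (s ^^ i) v = ?u"
    using grp_closed(4)[OF sW] by (metis bij_is_inj inv_f_f)
  then show "coact (s ^^ i) x v =
      x v + (inverse (refl_eig s) ^ i - 1) / 2 * x (alpha_chk D s) * alpha D s v"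
    using x by (simp add: coact_def covectors_iff power_inverse)
qed

lemma coact_refl:
  assumes s: "s \<in> reflections D" and x: "x \<in> covectors D"
  shows "coact s x = (\<lambda>v. x v + (inverse (refl_eig s) - 1) / 2 * x (alpha_chk D s) * alpha D s v)"
  using coact_refl_power[OF assms, of 1] by simp

lemma refl_eig_root_of_unity:
  assumes s: "s \<in> reflections D" shows "\<exists>n>0. refl_eig s ^ n = 1"
proof -
  interpret V: vector_space "scl D" by (rule vector_space_scl)
  have sW: "s \<in> grp D" using s reflections_subset by blast
  have "finite (range (\<lambda>i. s ^^ i))"
    by (rule finite_subset[OF _ finite_grp]) (auto intro: grp_power[OF sW])
  then have "\<not> inj (\<lambda>i::nat. s ^^ i)"
    using finite_imageD infinite_UNIV_nat by blast
  then obtain i j :: nat where "i \<noteq> j" and eq0: "s ^^ i = s ^^ j"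
    by (auto simp: inj_def)
  then obtain i j :: nat where ij: "i < j" and eq: "s ^^ i = s ^^ j"
    by (metis linorder_neqE_nat)
  from eq have "(s ^^ i) (alpha_chk D s) = (s ^^ j) (alpha_chk D s)" by simp
  then have "scl D (refl_eig s ^ i - 1) (alpha_chk D s) = scl D (refl_eig s ^ j - 1) (alpha_chk D s)"
    by (simp add: refl_power[OF s] alpha_pairing[OF s])
  then have "refl_eig s ^ i = refl_eig s ^ j"
    using alpha_chk_nonzero[OF s] by (simp add: V.scale_cancel_right)
  also have "refl_eig s ^ j = refl_eig s ^ i * refl_eig s ^ (j - i)"
    using ij by (simp flip: power_add)
  finally have "refl_eig s ^ (j - i) = 1"
    using refl_eig(1)[OF s] by simp
  with ij show ?thesis by (intro exI[of _ "j - i"]) auto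
qed

definition conjugate :: "('v \<Rightarrow> 'v) \<Rightarrow> ('v \<Rightarrow> 'v) \<Rightarrow> 'v \<Rightarrow> 'v" where
  "conjugate w s = w \<circ> s \<circ> inv_into UNIV w"

text \<open>In a finite group the inverse of \<open>w\<close> is a power of \<open>w\<close>.\<close>

lemma grp_inv:
  assumes "w \<in> grp D" shows "inv_into UNIV w \<in> grp D"
proof -
  interpret W: subgroup "grp D" "GL_group (scl D)" by (rule grp_subgroup)
  have "finite (range (\<lambda>i. w ^^ i))"
    by (rule finite_subset[OF _ finite_grp]) (auto intro: grp_power[OF assms])
  then have "\<not> inj (\<lambda>i::nat. w ^^ i)"
    using finite_imageD infinite_UNIV_nat by blast
  then obtain i j :: nat where "i \<noteq> j" "w ^^ i = w ^^ j"
    by (auto simp: inj_def)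
  then obtain i j :: nat where ij: "i < j" and eq: "w ^^ i = w ^^ j"
    by (metis linorder_neqE_nat)
  have bij: "bij (w ^^ i)" using grp_closed(4)[OF grp_power[OF assms]] .
  have "(w ^^ i) ((w ^^ (j - i)) v) = (w ^^ i) v" for v
    using ij eq by (metis add_diff_inverse_nat comp_apply funpow_add not_less_iff_gr_or_eq)
  then have *: "(w ^^ (j - i)) v = v" for v
    using bij by (metis bij_pointE)
  have "w ((w ^^ (j - i - 1)) v) = v" for v
    using *[of v] ij by (metis Suc_diff_1 comp_apply funpow.simps(2) zero_less_diff)
  then have "inv_into UNIV w = w ^^ (j - i - 1)"
    using grp_closed(4)[OF assms] by (metis bij_is_inj ext inv_f_f)
  then show ?thesis using grp_power[OF assms] by simp
qed

lemma inv_grp_simps: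
  assumes "w \<in> grp D"
  shows "w (inv_into UNIV w v) = v" "inv_into UNIV w (w v) = v"
  using grp_closed(4)[OF assms] by (simp_all add: bij_def surj_f_inv_f)

lemma conjugate_reflection:
  assumes w: "w \<in> grp D" and s: "s \<in> reflections D"
  shows "conjugate w s \<in> reflections D"
proof -
  obtain B0 where "finite_dimensional_vector_space (scl D) B0" using fin_dim by blast
  then interpret V: finite_dimensional_vector_space "scl D" B0 .
  interpret VV: finite_dimensional_vector_space_pair_1 "scl D" B0 "scl D" ..
  have sW: "s \<in> grp D" using s reflections_subset by blast
  have "fixed_space (conjugate w s) = w ` fixed_space s"
  proof (intro equalityI subsetI)
    fix v assume "v \<in> fixed_space (conjugate w s)"
    then have "w (s (inv_into UNIV w v)) = v" by (simp add: fixed_space_def conjugate_def)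
    then have "s (inv_into UNIV w v) = inv_into UNIV w v"
      by (metis inv_grp_simps(2) w)
    then show "v \<in> w ` fixed_space s"
      by (intro image_eqI[of _ _ "inv_into UNIV w v"]) (auto simp: fixed_space_def inv_grp_simps w)
  qed (auto simp: fixed_space_def conjugate_def inv_grp_simps[OF w])
  moreover have "V.dim (w ` fixed_space s) = V.dim (fixed_space s)"
    using VV.dim_image_eq[OF grp_closed(3)[OF w]] grp_closed(4)[OF w]
    by (metis bij_is_inj inj_on_subset subset_UNIV)
  ultimately show ?thesis
    using s w sW by (simp add: reflections_def conjugate_def grp_closed grp_inv)
qed

lemma conj_class_conjugate:
  assumes w: "w \<in> grp D"
  shows "conj_class D (conjugate w s) = conj_class D s"
proof (intro equalityI subsetI)
  have inv_comp: "inv_into UNIV (u \<circ> u') = inv_into UNIV u' \<circ> inv_into UNIV u"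
    if "u \<in> grp D" "u' \<in> grp D" for u u'
    using that by (intro o_inv_distrib grp_closed)
  show "g \<in> conj_class D s" if g: "g \<in> conj_class D (conjugate w s)" for g
  proof -
    obtain u where "u \<in> grp D" "g = u \<circ> (w \<circ> s \<circ> inv_into UNIV w) \<circ> inv_into UNIV u"
      using g by (auto simp: conj_class_def conjugate_def)
    then show ?thesis
      unfolding conj_class_def using w
      by (intro CollectI exI[of _ "u \<circ> w"]) (auto simp: inv_comp o_assoc grp_closed)
  qed
  show "g \<in> conj_class D (conjugate w s)" if g: "g \<in> conj_class D s" for g
  proof -
    obtain u where u: "u \<in> grp D" "g = u \<circ> s \<circ> inv_into UNIV u"
      using g by (auto simp: conj_class_def)
    have iw: "inv_into UNIV w \<in> grp D" by (rule grp_inv[OF w])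
    have "inv_into UNIV (inv_into UNIV w) = w"
      using grp_closed(4)[OF w] by (rule inv_inv_eq)
    then have "g = (u \<circ> inv_into UNIV w) \<circ> conjugate w s \<circ> inv_into UNIV (u \<circ> inv_into UNIV w)"
      using u iw by (auto simp: inv_comp conjugate_def fun_eq_iff inv_grp_simps[OF w])
    then show ?thesis
      unfolding conj_class_def using u iw by (blast intro: grp_closed)
  qed
qed

text \<open>The eigenvalue other than 1 characterises \<open>refl_eig s\<close>; this makes it a class function.\<close>

lemma refl_eig_unique:
  assumes s: "s \<in> reflections D" and v: "s v = scl D l v" "v \<noteq> 0" "l \<noteq> 1"
  shows "l = refl_eig s"
proof -
  interpret V: vector_space "scl D" by (rule vector_space_scl)
  have sW: "s \<in> grp D" using s reflections_subset by blast
  have "scl D (l - 1) v = scl D ((refl_eig s - 1) / 2 * alpha D s v) (alpha_chk D s)" (is "_ = scl D ?k _")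
    using refl_eig(3)[OF s, of v] v(1) by (simp add: V.scale_left_diff_distrib)
  then have "scl D (inverse (l - 1)) (scl D (l - 1) v) = scl D (inverse (l - 1) * ?k) (alpha_chk D s)"
    by simp
  then have v': "v = scl D (inverse (l - 1) * ?k) (alpha_chk D s)" (is "_ = scl D ?m _")
    using v(3) by simp
  have "scl D l v = scl D ?m (scl D (refl_eig s) (alpha_chk D s))"
    using v(1) by (subst v(1)[symmetric], subst v') (simp only: linear_grp[OF sW] refl_alpha_chk[OF s])
  also have "\<dots> = scl D (refl_eig s) v"
    by (subst (2) v') (simp add: mult.commute mult.left_commute)
  finally show ?thesis using v(2) by (simp add: V.scale_cancel_right)
qed

lemma refl_eig_conjugate:
  assumes w: "w \<in> grp D" and s: "s \<in> reflections D"
  shows "refl_eig (conjugate w s) = refl_eig s"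
proof -
  have sW: "s \<in> grp D" using s reflections_subset by blast
  have "conjugate w s (w (alpha_chk D s)) = scl D (refl_eig s) (w (alpha_chk D s))"
    by (simp add: conjugate_def inv_grp_simps[OF w] refl_alpha_chk[OF s] linear_grp[OF w])
  moreover have "w (alpha_chk D s) \<noteq> 0"
    using alpha_chk_nonzero[OF s] linear_grp(1)[OF w, of 0 0] inv_grp_simps(2)[OF w]
    by (metis add_cancel_right_right)
  ultimately show ?thesis
    using refl_eig_unique[OF conjugate_reflection[OF w s]] refl_eig(2)[OF s] by metis
qed

lemma bij_betw_conjugate:
  assumes w: "w \<in> grp D" shows "bij_betw (conjugate w) (reflections D) (reflections D)"
proof (rule bij_betw_byWitness[where f' = "conjugate (inv_into UNIV w)"])
  have iw: "inv_into UNIV w \<in> grp D" by (rule grp_inv[OF w])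
  have ii: "inv_into UNIV (inv_into UNIV w) = w"
    using grp_closed(4)[OF w] by (rule inv_inv_eq)
  show "\<forall>s\<in>reflections D. conjugate (inv_into UNIV w) (conjugate w s) = s"
    "\<forall>s\<in>reflections D. conjugate w (conjugate (inv_into UNIV w) s) = s"
    using ii by (auto simp: conjugate_def fun_eq_iff inv_grp_simps[OF w])
  show "conjugate w ` reflections D \<subseteq> reflections D"
    "conjugate (inv_into UNIV w) ` reflections D \<subseteq> reflections D"
    using conjugate_reflection[OF w] conjugate_reflection[OF iw] by auto
qed

end

section \<open>Relations modulo an ideal\<close>

text \<open>The ideals of interest are the preimages of ideals of \<open>univ_alg D\<close>: the zero ideal, the ideal of
  \<open>t\<close>, and the ideals defining the specialised algebras.  Letters foreign to \<open>D\<close> are put to zero,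
  which makes these preimages ideals of the ring of all tensors.\<close>

locale cherednik_congruence = refl_group D + two_sided_ideal J
  for D :: "'v::ab_group_add refl_data" and J :: "'v tensor set" +
  assumes rels_mem: "smash_rels D \<subseteq> J" "commutation_rels D \<subseteq> J"
    and foreign_mem: "g \<notin> all_letters D \<Longrightarrow> gen g \<in> J"
begin

lemma foreign_commute: "g \<notin> all_letters D \<Longrightarrow> z * gen g - gen g * z \<in> J"
  using foreign_mem[of g] diff_mem[OF mult_left_mem mult_right_mem] by blast

text \<open>The position of a relation in the left-nested union is given explicitly; a search through the
  comprehensions would be expensive.\<close>

lemma smash_rels_mem:
  "p \<in> par_letters D \<Longrightarrow> g \<in> all_letters D \<Longrightarrow> gen p * gen g - gen g * gen p \<in> J"
  "gen (Vec (y + y')) - gen (Vec y) - gen (Vec y') \<in> J"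
  "gen (Vec (scl D a y)) - scalar a * gen (Vec y) \<in> J"
  "x \<in> covectors D \<Longrightarrow> x' \<in> covectors D \<Longrightarrow>
     gen (Cov (\<lambda>v. x v + x' v)) - gen (Cov x) - gen (Cov x') \<in> J"
  "x \<in> covectors D \<Longrightarrow> gen (Cov (\<lambda>v. a * x v)) - scalar a * gen (Cov x) \<in> J"
  "gen (Grp id) - 1 \<in> J"
  "w \<in> grp D \<Longrightarrow> w' \<in> grp D \<Longrightarrow> gen (Grp w) * gen (Grp w') - gen (Grp (w \<circ> w')) \<in> J"
  "w \<in> grp D \<Longrightarrow> gen (Grp w) * gen (Vec y) - gen (Vec (w y)) * gen (Grp w) \<in> J"
  "w \<in> grp D \<Longrightarrow> x \<in> covectors D \<Longrightarrow>
     gen (Grp w) * gen (Cov x) - gen (Cov (coact w x)) * gen (Grp w) \<in> J"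
          apply (rule subsetD[OF rels_mem(1)], unfold smash_rels_def)
          apply (rule UnI1, rule UnI1, rule UnI1, rule UnI1, rule UnI1, rule UnI1)
          apply (rule CollectI, (rule exI)+, rule conjI, rule refl, simp)
         apply (rule subsetD[OF rels_mem(1)], unfold smash_rels_def vec_lin_rels_def)
         apply (rule UnI1, rule UnI1, rule UnI1, rule UnI1, rule UnI1, rule UnI2, rule UnI1)
         apply (rule CollectI, (rule exI)+, rule conjI, rule refl, rule TrueI)
        apply (rule subsetD[OF rels_mem(1)], unfold smash_rels_def vec_lin_rels_def)
        apply (rule UnI1, rule UnI1, rule UnI1, rule UnI1, rule UnI1, rule UnI2, rule UnI2)
        apply (rule CollectI, (rule exI)+, rule conjI, rule refl, rule TrueI)
       apply (rule subsetD[OF rels_mem(1)], unfold smash_rels_def cov_lin_rels_def)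
       apply (rule UnI1, rule UnI1, rule UnI1, rule UnI1, rule UnI2, rule UnI1)
       apply (rule CollectI, (rule exI)+, rule conjI, rule refl, simp)
      apply (rule subsetD[OF rels_mem(1)], unfold smash_rels_def cov_lin_rels_def)
      apply (rule UnI1, rule UnI1, rule UnI1, rule UnI1, rule UnI2, rule UnI2)
      apply (rule CollectI, (rule exI)+, rule conjI, rule refl, simp)
     apply (rule subsetD[OF rels_mem(1)], unfold smash_rels_def)
     apply (rule UnI1, rule UnI1, rule UnI1, rule UnI2, rule singletonI)
    apply (rule subsetD[OF rels_mem(1)], unfold smash_rels_def)
    apply (rule UnI1, rule UnI1, rule UnI2)
    apply (rule CollectI, (rule exI)+, rule conjI, rule refl, simp)
   apply (rule subsetD[OF rels_mem(1)], unfold smash_rels_def)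
   apply (rule UnI1, rule UnI2)
   apply (rule CollectI, (rule exI)+, rule conjI, rule refl, simp)
  apply (rule subsetD[OF rels_mem(1)], unfold smash_rels_def)
  apply (rule UnI2)
  apply (rule CollectI, (rule exI)+, rule conjI, rule refl, simp)
  done

lemma commutation_rels_mem:
  "x \<in> covectors D \<Longrightarrow> x' \<in> covectors D \<Longrightarrow> gen (Cov x) * gen (Cov x') - gen (Cov x') * gen (Cov x) \<in> J"
  "gen (Vec y) * gen (Vec y') - gen (Vec y') * gen (Vec y) \<in> J"
  "x \<in> covectors D \<Longrightarrow>
     (gen (Vec y) * gen (Cov x) - gen (Cov x) * gen (Vec y))
        - (gen Par_t * scalar (x y)
            - (\<Sum>s\<in>reflections D. gen (Par_c (conj_class D s))
                 * scalar (x (alpha_chk D s) * alpha D s y) * gen (Grp s))) \<in> J"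
    apply (rule subsetD[OF rels_mem(2)], unfold commutation_rels_def comm_rels_def cov_letters_def)
    apply (rule UnI1, rule UnI1)
    apply (rule CollectI, (rule exI)+, rule conjI, rule refl, simp)
   apply (rule subsetD[OF rels_mem(2)], unfold commutation_rels_def comm_rels_def vec_letters_def)
   apply (rule UnI1, rule UnI2)
   apply (rule CollectI, (rule exI)+, rule conjI, rule refl, simp)
  apply (rule subsetD[OF rels_mem(2)], unfold commutation_rels_def)
  apply (rule UnI2)
  apply (rule CollectI, (rule exI)+, rule conjI, rule refl, simp)
  done

lemma par_central:
  assumes "p \<in> par_letters D"
  shows "gen p * q \<doteq> q * gen p"
proof -
  have "gen p * gen g - gen g * gen p \<in> J" for g
    using smash_rels_mem(1)[OF assms] foreign_commute by blast
  then show ?thesis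
    unfolding cong_def by (rule free_algebra_commutator_mem[OF two_sided_ideal_axioms])
qed

lemma vec_rels:
  "gen (Vec (y + y')) \<doteq> gen (Vec y) + gen (Vec y')"
  "gen (Vec (scl D a y)) \<doteq> scalar a * gen (Vec y)"
  using smash_rels_mem(2)[of y y'] smash_rels_mem(3)[of a y] by (simp_all add: cong_def algebra_simps)

lemma cov_rels:
  assumes "x \<in> covectors D"
  shows "x' \<in> covectors D \<Longrightarrow> gen (Cov (\<lambda>v. x v + x' v)) \<doteq> gen (Cov x) + gen (Cov x')"
    "gen (Cov (\<lambda>v. a * x v)) \<doteq> scalar a * gen (Cov x)"
  using smash_rels_mem(4)[OF assms, of x'] smash_rels_mem(5)[OF assms, of a]
  by (simp_all add: cong_def diff_diff_eq)

lemma vec_sum: "gen (Vec (\<Sum>b\<in>B. scl D (f b) (y b))) \<doteq> (\<Sum>b\<in>B. scalar (f b) * gen (Vec (y b)))"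
proof -
  interpret V: vector_space "scl D" by (rule vector_space_scl)
  have "gen (Vec (scl D 0 0)) \<doteq> scalar 0 * gen (Vec 0)" by (rule vec_rels)
  then have 0: "gen (Vec 0) \<doteq> 0" by (simp add: scalar_simps)
  show ?thesis
  proof (induction B rule: infinite_finite_induct)
    case (insert b B)
    have "gen (Vec (scl D (f b) (y b) + (\<Sum>b\<in>B. scl D (f b) (y b)))) \<doteq>
        gen (Vec (scl D (f b) (y b))) + gen (Vec (\<Sum>b\<in>B. scl D (f b) (y b)))"
      by (rule vec_rels)
    also have "\<dots> \<doteq> scalar (f b) * gen (Vec (y b)) + (\<Sum>b\<in>B. scalar (f b) * gen (Vec (y b)))"
      by (intro cong_add vec_rels insert)
    finally show ?case using insert by simp
  qed (simp_all add: 0)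
qed

lemma covector_sum: "(\<And>b. b \<in> B \<Longrightarrow> x b \<in> covectors D) \<Longrightarrow> (\<lambda>v. \<Sum>b\<in>B. f b * x b v) \<in> covectors D"
  by (auto simp: covectors_iff sum.distrib algebra_simps sum_distrib_left)

lemma cov_sum:
  assumes "\<And>b. b \<in> B \<Longrightarrow> x b \<in> covectors D"
  shows "gen (Cov (\<lambda>v. \<Sum>b\<in>B. f b * x b v)) \<doteq> (\<Sum>b\<in>B. scalar (f b) * gen (Cov (x b)))"
proof -
  have "(\<lambda>v. 0) \<in> covectors D" by (simp add: covectors_iff)
  then have "gen (Cov (\<lambda>v. 0 * 0)) \<doteq> scalar 0 * gen (Cov (\<lambda>v. 0))" by (rule cov_rels)
  then have 0: "gen (Cov (\<lambda>v. 0)) \<doteq> 0" by (simp add: scalar_simps)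
  show ?thesis using assms
  proof (induction B rule: infinite_finite_induct)
    case (insert b B)
    have "gen (Cov (\<lambda>v. f b * x b v + (\<Sum>b\<in>B. f b * x b v))) \<doteq>
        gen (Cov (\<lambda>v. f b * x b v)) + gen (Cov (\<lambda>v. \<Sum>b\<in>B. f b * x b v))"
      by (intro cov_rels covectors_closed covector_sum insert) auto
    also have "\<dots> \<doteq> scalar (f b) * gen (Cov (x b)) + (\<Sum>b\<in>B. scalar (f b) * gen (Cov (x b)))"
      by (intro cong_add cov_rels insert) auto
    finally show ?case using insert by simp
  qed (simp_all add: 0)
qed

lemma grp_rels:
  "gen (Grp id) \<doteq> 1"
  "w \<in> grp D \<Longrightarrow> w' \<in> grp D \<Longrightarrow> gen (Grp w) * gen (Grp w') \<doteq> gen (Grp (w \<circ> w'))"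
  "w \<in> grp D \<Longrightarrow> gen (Grp w) * gen (Vec y) \<doteq> gen (Vec (w y)) * gen (Grp w)"
  "w \<in> grp D \<Longrightarrow> x \<in> covectors D \<Longrightarrow> gen (Grp w) * gen (Cov x) \<doteq> gen (Cov (coact w x)) * gen (Grp w)"
  by (simp_all only: cong_def smash_rels_mem)

lemma comm_rels_cong:
  "x \<in> covectors D \<Longrightarrow> x' \<in> covectors D \<Longrightarrow> gen (Cov x) * gen (Cov x') \<doteq> gen (Cov x') * gen (Cov x)"
  "gen (Vec y) * gen (Vec y') \<doteq> gen (Vec y') * gen (Vec y)"
  by (simp_all only: cong_def commutation_rels_mem)

definition refl_sum :: "('v \<Rightarrow> complex) \<Rightarrow> 'v \<Rightarrow> 'v tensor" where
  "refl_sum x y = (\<Sum>s\<in>reflections D. gen (Par_c (conj_class D s))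
     * scalar (x (alpha_chk D s) * alpha D s y) * gen (Grp s))"

lemma vec_cov_rel:
  assumes "x \<in> covectors D"
  shows "gen (Vec y) * gen (Cov x) - gen (Cov x) * gen (Vec y) \<doteq> gen Par_t * scalar (x y) - refl_sum x y"
  unfolding cong_def refl_sum_def by (rule commutation_rels_mem(3)[OF assms])

lemma letter_cases:
  assumes "g \<in> all_letters D"
  obtains "g \<in> par_letters D" | w where "g = Grp w" "w \<in> grp D" | y where "g = Vec y"
    | x where "g = Cov x" "x \<in> covectors D"
  using assms by (auto simp: all_letters_def vec_letters_def cov_letters_def)

text \<open>The parameters are central by the defining relations, so they need no hypothesis.\<close>

lemma central_memI:
  assumes "\<And>w. w \<in> grp D \<Longrightarrow> z * gen (Grp w) - gen (Grp w) * z \<in> J"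
    and "\<And>y. z * gen (Vec y) - gen (Vec y) * z \<in> J"
    and "\<And>x. x \<in> covectors D \<Longrightarrow> z * gen (Cov x) - gen (Cov x) * z \<in> J"
  shows "z * q - q * z \<in> J"
proof (rule free_algebra_commutator_mem[OF two_sided_ideal_axioms])
  fix g
  show "z * gen g - gen g * z \<in> J"
  proof (cases "g \<in> all_letters D")
    case True
    then show ?thesis
    proof (cases rule: letter_cases)
      case 1
      from par_central[OF this, of z] show ?thesis by (metis cong_def cong_sym)
    qed (use assms in auto)
  qed (rule foreign_commute)
qed

end

section \<open>The Euler element\<close>

context refl_group
begin

definition hbasis :: "'v set" where
  "hbasis = (SOME B. finite_dimensional_vector_space (scl D) B)"

lemma hbasis: "finite_dimensional_vector_space (scl D) hbasis"
  unfolding hbasis_def using someI_ex[OF fin_dim] .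

lemma finite_hbasis: "finite hbasis"
  using hbasis finite_dimensional_vector_space.finite_Basis by blast

definition coord :: "'v \<Rightarrow> 'v \<Rightarrow> complex" where
  "coord b = (\<lambda>v. module.representation (scl D) hbasis v b)"

lemma coord_covector: "coord b \<in> covectors D"
proof -
  interpret V: finite_dimensional_vector_space "scl D" hbasis by (rule hbasis)
  show ?thesis
    unfolding covectors_iff coord_def
    by (simp add: V.representation_add V.representation_scale V.independent_Basis V.span_Basis)
qed

lemma coord_expand: "(\<Sum>b\<in>hbasis. scl D (coord b v) b) = v"
proof -
  interpret V: finite_dimensional_vector_space "scl D" hbasis by (rule hbasis)
  show ?thesis
    unfolding coord_def
    by (rule V.sum_representation_eq) (auto simp: V.independent_Basis V.span_Basis V.finite_Basis)
qed

lemma covector_expand: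
  assumes "x \<in> covectors D" shows "(\<Sum>b\<in>hbasis. x b * coord b v) = x v"
proof -
  have "x (\<Sum>b\<in>B. scl D (coord b v) b) = (\<Sum>b\<in>B. x b * coord b v)" if "finite B" for B
  proof -
    have "x 0 = 0" using assms by (metis add_cancel_right_right covectors_iff)
    with that show ?thesis
      by (induction B rule: finite_induct) (use assms in \<open>auto simp: covectors_iff mult.commute\<close>)
  qed
  from this[OF finite_hbasis] show ?thesis by (simp add: coord_expand)
qed

text \<open>The factor \<open>k\<close> in \<open>x - s x = k \<langle>x, \<alpha>\<^sub>s\<^sup>\<or>\<rangle> \<alpha>\<^sub>s\<close> for covectors \<open>x\<close>.\<close>

definition refl_coeff :: "('v \<Rightarrow> 'v) \<Rightarrow> complex" where
  "refl_coeff s = (1 - inverse (refl_eig s)) / 2"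

text \<open>The commutators of \<open>\<Sum>\<^sub>b x\<^sub>b y\<^sub>b\<close> with vectors and covectors contain reflection terms; the coefficients
  of the second sum are those that cancel them.\<close>

definition euler :: "'v tensor" where
  "euler = (\<Sum>b\<in>hbasis. gen (Cov (coord b)) * gen (Vec b))
     - (\<Sum>s\<in>reflections D. scalar (1 / refl_coeff s) * gen (Par_c (conj_class D s)) * gen (Grp s))"

lemma refl_coeff_nonzero: "s \<in> reflections D \<Longrightarrow> refl_coeff s \<noteq> 0"
  using refl_eig[of s] by (auto simp: refl_coeff_def)

end

context cherednik_congruence
begin

abbreviation (input) par_c :: "('v \<Rightarrow> 'v) \<Rightarrow> 'v tensor" where
  "par_c s \<equiv> gen (Par_c (conj_class D s))"

lemma par_c_central: "s \<in> reflections D \<Longrightarrow> par_c s * q \<doteq> q * par_c s"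
  by (rule par_central) (auto simp: par_letters_def refl_classes_def)

lemma par_t_central: "gen Par_t * q \<doteq> q * gen Par_t"
  by (rule par_central) (auto simp: par_letters_def)

lemma vec_expand: "(\<Sum>b\<in>hbasis. scalar (coord b v) * gen (Vec b)) \<doteq> gen (Vec v)"
  using vec_sum[of "\<lambda>b. coord b v" "\<lambda>b. b" hbasis] cong_sym by (simp add: coord_expand)

lemma cov_expand:
  assumes "x \<in> covectors D"
  shows "(\<Sum>b\<in>hbasis. scalar (x b) * gen (Cov (coord b))) \<doteq> gen (Cov x)"
  using cov_sum[of hbasis coord x] cong_sym by (simp add: coord_covector covector_expand assms)

lemma grp_cov_commutator:
  assumes s: "s \<in> reflections D" and x: "x \<in> covectors D"
  shows "gen (Grp s) * gen (Cov x) - gen (Cov x) * gen (Grp s)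
    \<doteq> - (scalar (refl_coeff s * x (alpha_chk D s)) * gen (Cov (alpha D s)) * gen (Grp s))"
proof -
  have sW: "s \<in> grp D" using s reflections_subset by blast
  have \<alpha>: "alpha D s \<in> covectors D" by (rule alpha_covector[OF s])
  let ?m = "- (refl_coeff s * x (alpha_chk D s))"
  have co: "coact s x = (\<lambda>v. x v + ?m * alpha D s v)"
    by (simp add: coact_refl[OF s x] refl_coeff_def field_simps)
  have "gen (Cov (coact s x)) \<doteq> gen (Cov x) + gen (Cov (\<lambda>v. ?m * alpha D s v))"
    unfolding co by (intro cov_rels covectors_closed x \<alpha>)
  also have "\<dots> \<doteq> gen (Cov x) + scalar ?m * gen (Cov (alpha D s))"
    by (intro cong_add cong_refl cov_rels \<alpha>)
  finally have "gen (Cov (coact s x)) * gen (Grp s) \<doteq>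
      (gen (Cov x) + scalar ?m * gen (Cov (alpha D s))) * gen (Grp s)"
    by (intro cong_mult cong_refl)
  then have "gen (Grp s) * gen (Cov x) - gen (Cov x) * gen (Grp s) \<doteq>
      (gen (Cov x) + scalar ?m * gen (Cov (alpha D s))) * gen (Grp s) - gen (Cov x) * gen (Grp s)"
    by (intro cong_diff cong_refl cong_trans[OF grp_rels(4)] sW x)
  also have "\<dots> = - (scalar (refl_coeff s * x (alpha_chk D s)) * gen (Cov (alpha D s)) * gen (Grp s))"
    unfolding scalar_simps by (simp add: algebra_simps)
  finally show ?thesis .
qed

lemma grp_vec_commutator:
  assumes s: "s \<in> reflections D"
  shows "gen (Grp s) * gen (Vec y) - gen (Vec y) * gen (Grp s)
    \<doteq> scalar (refl_coeff s * alpha D s y) * gen (Grp s) * gen (Vec (alpha_chk D s))"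
proof -
  have sW: "s \<in> grp D" using s reflections_subset by blast
  let ?m = "(refl_eig s - 1) / 2 * alpha D s y"
  have "gen (Vec (s y)) \<doteq> gen (Vec y) + gen (Vec (scl D ?m (alpha_chk D s)))"
    unfolding refl_eig(3)[OF s, of y] by (rule vec_rels)
  also have "\<dots> \<doteq> gen (Vec y) + scalar ?m * gen (Vec (alpha_chk D s))"
    by (intro cong_add cong_refl vec_rels)
  finally have "gen (Vec (s y)) * gen (Grp s) \<doteq>
      (gen (Vec y) + scalar ?m * gen (Vec (alpha_chk D s))) * gen (Grp s)"
    by (intro cong_mult cong_refl)
  then have "gen (Grp s) * gen (Vec y) - gen (Vec y) * gen (Grp s) \<doteq>
      (gen (Vec y) + scalar ?m * gen (Vec (alpha_chk D s))) * gen (Grp s) - gen (Vec y) * gen (Grp s)"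
    by (intro cong_diff cong_refl cong_trans[OF grp_rels(3)] sW)
  also have "\<dots> = scalar ?m * (gen (Vec (alpha_chk D s)) * gen (Grp s))"
    by (simp add: algebra_simps)
  finally have 1: "gen (Grp s) * gen (Vec y) - gen (Vec y) * gen (Grp s) \<doteq> \<dots>" .
  have "gen (Grp s) * gen (Vec (alpha_chk D s)) \<doteq> gen (Vec (s (alpha_chk D s))) * gen (Grp s)"
    by (rule grp_rels(3)[OF sW])
  also have "\<dots> \<doteq> scalar (refl_eig s) * gen (Vec (alpha_chk D s)) * gen (Grp s)"
    unfolding refl_alpha_chk[OF s] by (intro cong_mult vec_rels cong_refl)
  finally have "scalar (refl_coeff s * alpha D s y) * (gen (Grp s) * gen (Vec (alpha_chk D s))) \<doteq>
     scalar (refl_coeff s * alpha D s y) * (scalar (refl_eig s) * gen (Vec (alpha_chk D s)) * gen (Grp s))"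
    by (rule cong_mult[OF cong_refl])
  also have "\<dots> = scalar (refl_coeff s * alpha D s y * refl_eig s) * (gen (Vec (alpha_chk D s)) * gen (Grp s))"
    by (simp add: scalar_simps mult.assoc)
  also have "refl_coeff s * alpha D s y * refl_eig s = ?m"
    using refl_eig(1)[OF s] by (simp add: refl_coeff_def field_simps)
  finally have 2: "scalar (refl_coeff s * alpha D s y) * (gen (Grp s) * gen (Vec (alpha_chk D s))) \<doteq>
     scalar ?m * (gen (Vec (alpha_chk D s)) * gen (Grp s))" .
  show ?thesis
    using cong_trans[OF 1 cong_sym[OF 2]] by (simp add: mult.assoc)
qed

text \<open>From \<open>[\<Sum>\<^sub>b x\<^sub>b y\<^sub>b, x] = \<Sum>\<^sub>b x\<^sub>b [y\<^sub>b, x]\<close> one gets \<open>t x\<close> minus the terms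
  \<open>c(s) \<langle>x, \<alpha>\<^sub>s\<^sup>\<or>\<rangle> \<alpha>\<^sub>s s\<close>, and \<open>[s, x]\<close> is \<open>- refl_coeff s\<close> times \<open>\<langle>x, \<alpha>\<^sub>s\<^sup>\<or>\<rangle> \<alpha>\<^sub>s s\<close>.\<close>

lemma euler_cov:
  assumes x: "x \<in> covectors D"
  shows "euler * gen (Cov x) - gen (Cov x) * euler \<doteq> gen Par_t * gen (Cov x)"
proof -
  let ?C = "\<lambda>b. gen (Cov (coord b))" and ?V = "\<lambda>b. gen (Vec b)" and ?X = "gen (Cov x)"
  let ?S = "\<lambda>s. par_c s * scalar (x (alpha_chk D s)) * gen (Cov (alpha D s)) * gen (Grp s)"
  have t1: "?C b * ?V b * ?X - ?X * (?C b * ?V b) \<doteq>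
      gen Par_t * (scalar (x b) * ?C b) -
      (\<Sum>s\<in>reflections D. par_c s * scalar (x (alpha_chk D s)) * (scalar (alpha D s b) * ?C b) * gen (Grp s))" for b
  proof -
    have "?C b * ?V b * ?X - ?X * (?C b * ?V b) = ?C b * (?V b * ?X - ?X * ?V b) + (?C b * ?X - ?X * ?C b) * ?V b"
      by (simp add: algebra_simps)
    also have "\<dots> \<doteq> ?C b * (gen Par_t * scalar (x b) - refl_sum x b) + (?X * ?C b - ?X * ?C b) * ?V b"
      by (intro cong_add cong_mult cong_refl vec_cov_rel cong_diff comm_rels_cong x coord_covector)
    also have "\<dots> = ?C b * gen Par_t * scalar (x b) -
        (\<Sum>s\<in>reflections D. ?C b * par_c s * scalar (x (alpha_chk D s) * alpha D s b) * gen (Grp s))"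
      by (simp add: refl_sum_def algebra_simps sum_distrib_left)
    also have "\<dots> \<doteq> gen Par_t * ?C b * scalar (x b) -
        (\<Sum>s\<in>reflections D. par_c s * ?C b * scalar (x (alpha_chk D s) * alpha D s b) * gen (Grp s))"
      by (intro cong_diff cong_sum cong_mult cong_refl cong_sym[OF par_t_central] cong_sym[OF par_c_central])
    also have "\<dots> = gen Par_t * (scalar (x b) * ?C b) -
      (\<Sum>s\<in>reflections D. par_c s * scalar (x (alpha_chk D s)) * (scalar (alpha D s b) * ?C b) * gen (Grp s))"
      by (simp add: mult.assoc scalar_norm)
    finally show ?thesis .
  qed
  have "(\<Sum>b\<in>hbasis. ?C b * ?V b) * ?X - ?X * (\<Sum>b\<in>hbasis. ?C b * ?V b) =
      (\<Sum>b\<in>hbasis. ?C b * ?V b * ?X - ?X * (?C b * ?V b))"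
    by (simp add: sum_distrib_left sum_distrib_right sum_subtractf)
  also have "\<dots> \<doteq> (\<Sum>b\<in>hbasis. gen Par_t * (scalar (x b) * ?C b) -
      (\<Sum>s\<in>reflections D. par_c s * scalar (x (alpha_chk D s)) * (scalar (alpha D s b) * ?C b) * gen (Grp s)))"
    by (intro cong_sum t1)
  also have "\<dots> = gen Par_t * (\<Sum>b\<in>hbasis. scalar (x b) * ?C b) -
      (\<Sum>b\<in>hbasis. \<Sum>s\<in>reflections D. par_c s * scalar (x (alpha_chk D s)) * (scalar (alpha D s b) * ?C b) * gen (Grp s))"
    by (simp add: sum_subtractf sum_distrib_left)
  also have "(\<Sum>b\<in>hbasis. \<Sum>s\<in>reflections D. par_c s * scalar (x (alpha_chk D s)) * (scalar (alpha D s b) * ?C b) * gen (Grp s))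
      = (\<Sum>s\<in>reflections D. par_c s * scalar (x (alpha_chk D s)) * (\<Sum>b\<in>hbasis. scalar (alpha D s b) * ?C b) * gen (Grp s))"
    by (subst sum.swap) (simp add: sum_distrib_left sum_distrib_right)
  also have "gen Par_t * (\<Sum>b\<in>hbasis. scalar (x b) * ?C b) - \<dots> \<doteq> gen Par_t * ?X - (\<Sum>s\<in>reflections D. ?S s)"
    by (intro cong_diff cong_mult cong_refl cong_sum cov_expand x alpha_covector)
  finally have A: "(\<Sum>b\<in>hbasis. ?C b * ?V b) * ?X - ?X * (\<Sum>b\<in>hbasis. ?C b * ?V b)
      \<doteq> gen Par_t * ?X - (\<Sum>s\<in>reflections D. ?S s)" .
  let ?R = "\<lambda>s. scalar (1 / refl_coeff s) * par_c s * gen (Grp s)"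
  have t2: "?R s * ?X - ?X * ?R s \<doteq> - ?S s" if s: "s \<in> reflections D" for s
  proof -
    let ?k = "scalar (1 / refl_coeff s)"
    have "?R s * ?X - ?X * ?R s = ?k * (par_c s * (gen (Grp s) * ?X) - (?X * par_c s) * gen (Grp s))"
      by (simp add: algebra_simps scalar_norm)
    also have "\<dots> \<doteq> ?k * (par_c s * (gen (Grp s) * ?X) - (par_c s * ?X) * gen (Grp s))"
      by (intro cong_mult cong_diff cong_refl cong_sym[OF par_c_central] s)
    also have "\<dots> = ?k * par_c s * (gen (Grp s) * ?X - ?X * gen (Grp s))"
      by (simp add: algebra_simps)
    also have "\<dots> \<doteq> ?k * par_c s * - (scalar (refl_coeff s * x (alpha_chk D s)) * gen (Cov (alpha D s)) * gen (Grp s))"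
      by (intro cong_mult cong_refl grp_cov_commutator s x)
    also have "\<dots> = - (par_c s * (?k * scalar (refl_coeff s * x (alpha_chk D s))) * gen (Cov (alpha D s)) * gen (Grp s))"
      by (simp add: mult.assoc scalar_norm mult.commute mult.left_commute)
    also have "?k * scalar (refl_coeff s * x (alpha_chk D s)) = scalar (x (alpha_chk D s))"
      using refl_coeff_nonzero[OF s] by (simp add: scalar_norm)
    finally show ?thesis .
  qed
  have "(\<Sum>s\<in>reflections D. ?R s) * ?X - ?X * (\<Sum>s\<in>reflections D. ?R s) = (\<Sum>s\<in>reflections D. ?R s * ?X - ?X * ?R s)"
    by (simp add: sum_distrib_left sum_distrib_right sum_subtractf)
  also have "\<dots> \<doteq> (\<Sum>s\<in>reflections D. - ?S s)"
    by (intro cong_sum t2)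
  finally have B: "(\<Sum>s\<in>reflections D. ?R s) * ?X - ?X * (\<Sum>s\<in>reflections D. ?R s) \<doteq> \<dots>" .
  have "euler * ?X - ?X * euler = ((\<Sum>b\<in>hbasis. ?C b * ?V b) * ?X - ?X * (\<Sum>b\<in>hbasis. ?C b * ?V b))
      - ((\<Sum>s\<in>reflections D. ?R s) * ?X - ?X * (\<Sum>s\<in>reflections D. ?R s))"
    by (simp add: euler_def algebra_simps)
  also have "\<dots> \<doteq> (gen Par_t * ?X - (\<Sum>s\<in>reflections D. ?S s)) - (\<Sum>s\<in>reflections D. - ?S s)"
    by (intro cong_diff A B)
  also have "\<dots> = gen Par_t * ?X" by (simp add: sum_negf)
  finally show ?thesis .
qed

text \<open>The computation dual to the one for covectors; the reflection terms now are \<open>s \<alpha>\<^sub>s\<^sup>\<or>\<close>, in this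
  order.\<close>

lemma euler_vec:
  shows "euler * gen (Vec y) - gen (Vec y) * euler \<doteq> - (gen Par_t * gen (Vec y))"
proof -
  let ?C = "\<lambda>b. gen (Cov (coord b))" and ?V = "\<lambda>b. gen (Vec b)" and ?Y = "gen (Vec y)"
  let ?S = "\<lambda>s. par_c s * scalar (alpha D s y) * gen (Grp s) * gen (Vec (alpha_chk D s))"
  have t1: "?C b * ?V b * ?Y - ?Y * (?C b * ?V b) \<doteq>
      - (gen Par_t * (scalar (coord b y) * ?V b)) +
      (\<Sum>s\<in>reflections D. par_c s * scalar (alpha D s y) * gen (Grp s) * (scalar (coord b (alpha_chk D s)) * ?V b))" for b
  proof -
    have "?C b * ?V b * ?Y - ?Y * (?C b * ?V b) = ?C b * (?V b * ?Y - ?Y * ?V b) - (?Y * ?C b - ?C b * ?Y) * ?V b"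
      by (simp add: algebra_simps)
    also have "\<dots> \<doteq> ?C b * (?V b * ?Y - ?V b * ?Y) - (gen Par_t * scalar (coord b y) - refl_sum (coord b) y) * ?V b"
      by (intro cong_add cong_mult cong_refl vec_cov_rel cong_diff comm_rels_cong coord_covector)
    also have "\<dots> = - (gen Par_t * (scalar (coord b y) * ?V b)) +
        (\<Sum>s\<in>reflections D. par_c s * scalar (coord b (alpha_chk D s) * alpha D s y) * gen (Grp s) * ?V b)"
      by (simp add: refl_sum_def algebra_simps sum_distrib_right)
    also have "\<dots> = - (gen Par_t * (scalar (coord b y) * ?V b)) +
      (\<Sum>s\<in>reflections D. par_c s * scalar (alpha D s y) * gen (Grp s) * (scalar (coord b (alpha_chk D s)) * ?V b))"
      by (simp add: mult.assoc scalar_norm mult.commute mult.left_commute)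
    finally show ?thesis .
  qed
  have "(\<Sum>b\<in>hbasis. ?C b * ?V b) * ?Y - ?Y * (\<Sum>b\<in>hbasis. ?C b * ?V b) =
      (\<Sum>b\<in>hbasis. ?C b * ?V b * ?Y - ?Y * (?C b * ?V b))"
    by (simp add: sum_distrib_left sum_distrib_right sum_subtractf)
  also have "\<dots> \<doteq> (\<Sum>b\<in>hbasis. - (gen Par_t * (scalar (coord b y) * ?V b)) +
      (\<Sum>s\<in>reflections D. par_c s * scalar (alpha D s y) * gen (Grp s) * (scalar (coord b (alpha_chk D s)) * ?V b)))"
    by (intro cong_sum t1)
  also have "\<dots> = - (gen Par_t * (\<Sum>b\<in>hbasis. scalar (coord b y) * ?V b)) +
      (\<Sum>b\<in>hbasis. \<Sum>s\<in>reflections D. par_c s * scalar (alpha D s y) * gen (Grp s) * (scalar (coord b (alpha_chk D s)) * ?V b))"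
    by (simp add: sum.distrib sum_distrib_left sum_negf sum_subtractf)
  also have "(\<Sum>b\<in>hbasis. \<Sum>s\<in>reflections D. par_c s * scalar (alpha D s y) * gen (Grp s) * (scalar (coord b (alpha_chk D s)) * ?V b))
      = (\<Sum>s\<in>reflections D. par_c s * scalar (alpha D s y) * gen (Grp s) * (\<Sum>b\<in>hbasis. scalar (coord b (alpha_chk D s)) * ?V b))"
    by (subst sum.swap) (simp add: sum_distrib_left sum_distrib_right)
  also have "- (gen Par_t * (\<Sum>b\<in>hbasis. scalar (coord b y) * ?V b)) + \<dots> \<doteq> - (gen Par_t * ?Y) + (\<Sum>s\<in>reflections D. ?S s)"
    by (intro cong_add cong_uminus cong_mult cong_refl cong_sum vec_expand)
  finally have A: "(\<Sum>b\<in>hbasis. ?C b * ?V b) * ?Y - ?Y * (\<Sum>b\<in>hbasis. ?C b * ?V b)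
      \<doteq> - (gen Par_t * ?Y) + (\<Sum>s\<in>reflections D. ?S s)" .
  let ?R = "\<lambda>s. scalar (1 / refl_coeff s) * par_c s * gen (Grp s)"
  have t2: "?R s * ?Y - ?Y * ?R s \<doteq> ?S s" if s: "s \<in> reflections D" for s
  proof -
    let ?k = "scalar (1 / refl_coeff s)"
    have "?R s * ?Y - ?Y * ?R s = ?k * (par_c s * (gen (Grp s) * ?Y) - (?Y * par_c s) * gen (Grp s))"
      by (simp add: algebra_simps scalar_norm)
    also have "\<dots> \<doteq> ?k * (par_c s * (gen (Grp s) * ?Y) - (par_c s * ?Y) * gen (Grp s))"
      by (intro cong_mult cong_diff cong_refl cong_sym[OF par_c_central] s)
    also have "\<dots> = ?k * par_c s * (gen (Grp s) * ?Y - ?Y * gen (Grp s))"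
      by (simp add: algebra_simps)
    also have "\<dots> \<doteq> ?k * par_c s * (scalar (refl_coeff s * alpha D s y) * gen (Grp s) * gen (Vec (alpha_chk D s)))"
      by (intro cong_mult cong_refl grp_vec_commutator s)
    also have "\<dots> = par_c s * (?k * scalar (refl_coeff s * alpha D s y)) * gen (Grp s) * gen (Vec (alpha_chk D s))"
      by (simp add: mult.assoc scalar_norm mult.commute mult.left_commute)
    also have "?k * scalar (refl_coeff s * alpha D s y) = scalar (alpha D s y)"
      using refl_coeff_nonzero[OF s] by (simp add: scalar_norm)
    finally show ?thesis .
  qed
  have "(\<Sum>s\<in>reflections D. ?R s) * ?Y - ?Y * (\<Sum>s\<in>reflections D. ?R s) = (\<Sum>s\<in>reflections D. ?R s * ?Y - ?Y * ?R s)"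
    by (simp add: sum_distrib_left sum_distrib_right sum_subtractf)
  also have "\<dots> \<doteq> (\<Sum>s\<in>reflections D. ?S s)"
    by (intro cong_sum t2)
  finally have B: "(\<Sum>s\<in>reflections D. ?R s) * ?Y - ?Y * (\<Sum>s\<in>reflections D. ?R s) \<doteq> \<dots>" .
  have "euler * ?Y - ?Y * euler = ((\<Sum>b\<in>hbasis. ?C b * ?V b) * ?Y - ?Y * (\<Sum>b\<in>hbasis. ?C b * ?V b))
      - ((\<Sum>s\<in>reflections D. ?R s) * ?Y - ?Y * (\<Sum>s\<in>reflections D. ?R s))"
    by (simp add: euler_def algebra_simps)
  also have "\<dots> \<doteq> (- (gen Par_t * ?Y) + (\<Sum>s\<in>reflections D. ?S s)) - (\<Sum>s\<in>reflections D. ?S s)"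
    by (intro cong_diff A B)
  also have "\<dots> = - (gen Par_t * ?Y)" by simp
  finally show ?thesis .
qed

text \<open>The tensor \<open>\<Sum>\<^sub>b x\<^sub>b \<otimes> y\<^sub>b\<close> is canonical, hence invariant, and conjugation by \<open>w\<close> permutes the reflections
  without changing their parameters and eigenvalues.\<close>

lemma euler_grp:
  assumes w: "w \<in> grp D"
  shows "euler * gen (Grp w) - gen (Grp w) * euler \<in> J"
proof -
  let ?C = "\<lambda>b. gen (Cov (coord b))" and ?V = "\<lambda>b. gen (Vec b)" and ?W = "gen (Grp w)"
  have "?W * (\<Sum>b\<in>hbasis. ?C b * ?V b) = (\<Sum>b\<in>hbasis. (?W * ?C b) * ?V b)"
    by (simp add: sum_distrib_left mult.assoc)
  also have "\<dots> \<doteq> (\<Sum>b\<in>hbasis. (gen (Cov (coact w (coord b))) * ?W) * ?V b)"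
    by (intro cong_sum cong_mult cong_refl grp_rels w coord_covector)
  also have "\<dots> = (\<Sum>b\<in>hbasis. gen (Cov (coact w (coord b))) * (?W * ?V b))"
    by (simp add: mult.assoc)
  also have "\<dots> \<doteq> (\<Sum>b\<in>hbasis. gen (Cov (coact w (coord b))) * (gen (Vec (w b)) * ?W))"
    by (intro cong_sum cong_mult cong_refl grp_rels w)
  also have "\<dots> \<doteq> (\<Sum>b\<in>hbasis. gen (Cov (coact w (coord b))) * ((\<Sum>a\<in>hbasis. scalar (coord a (w b)) * ?V a) * ?W))"
    by (intro cong_sum cong_mult cong_refl cong_sym[OF vec_expand])
  also have "\<dots> = (\<Sum>b\<in>hbasis. \<Sum>a\<in>hbasis. scalar (coord a (w b)) * gen (Cov (coact w (coord b))) * ?V a * ?W)"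
    by (simp add: sum_distrib_left sum_distrib_right mult.assoc scalar_norm)
  also have "\<dots> = (\<Sum>a\<in>hbasis. (\<Sum>b\<in>hbasis. scalar (coord a (w b)) * gen (Cov (coact w (coord b)))) * ?V a * ?W)"
    by (subst sum.swap) (simp add: sum_distrib_left sum_distrib_right)
  also have "\<dots> \<doteq> (\<Sum>a\<in>hbasis. ?C a * ?V a * ?W)"
  proof (intro cong_sum cong_mult cong_refl)
    fix a
    have "(\<Sum>b\<in>hbasis. scalar (coord a (w b)) * gen (Cov (coact w (coord b)))) \<doteq>
        gen (Cov (\<lambda>v. \<Sum>b\<in>hbasis. coord a (w b) * coact w (coord b) v))"
      by (intro cong_sym[OF cov_sum] coact_covector w coord_covector)
    also have "(\<lambda>v. \<Sum>b\<in>hbasis. coord a (w b) * coact w (coord b) v) = coord a"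
    proof
      fix v
      have cw: "(\<lambda>v. coord a (w v)) \<in> covectors D"
        using coord_covector[of a] by (simp add: covectors_iff linear_grp[OF w])
      show "(\<Sum>b\<in>hbasis. coord a (w b) * coact w (coord b) v) = coord a v"
        using covector_expand[OF cw, of "inv_into UNIV w v"] by (simp add: coact_def inv_grp_simps[OF w])
    qed
    finally show "(\<Sum>b\<in>hbasis. scalar (coord a (w b)) * gen (Cov (coact w (coord b)))) \<doteq> ?C a" .
  qed
  also have "\<dots> = (\<Sum>b\<in>hbasis. ?C b * ?V b) * ?W"
    by (simp add: sum_distrib_right)
  finally have A: "?W * (\<Sum>b\<in>hbasis. ?C b * ?V b) \<doteq> (\<Sum>b\<in>hbasis. ?C b * ?V b) * ?W" .
  let ?R = "\<lambda>s. scalar (1 / refl_coeff s) * par_c s * gen (Grp s)"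
  have t: "?W * ?R s \<doteq> ?R (conjugate w s) * ?W" if s: "s \<in> reflections D" for s
  proof -
    have sW: "s \<in> grp D" "conjugate w s \<in> grp D"
      using s conjugate_reflection[OF w s] reflections_subset by blast+
    let ?k = "scalar (1 / refl_coeff s)"
    have "?W * ?R s = ?k * (?W * par_c s * gen (Grp s))"
      by (simp add: mult.assoc scalar_norm)
    also have "\<dots> \<doteq> ?k * (par_c s * ?W * gen (Grp s))"
      by (intro cong_mult cong_refl cong_sym[OF par_c_central] s)
    also have "\<dots> = ?k * par_c s * (?W * gen (Grp s))" by (simp add: mult.assoc)
    also have "\<dots> \<doteq> ?k * par_c s * gen (Grp (w \<circ> s))"
      by (intro cong_mult cong_refl grp_rels w sW)
    also have "w \<circ> s = conjugate w s \<circ> w"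
      by (auto simp: conjugate_def inv_grp_simps[OF w])
    also have "?k * par_c s * gen (Grp (conjugate w s \<circ> w)) \<doteq> ?k * par_c s * (gen (Grp (conjugate w s)) * ?W)"
      by (intro cong_mult cong_refl cong_sym[OF grp_rels(2)] w sW)
    also have "\<dots> = ?R (conjugate w s) * ?W"
      by (simp add: conj_class_conjugate[OF w] refl_coeff_def refl_eig_conjugate[OF w s] mult.assoc)
    finally show ?thesis .
  qed
  have "?W * (\<Sum>s\<in>reflections D. ?R s) = (\<Sum>s\<in>reflections D. ?W * ?R s)"
    by (simp add: sum_distrib_left)
  also have "\<dots> \<doteq> (\<Sum>s\<in>reflections D. ?R (conjugate w s) * ?W)"
    by (intro cong_sum t)
  also have "\<dots> = (\<Sum>s\<in>reflections D. ?R s * ?W)"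
    by (rule sum.reindex_bij_betw[OF bij_betw_conjugate[OF w]])
  also have "\<dots> = (\<Sum>s\<in>reflections D. ?R s) * ?W"
    by (simp add: sum_distrib_right)
  finally have B: "?W * (\<Sum>s\<in>reflections D. ?R s) \<doteq> (\<Sum>s\<in>reflections D. ?R s) * ?W" .
  have "?W * euler \<doteq> euler * ?W"
    using cong_diff[OF A B] by (simp add: euler_def algebra_simps)
  then show ?thesis by (metis cong_def cong_sym)
qed

end

section \<open>Invariants commute with everything modulo the deformation parameter\<close>

text \<open>A pair \<open>(b, k)\<close> stands for a letter \<open>b + k Z\<close> split into an \<open>s\<close>-invariant part and a multiple of the
  eigenvector \<open>Z\<close> of \<open>s\<close>; applying \<open>s\<^sup>i\<close> to it gives \<open>b + q k Z\<close> with \<open>q = m\<^sup>i\<close>, where \<open>m\<close> is the eigenvalue of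
  \<open>Z\<close>.  The derivation \<open>\<Delta>\<close> with \<open>\<Delta>(u v) = \<Delta>(u) s(v) + u \<Delta>(v)\<close>, \<open>\<Delta>(b) = 0\<close>, \<open>\<Delta>(Z) = 2\<close> becomes
  \<open>twisted_deriv\<close>, and \<open>pair_coeff r a\<close> is the coefficient of \<open>Z\<^sup>a\<close> in the product of the letters.\<close>

fun pair_prod :: "'g free_algebra \<Rightarrow> complex \<Rightarrow> ('g free_algebra \<times> complex) list \<Rightarrow> 'g free_algebra" where
  "pair_prod Z q [] = 1"
| "pair_prod Z q ((b, k) # r) = (b + scalar (q * k) * Z) * pair_prod Z q r"

fun twisted_deriv :: "'g free_algebra \<Rightarrow> complex \<Rightarrow> complex \<Rightarrow> ('g free_algebra \<times> complex) list \<Rightarrow> 'g free_algebra" where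
  "twisted_deriv Z m q [] = 0"
| "twisted_deriv Z m q ((b, k) # r) =
     scalar (2 * q * k) * pair_prod Z (q * m) r + (b + scalar (q * k) * Z) * twisted_deriv Z m q r"

fun pair_coeff :: "('g free_algebra \<times> complex) list \<Rightarrow> nat \<Rightarrow> 'g free_algebra" where
  "pair_coeff [] a = (if a = 0 then 1 else 0)"
| "pair_coeff ((b, k) # r) 0 = b * pair_coeff r 0"
| "pair_coeff ((b, k) # r) (Suc a) = b * pair_coeff r (Suc a) + scalar k * pair_coeff r a"

lemma pair_coeff_beyond: "length r < a \<Longrightarrow> pair_coeff r a = 0"
  by (induction r a rule: pair_coeff.induct) auto

definition qint :: "complex \<Rightarrow> nat \<Rightarrow> complex" where
  "qint m a = (\<Sum>j<a. m ^ j)"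

lemma qint_simps: "qint m 0 = 0" "qint m (Suc a) = qint m a + m ^ a"
  by (simp_all add: qint_def)

locale free_ideal = two_sided_ideal J for J :: "'g free_algebra set"
begin

lemma power_commute:
  assumes "Z * b \<doteq> b * Z" shows "Z ^ a * b \<doteq> b * Z ^ a"
proof (induction a)
  case (Suc a)
  have "Z ^ Suc a * b = Z * (Z ^ a * b)" by (simp add: mult.assoc)
  also have "\<dots> \<doteq> Z * (b * Z ^ a)" by (intro cong_mult cong_refl Suc)
  also have "\<dots> = (Z * b) * Z ^ a" by (simp add: mult.assoc)
  also have "\<dots> \<doteq> (b * Z) * Z ^ a" by (intro cong_mult cong_refl assms)
  finally show ?case by (simp add: mult.assoc)
qed simp

lemma scalar_swap: "p * (scalar a * q) = scalar a * (p * q)"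
  by (metis mult.assoc scalar_commutes)

lemma pair_prod_expand:
  assumes "\<forall>(b, k) \<in> set r. Z * b \<doteq> b * Z"
  shows "pair_prod Z q r \<doteq> (\<Sum>a<Suc (length r). scalar (q ^ a) * (Z ^ a * pair_coeff r a))"
  using assms
proof (induction r)
  case Nil
  then show ?case by (simp add: scalar_simps)
next
  case (Cons bk r)
  obtain b k where bk: "bk = (b, k)" by (cases bk)
  let ?n = "length r" and ?N = "pair_coeff r"
  have Zb: "Z * b \<doteq> b * Z" using Cons.prems bk by auto
  let ?f = "\<lambda>a. scalar (q ^ a) * (Z ^ a * (b * ?N a))"
  let ?g = "\<lambda>a. scalar (q ^ Suc a * k) * (Z ^ Suc a * ?N a)"
  have "pair_prod Z q (bk # r) \<doteq> (b + scalar (q * k) * Z) * (\<Sum>a<Suc ?n. scalar (q ^ a) * (Z ^ a * ?N a))"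
    unfolding bk pair_prod.simps by (intro cong_mult cong_refl Cons.IH) (use Cons.prems in auto)
  also have "\<dots> = (\<Sum>a<Suc ?n. scalar (q ^ a) * (b * Z ^ a * ?N a)) + (\<Sum>a<Suc ?n. ?g a)"
    by (simp only: distrib_right sum_distrib_left scalar_swap[of b] scalar_swap[of Z] scalar_norm mult.assoc power_Suc)
      (simp add: mult.commute mult.left_commute sum.distrib)
  also have "\<dots> \<doteq> (\<Sum>a<Suc ?n. scalar (q ^ a) * (Z ^ a * b * ?N a)) + (\<Sum>a<Suc ?n. ?g a)"
    by (intro cong_add cong_sum cong_mult cong_refl cong_sym[OF power_commute[OF Zb]])
  also have "(\<Sum>a<Suc ?n. scalar (q ^ a) * (Z ^ a * b * ?N a)) = (\<Sum>a<Suc (Suc ?n). ?f a)"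
    by (simp add: pair_coeff_beyond mult.assoc)
  also have "\<dots> = ?f 0 + (\<Sum>a<Suc ?n. ?f (Suc a))"
    by (rule sum.lessThan_Suc_shift)
  also have "?f 0 + (\<Sum>a<Suc ?n. ?f (Suc a)) + (\<Sum>a<Suc ?n. ?g a) = b * ?N 0 + (\<Sum>a<Suc ?n. ?f (Suc a) + ?g a)"
    by (simp add: sum.distrib scalar_simps)
  also have "\<dots> = pair_coeff (bk # r) 0 + (\<Sum>a<Suc ?n. scalar (q ^ Suc a) * (Z ^ Suc a * pair_coeff (bk # r) (Suc a)))"
    unfolding bk pair_coeff.simps
    by (intro arg_cong2[where f = "(+)"] sum.cong refl)
      (simp only: distrib_left scalar_swap[of "Z ^ n" for n] scalar_norm)
  also have "\<dots> = (\<Sum>a<Suc (length (bk # r)). scalar (q ^ a) * (Z ^ a * pair_coeff (bk # r) a))"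
    unfolding length_Cons sum.lessThan_Suc_shift[of _ "Suc ?n"]
    by (simp add: scalar_simps del: sum.lessThan_Suc)
  finally show ?case .
qed

text \<open>The twisted Leibniz rule gives \<open>\<Delta>(Z\<^sup>a) = 2 (1 + m + \<dots> + m\<^bsup>a-1\<^esup>) Z\<^bsup>a-1\<^esup>\<close>.  For \<open>a = 0\<close> the coefficient
  vanishes, so the truncated exponent is harmless.\<close>

lemma twisted_deriv_expand:
  assumes "\<forall>(b, k) \<in> set r. Z * b \<doteq> b * Z"
  shows "twisted_deriv Z m q r \<doteq>
    (\<Sum>a<Suc (length r). scalar (2 * qint m a * q ^ a) * (Z ^ (a - 1) * pair_coeff r a))"
  using assms
proof (induction r)
  case Nil
  then show ?case by (simp add: qint_simps scalar_simps)
next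
  case (Cons bk r)
  obtain b k where bk: "bk = (b, k)" by (cases bk)
  let ?n = "length r" and ?N = "pair_coeff r"
  have Zb: "Z * b \<doteq> b * Z" using Cons.prems bk by auto
  have r: "\<forall>(b, k) \<in> set r. Z * b \<doteq> b * Z" using Cons.prems by auto
  let ?f = "\<lambda>a. scalar (2 * qint m a * q ^ a) * (Z ^ (a - 1) * (b * ?N a))"
  let ?g = "\<lambda>a. scalar (2 * qint m (Suc a) * q ^ Suc a * k) * (Z ^ a * ?N a)"
  have ZZ: "scalar (c * (2 * qint m a * q ^ a)) * (Z * (Z ^ (a - 1) * p)) = scalar (c * (2 * qint m a * q ^ a)) * (Z ^ a * p)" for a c p
    by (cases a) (simp_all add: qint_simps scalar_simps mult.assoc)
  have "twisted_deriv Z m q (bk # r) \<doteq> scalar (2 * q * k) * (\<Sum>a<Suc ?n. scalar ((q * m) ^ a) * (Z ^ a * ?N a)) +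
      (b + scalar (q * k) * Z) * (\<Sum>a<Suc ?n. scalar (2 * qint m a * q ^ a) * (Z ^ (a - 1) * ?N a))"
    unfolding bk twisted_deriv.simps
    by (intro cong_add cong_mult cong_refl Cons.IH pair_prod_expand r)
  also have "\<dots> = (\<Sum>a<Suc ?n. scalar (2 * q * k * (q * m) ^ a) * (Z ^ a * ?N a)) +
     ((\<Sum>a<Suc ?n. scalar (2 * qint m a * q ^ a) * (b * Z ^ (a - 1) * ?N a)) +
     (\<Sum>a<Suc ?n. scalar (q * k * (2 * qint m a * q ^ a)) * (Z * (Z ^ (a - 1) * ?N a))))"
    by (simp only: distrib_right sum_distrib_left scalar_swap[of b] scalar_swap[of Z] scalar_norm mult.assoc sum.distrib)
  also have "\<dots> = (\<Sum>a<Suc ?n. scalar (2 * qint m a * q ^ a) * (b * Z ^ (a - 1) * ?N a)) +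
     (\<Sum>a<Suc ?n. scalar (2 * q * k * (q * m) ^ a + q * k * (2 * qint m a * q ^ a)) * (Z ^ a * ?N a))"
    unfolding ZZ by (simp only: scalar_simps(1) distrib_right sum.distrib add.commute add.left_commute)
  also have "\<dots> = (\<Sum>a<Suc ?n. scalar (2 * qint m a * q ^ a) * (b * Z ^ (a - 1) * ?N a)) + (\<Sum>a<Suc ?n. ?g a)"
    by (intro arg_cong2[where f = "(+)"] sum.cong refl arg_cong2[where f = "(*)"] arg_cong[where f = scalar])
      (simp add: qint_simps algebra_simps power_mult_distrib)
  also have "\<dots> \<doteq> (\<Sum>a<Suc ?n. scalar (2 * qint m a * q ^ a) * (Z ^ (a - 1) * b * ?N a)) + (\<Sum>a<Suc ?n. ?g a)"
    by (intro cong_add cong_sum cong_mult cong_refl cong_sym[OF power_commute[OF Zb]])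
  also have "(\<Sum>a<Suc ?n. scalar (2 * qint m a * q ^ a) * (Z ^ (a - 1) * b * ?N a)) = (\<Sum>a<Suc (Suc ?n). ?f a)"
    by (simp add: pair_coeff_beyond mult.assoc)
  also have "\<dots> = ?f 0 + (\<Sum>a<Suc ?n. ?f (Suc a))"
    by (rule sum.lessThan_Suc_shift)
  also have "?f 0 + (\<Sum>a<Suc ?n. ?f (Suc a)) + (\<Sum>a<Suc ?n. ?g a) = (\<Sum>a<Suc ?n. ?f (Suc a) + ?g a)"
    by (simp add: sum.distrib scalar_simps qint_simps(1))
  also have "\<dots> = (\<Sum>a<Suc ?n. scalar (2 * qint m (Suc a) * q ^ Suc a) * (Z ^ (Suc a - 1) * pair_coeff (bk # r) (Suc a)))"
    unfolding bk pair_coeff.simps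
    by (intro sum.cong refl) (simp only: distrib_left scalar_swap[of "Z ^ n" for n] scalar_norm diff_Suc_1)
  also have "\<dots> = (\<Sum>a<Suc (length (bk # r)). scalar (2 * qint m a * q ^ a) * (Z ^ (a - 1) * pair_coeff (bk # r) a))"
    unfolding length_Cons sum.lessThan_Suc_shift[of _ "Suc ?n"]
    by (simp add: scalar_simps qint_simps(1) del: sum.lessThan_Suc)
  finally show ?case .
qed

text \<open>Either \<open>m\<^sup>a = 1\<close>, and the geometric sum \<open>qint m a\<close> is zero, or the powers of the root of unity \<open>m\<^sup>a\<close>
  sum to zero.\<close>

lemma qint_root_of_unity_sum:
  assumes "m \<noteq> 1" "m ^ n = 1"
  shows "(\<Sum>i<n. 2 * qint m a * (m ^ i) ^ a) = 0"
proof -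
  have q: "qint m a = (m ^ a - 1) / (m - 1)"
    using geometric_sum[OF assms(1), of a] by (simp add: qint_def)
  show ?thesis
  proof (cases "m ^ a = 1")
    case False
    have "(\<Sum>i<n. (m ^ i) ^ a) = (\<Sum>i<n. (m ^ a) ^ i)"
      by (simp add: mult.commute flip: power_mult)
    also have "\<dots> = ((m ^ a) ^ n - 1) / (m ^ a - 1)"
      by (rule geometric_sum[OF False])
    also have "(m ^ a) ^ n = 1"
      using assms(2) by (metis mult.commute power_mult power_one)
    finally have "(\<Sum>i<n. (m ^ i) ^ a) = 0" by simp
    then show ?thesis by (simp flip: sum_distrib_left)
  qed (simp add: q)
qed

lemma twisted_deriv_sum:
  assumes Zb: "\<forall>(b, k) \<in> set r. Z * b \<doteq> b * Z" and m: "m \<noteq> 1" "m ^ n = 1"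
  shows "(\<Sum>i<n. twisted_deriv Z m (m ^ i) r) \<doteq> 0"
proof -
  have "(\<Sum>i<n. twisted_deriv Z m (m ^ i) r) \<doteq>
     (\<Sum>i<n. \<Sum>a<Suc (length r). scalar (2 * qint m a * (m ^ i) ^ a) * (Z ^ (a - 1) * pair_coeff r a))"
    by (intro cong_sum twisted_deriv_expand Zb)
  also have "\<dots> = (\<Sum>a<Suc (length r). scalar (\<Sum>i<n. 2 * qint m a * (m ^ i) ^ a) * (Z ^ (a - 1) * pair_coeff r a))"
    by (subst sum.swap) (simp only: scalar_sum sum_distrib_right)
  also have "\<dots> = 0"
    by (simp only: qint_root_of_unity_sum[OF m] scalar_simps) simp
  finally show ?thesis .
qed

lemma scale_cancel:
  assumes "scalar a * p \<in> J" "a \<noteq> 0" shows "p \<in> J"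
proof -
  have "scalar (1 / a) * (scalar a * p) \<in> J" by (rule mult_left_mem) fact
  then show ?thesis using assms(2) by (simp add: scalar_norm scalar_simps)
qed

end

abbreviation word_prod :: "'g list \<Rightarrow> 'g free_algebra" where
  "word_prod gs \<equiv> Poly_Mapping.single (Word gs) 1"

lemma tensor_act_expand:
  "tensor_act w p = (\<Sum>u\<in>Poly_Mapping.keys p. scalar (Poly_Mapping.lookup p u) * word_prod (map (letter_act w) (letters u)))"
  unfolding tensor_act_def
proof (intro sum.cong refl)
  fix u
  have "map_word (letter_act w) u = Word (map (letter_act w) (letters u))"
    by (cases u) simp
  then show "Poly_Mapping.single (map_word (letter_act w) u) (Poly_Mapping.lookup p u) =
     scalar (Poly_Mapping.lookup p u) * word_prod (map (letter_act w) (letters u))"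
    by (simp add: scalar_def mult_single)
qed

text \<open>What the letters of \<open>\<hh>\<close> and those of \<open>\<hh>\<^sup>*\<close> have in common, so that both families of invariants are
  treated at once: \<open>Z s\<close> is the eigenvector of \<open>s\<close> with eigenvalue \<open>mu s\<close>, \<open>rest s l\<close> the fixed part of
  \<open>l\<close>, and \<open>phi s\<close> the functional that vanishes on the fixed letters.\<close>

locale letter_family = cherednik_congruence D J for D :: "'v::ab_group_add refl_data" and J +
  fixes L :: "'v letter set" and phi :: "('v \<Rightarrow> 'v) \<Rightarrow> 'v letter \<Rightarrow> complex"
    and Z :: "('v \<Rightarrow> 'v) \<Rightarrow> 'v tensor" and rest :: "('v \<Rightarrow> 'v) \<Rightarrow> 'v letter \<Rightarrow> 'v tensor"
    and mu :: "('v \<Rightarrow> 'v) \<Rightarrow> complex"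
  assumes act_closed: "w \<in> grp D \<Longrightarrow> l \<in> L \<Longrightarrow> letter_act w l \<in> L"
    and intertwine: "w \<in> grp D \<Longrightarrow> l \<in> L \<Longrightarrow> gen (Grp w) * gen l \<doteq> gen (letter_act w l) * gen (Grp w)"
    and commute: "l \<in> L \<Longrightarrow> l' \<in> L \<Longrightarrow> gen l * gen l' \<doteq> gen l' * gen l"
    and mu: "s \<in> reflections D \<Longrightarrow> mu s \<noteq> 1" "s \<in> reflections D \<Longrightarrow> \<exists>n>0. mu s ^ n = 1"
    and split: "s \<in> reflections D \<Longrightarrow> l \<in> L \<Longrightarrow>
      gen (letter_act (s ^^ i) l) \<doteq> rest s l + scalar (mu s ^ i * (phi s l / 2)) * Z s"
    and phi_eig: "s \<in> reflections D \<Longrightarrow> l \<in> L \<Longrightarrow> phi s (letter_act (s ^^ i) l) = mu s ^ i * phi s l"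
    and Z_rest: "s \<in> reflections D \<Longrightarrow> l \<in> L \<Longrightarrow> Z s * rest s l \<doteq> rest s l * Z s"
begin

sublocale free_ideal J ..

lemma act_comp:
  assumes "w \<in> grp D" "w' \<in> grp D"
  shows "letter_act (w \<circ> w') l = letter_act w (letter_act w' l)"
  using o_inv_distrib[OF grp_closed(4)[OF assms(1)] grp_closed(4)[OF assms(2)]]
  by (cases l) (simp_all add: coact_def o_assoc)

text \<open>The coefficient of \<open>s\<close> in the commutator of a dual letter with a word, see \<open>word_commutator\<close>.  The
  letters to the right of the one that is contracted are moved past \<open>s\<close>.\<close>

fun reflected_deriv :: "('v \<Rightarrow> 'v) \<Rightarrow> 'v letter list \<Rightarrow> 'v tensor" where
  "reflected_deriv s [] = 0"
| "reflected_deriv s (l # ls) =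
     scalar (phi s l) * word_prod (map (letter_act s) ls) + gen l * reflected_deriv s ls"

lemma word_prod_power:
  assumes "s \<in> reflections D" "set ls \<subseteq> L"
  shows "word_prod (map (letter_act (s ^^ i)) ls) \<doteq>
    pair_prod (Z s) (mu s ^ i) (map (\<lambda>l. (rest s l, phi s l / 2)) ls)"
  using assms(2)
proof (induction ls)
  case Nil
  then show ?case by (simp add: zero_word_def[symmetric])
next
  case (Cons l ls)
  then show ?case
    unfolding list.map single_Cons_word pair_prod.simps
    by (intro cong_mult split assms(1)) auto
qed

lemma reflected_deriv_power:
  assumes s: "s \<in> reflections D" and "set ls \<subseteq> L"
  shows "reflected_deriv s (map (letter_act (s ^^ i)) ls) \<doteq>
    twisted_deriv (Z s) (mu s) (mu s ^ i) (map (\<lambda>l. (rest s l, phi s l / 2)) ls)"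
  using assms(2)
proof (induction ls)
  case (Cons l ls)
  have sW: "s \<in> grp D" using s reflections_subset by blast
  have l: "l \<in> L" "set ls \<subseteq> L" using Cons.prems by auto
  have m: "map (letter_act s) (map (letter_act (s ^^ i)) ls) = map (letter_act (s ^^ Suc i)) ls"
    using act_comp[OF sW grp_power[OF sW, of i]] by simp
  have "word_prod (map (letter_act s) (map (letter_act (s ^^ i)) ls)) \<doteq>
      pair_prod (Z s) (mu s ^ i * mu s) (map (\<lambda>l. (rest s l, phi s l / 2)) ls)"
    unfolding m using word_prod_power[OF s l(2), of "Suc i"] by (simp add: mult.commute)
  then have h: "scalar (phi s (letter_act (s ^^ i) l)) * word_prod (map (letter_act s) (map (letter_act (s ^^ i)) ls)) \<doteq>
     scalar (2 * mu s ^ i * (phi s l / 2)) * pair_prod (Z s) (mu s ^ i * mu s) (map (\<lambda>l. (rest s l, phi s l / 2)) ls)"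
    by (simp add: phi_eig[OF s l(1)] cong_mult)
  show ?case
    unfolding list.map reflected_deriv.simps twisted_deriv.simps
    by (rule cong_add[OF h cong_mult[OF split[OF s l(1)] Cons.IH[OF l(2)]]])
qed simp

lemma act_list_closed: "w \<in> grp D \<Longrightarrow> set ls \<subseteq> L \<Longrightarrow> set (map (letter_act w) ls) \<subseteq> L"
  by (auto intro: act_closed)

lemma bij_betw_grp_comp:
  assumes "w \<in> grp D" shows "bij_betw (\<lambda>v. w \<circ> v) (grp D) (grp D)"
  by (rule bij_betw_byWitness[where f' = "\<lambda>v. inv_into UNIV w \<circ> v"])
    (auto simp: fun_eq_iff inv_grp_simps[OF assms] grp_closed grp_inv assms)

text \<open>Averaging over \<open>W\<close> includes averaging over the powers of \<open>s\<close>, and the latter already gives zero.\<close>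

lemma reflected_deriv_average:
  assumes s: "s \<in> reflections D" and ls: "set ls \<subseteq> L"
  shows "(\<Sum>w\<in>grp D. reflected_deriv s (map (letter_act w) ls)) \<in> J"
proof -
  have sW: "s \<in> grp D" using s reflections_subset by blast
  obtain n where n: "n > 0" "mu s ^ n = 1" using mu(2)[OF s] by blast
  have act_list: "map (letter_act (s ^^ i \<circ> w)) ls = map (letter_act (s ^^ i)) (map (letter_act w) ls)"
    if "w \<in> grp D" for i w
    by (simp add: act_comp[OF grp_power[OF sW] that])
  let ?S = "\<Sum>w\<in>grp D. reflected_deriv s (map (letter_act w) ls)"
  have "scalar (of_nat n) * ?S = (\<Sum>i<n. ?S)"
    by (simp add: scalar_def)
  also have "\<dots> = (\<Sum>i<n. \<Sum>w\<in>grp D. reflected_deriv s (map (letter_act (s ^^ i \<circ> w)) ls))"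
    by (intro sum.cong refl sum.reindex_bij_betw[OF bij_betw_grp_comp, symmetric] grp_power sW)
  also have "\<dots> = (\<Sum>w\<in>grp D. \<Sum>i<n. reflected_deriv s (map (letter_act (s ^^ i)) (map (letter_act w) ls)))"
    by (subst sum.swap) (simp only: act_list cong: sum.cong)
  also have "\<dots> \<doteq> (\<Sum>w\<in>grp D. \<Sum>i<n. twisted_deriv (Z s) (mu s) (mu s ^ i)
      (map (\<lambda>l. (rest s l, phi s l / 2)) (map (letter_act w) ls)))"
    by (intro cong_sum reflected_deriv_power s act_list_closed ls)
  also have "\<dots> \<doteq> (\<Sum>w\<in>grp D. 0)"
    by (intro cong_sum twisted_deriv_sum mu s n) (use ls act_closed Z_rest[OF s] in auto)
  finally show ?thesis
    using n(1) scale_cancel by (simp add: cong_zero_iff)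
qed

lemma word_grp_intertwine:
  assumes w: "w \<in> grp D" and ls: "set ls \<subseteq> L"
  shows "gen (Grp w) * word_prod ls \<doteq> word_prod (map (letter_act w) ls) * gen (Grp w)"
  using ls
proof (induction ls)
  case Nil
  then show ?case by (simp add: zero_word_def[symmetric])
next
  case (Cons l ls)
  have "gen (Grp w) * word_prod (l # ls) = (gen (Grp w) * gen l) * word_prod ls"
    by (simp add: single_Cons_word mult.assoc)
  also have "\<dots> \<doteq> (gen (letter_act w l) * gen (Grp w)) * word_prod ls"
    using Cons.prems by (intro cong_mult cong_refl intertwine w) auto
  also have "\<dots> = gen (letter_act w l) * (gen (Grp w) * word_prod ls)" by (simp add: mult.assoc)
  also have "\<dots> \<doteq> gen (letter_act w l) * (word_prod (map (letter_act w) ls) * gen (Grp w))"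
    using Cons.prems by (intro cong_mult[OF cong_refl Cons.IH]) auto
  finally show ?case by (simp add: single_Cons_word mult.assoc)
qed

text \<open>Induction on the word by the Leibniz rule, moving the reflections produced to the right.\<close>

lemma word_commutator:
  assumes ls: "set ls \<subseteq> L"
    and central: "\<And>s q. s \<in> reflections D \<Longrightarrow> kap s * q \<doteq> q * kap s"
    and b: "\<And>l. l \<in> L \<Longrightarrow> b * gen l - gen l * b \<doteq> (\<Sum>s\<in>reflections D. kap s * scalar (phi s l) * gen (Grp s))"
  shows "b * word_prod ls - word_prod ls * b \<doteq>
    (\<Sum>s\<in>reflections D. kap s * reflected_deriv s ls * gen (Grp s))"
  using ls
proof (induction ls)
  case Nil
  then show ?case by (simp add: zero_word_def[symmetric])
next
  case (Cons l ls)
  have l: "l \<in> L" "set ls \<subseteq> L" using Cons.prems by auto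
  have "b * word_prod (l # ls) - word_prod (l # ls) * b =
      (b * gen l - gen l * b) * word_prod ls + gen l * (b * word_prod ls - word_prod ls * b)"
    by (simp add: single_Cons_word algebra_simps)
  also have "\<dots> \<doteq> (\<Sum>s\<in>reflections D. kap s * scalar (phi s l) * gen (Grp s)) * word_prod ls +
      gen l * (\<Sum>s\<in>reflections D. kap s * reflected_deriv s ls * gen (Grp s))"
    by (intro cong_add cong_mult cong_refl b l Cons.IH)
  also have "\<dots> = (\<Sum>s\<in>reflections D. kap s * scalar (phi s l) * (gen (Grp s) * word_prod ls) +
      (gen l * kap s) * reflected_deriv s ls * gen (Grp s))"
    by (simp add: sum.distrib sum_distrib_left sum_distrib_right mult.assoc)
  also have "\<dots> \<doteq> (\<Sum>s\<in>reflections D. kap s * scalar (phi s l) * (word_prod (map (letter_act s) ls) * gen (Grp s)) +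
      (kap s * gen l) * reflected_deriv s ls * gen (Grp s))"
    by (intro cong_sum cong_add cong_mult cong_refl word_grp_intertwine l cong_sym[OF central])
      (auto dest: subsetD[OF reflections_subset])
  also have "\<dots> = (\<Sum>s\<in>reflections D. kap s * reflected_deriv s (l # ls) * gen (Grp s))"
    by (simp add: algebra_simps)
  finally show ?case .
qed

context
  fixes p :: "'v tensor"
  assumes p: "p \<in> free_carrier L" and inv: "\<And>w. w \<in> grp D \<Longrightarrow> tensor_act w p \<doteq> p"
begin

lemma letters_p: "u \<in> Poly_Mapping.keys p \<Longrightarrow> set (letters u) \<subseteq> L"
  using p by (auto simp: free_carrier_def)

lemma word_expansion_p: "p = (\<Sum>u\<in>Poly_Mapping.keys p. scalar (Poly_Mapping.lookup p u) * word_prod (letters u))"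
  by (rule trans[OF word_expansion]) simp

lemma invariant_commutes_grp:
  assumes w: "w \<in> grp D"
  shows "p * gen (Grp w) - gen (Grp w) * p \<in> J"
proof -
  let ?c = "\<lambda>u. scalar (Poly_Mapping.lookup p u)"
  have "gen (Grp w) * p = (\<Sum>u\<in>Poly_Mapping.keys p. ?c u * (gen (Grp w) * word_prod (letters u)))"
    by (subst word_expansion_p) (simp add: sum_distrib_left scalar_norm)
  also have "\<dots> \<doteq> (\<Sum>u\<in>Poly_Mapping.keys p. ?c u * (word_prod (map (letter_act w) (letters u)) * gen (Grp w)))"
    by (intro cong_sum cong_mult cong_refl word_grp_intertwine w letters_p)
  also have "\<dots> = tensor_act w p * gen (Grp w)"
    by (simp add: tensor_act_expand sum_distrib_right mult.assoc)
  also have "\<dots> \<doteq> p * gen (Grp w)"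
    by (intro cong_mult cong_refl inv w)
  finally show ?thesis by (metis cong_def cong_sym)
qed

lemma invariant_commutes_family:
  assumes l: "l \<in> L"
  shows "p * gen l - gen l * p \<in> J"
proof -
  let ?c = "\<lambda>u. scalar (Poly_Mapping.lookup p u)"
  have w: "gen l * word_prod ls \<doteq> word_prod ls * gen l" if "set ls \<subseteq> L" for ls
    using that
  proof (induction ls)
    case Nil
    then show ?case by (simp add: zero_word_def[symmetric])
  next
    case (Cons k ls)
    have "gen l * word_prod (k # ls) = (gen l * gen k) * word_prod ls"
      by (simp add: single_Cons_word mult.assoc)
    also have "\<dots> \<doteq> (gen k * gen l) * word_prod ls"
      using Cons.prems by (intro cong_mult cong_refl commute l) auto
    also have "\<dots> = gen k * (gen l * word_prod ls)" by (simp add: mult.assoc)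
    also have "\<dots> \<doteq> gen k * (word_prod ls * gen l)"
      using Cons.prems by (intro cong_mult[OF cong_refl Cons.IH]) auto
    finally show ?case by (simp add: single_Cons_word mult.assoc)
  qed
  have "gen l * p = (\<Sum>u\<in>Poly_Mapping.keys p. ?c u * (gen l * word_prod (letters u)))"
    by (subst word_expansion_p) (simp add: sum_distrib_left scalar_norm)
  also have "\<dots> \<doteq> (\<Sum>u\<in>Poly_Mapping.keys p. ?c u * (word_prod (letters u) * gen l))"
    by (intro cong_sum cong_mult cong_refl w letters_p)
  also have "\<dots> = p * gen l"
    by (subst (3) word_expansion_p) (simp add: sum_distrib_right mult.assoc)
  finally show ?thesis by (metis cong_def cong_sym)
qed

text \<open>Replace \<open>p\<close> by its average over \<open>W\<close>, to which \<open>reflected_deriv_average\<close> applies word by word.\<close>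

lemma invariant_commutes_dual:
  assumes central: "\<And>s q. s \<in> reflections D \<Longrightarrow> kap s * q \<doteq> q * kap s"
    and b: "\<And>l. l \<in> L \<Longrightarrow> b * gen l - gen l * b \<doteq> (\<Sum>s\<in>reflections D. kap s * scalar (phi s l) * gen (Grp s))"
  shows "p * b - b * p \<in> J"
proof -
  let ?c = "\<lambda>u. scalar (Poly_Mapping.lookup p u)" and ?K = "Poly_Mapping.keys p"
  let ?m = "\<lambda>w u. map (letter_act w) (letters u)"
  have "scalar (of_nat (card (grp D))) * p = (\<Sum>w\<in>grp D. p)"
    by (simp add: scalar_def)
  also have "\<dots> \<doteq> (\<Sum>w\<in>grp D. tensor_act w p)"
    by (intro cong_sum cong_sym[OF inv])
  finally have avg: "scalar (of_nat (card (grp D))) * p \<doteq> (\<Sum>w\<in>grp D. tensor_act w p)" .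
  have "scalar (of_nat (card (grp D))) * (p * b - b * p) =
      (scalar (of_nat (card (grp D))) * p) * b - b * (scalar (of_nat (card (grp D))) * p)"
    by (simp add: algebra_simps scalar_swap[of b])
  also have "\<dots> \<doteq> (\<Sum>w\<in>grp D. tensor_act w p) * b - b * (\<Sum>w\<in>grp D. tensor_act w p)"
    by (intro cong_diff cong_mult avg cong_refl)
  also have "\<dots> = - (\<Sum>w\<in>grp D. \<Sum>u\<in>?K. ?c u * (b * word_prod (?m w u) - word_prod (?m w u) * b))"
    by (simp add: tensor_act_expand sum_distrib_left sum_distrib_right sum_subtractf scalar_swap[of b] algebra_simps)
  also have "\<dots> \<doteq> - (\<Sum>w\<in>grp D. \<Sum>u\<in>?K. ?c u * (\<Sum>s\<in>reflections D. kap s * reflected_deriv s (?m w u) * gen (Grp s)))"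
    by (intro cong_uminus cong_sum cong_mult cong_refl word_commutator central b act_list_closed letters_p)
  also have "\<dots> = - (\<Sum>u\<in>?K. \<Sum>w\<in>grp D. ?c u * (\<Sum>s\<in>reflections D. kap s * reflected_deriv s (?m w u) * gen (Grp s)))"
    by (subst sum.swap) (rule refl)
  also have "\<dots> = - (\<Sum>u\<in>?K. ?c u * (\<Sum>w\<in>grp D. \<Sum>s\<in>reflections D. kap s * reflected_deriv s (?m w u) * gen (Grp s)))"
    by (simp add: sum_distrib_left)
  also have "\<dots> = - (\<Sum>u\<in>?K. ?c u * (\<Sum>s\<in>reflections D. kap s * (\<Sum>w\<in>grp D. reflected_deriv s (?m w u)) * gen (Grp s)))"
    by (subst sum.swap) (simp add: sum_distrib_left sum_distrib_right)
  also have "\<dots> \<doteq> - (\<Sum>u\<in>?K. ?c u * (\<Sum>s\<in>reflections D. kap s * 0 * gen (Grp s)))"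
    by (intro cong_uminus cong_sum cong_mult cong_refl)
      (simp add: cong_zero_iff reflected_deriv_average letters_p)
  finally have "scalar (of_nat (card (grp D))) * (p * b - b * p) \<in> J"
    by (simp add: cong_zero_iff)
  moreover have "card (grp D) \<noteq> 0"
    using finite_grp grp_closed(1) by auto
  ultimately show ?thesis
    using scale_cancel by (metis of_nat_eq_0_iff)
qed

end

end

context cherednik_congruence
begin

lemma cov_letter_family:
  "letter_family D J (cov_letters D) (\<lambda>s g. case g of Cov x \<Rightarrow> x (alpha_chk D s) | _ \<Rightarrow> 0)
     (\<lambda>s. gen (Cov (alpha D s)))
     (\<lambda>s g. case g of Cov x \<Rightarrow> gen (Cov x) - scalar (x (alpha_chk D s) / 2) * gen (Cov (alpha D s)) | _ \<Rightarrow> 0)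
     (\<lambda>s. inverse (refl_eig s))"
proof (unfold_locales, goal_cases)
  case (1 w l)
  then show ?case by (auto simp: cov_letters_def coact_covector)
next
  case (2 w l)
  then show ?case by (auto simp: cov_letters_def intro: grp_rels)
next
  case (3 l l')
  then show ?case by (auto simp: cov_letters_def intro: comm_rels_cong)
next
  case (4 s)
  then show ?case using refl_eig[OF 4] by simp
next
  case (5 s)
  then show ?case using refl_eig_root_of_unity[OF 5] by (auto simp: power_inverse)
next
  case (6 s l i)
  then obtain x where x: "l = Cov x" "x \<in> covectors D" by (auto simp: cov_letters_def)
  have \<alpha>: "alpha D s \<in> covectors D" by (rule alpha_covector) fact
  let ?k = "x (alpha_chk D s)" and ?m = "inverse (refl_eig s) ^ i"
  have "gen (Cov (coact (s ^^ i) x)) \<doteq> gen (Cov x) + gen (Cov (\<lambda>v. ((?m - 1) / 2 * ?k) * alpha D s v))"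
    unfolding coact_refl_power[OF 6(1) x(2)] by (intro cov_rels covectors_closed x \<alpha>)
  also have "\<dots> \<doteq> gen (Cov x) + scalar ((?m - 1) / 2 * ?k) * gen (Cov (alpha D s))"
    by (intro cong_add cong_refl cov_rels \<alpha>)
  also have "(?m - 1) / 2 * ?k = ?m * (?k / 2) - ?k / 2" by (simp add: field_simps)
  finally show ?case
    by (simp add: x scalar_simps(2) algebra_simps)
next
  case (7 s l i)
  then obtain x where x: "l = Cov x" "x \<in> covectors D" by (auto simp: cov_letters_def)
  show ?case
    using alpha_pairing[OF 7(1)] by (simp add: x coact_refl_power[OF 7(1) x(2)] field_simps)
next
  case (8 s l)
  then obtain x where x: "l = Cov x" "x \<in> covectors D" by (auto simp: cov_letters_def)
  have \<alpha>: "alpha D s \<in> covectors D" by (rule alpha_covector) fact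
  have "gen (Cov (alpha D s)) * gen (Cov x) \<doteq> gen (Cov x) * gen (Cov (alpha D s))"
    by (intro comm_rels_cong \<alpha> x)
  then show ?case
    by (simp add: x cong_def algebra_simps scalar_norm)
qed

lemma vec_letter_family:
  "letter_family D J vec_letters (\<lambda>s g. case g of Vec y \<Rightarrow> alpha D s y | _ \<Rightarrow> 0)
     (\<lambda>s. gen (Vec (alpha_chk D s)))
     (\<lambda>s g. case g of Vec y \<Rightarrow> gen (Vec y) - scalar (alpha D s y / 2) * gen (Vec (alpha_chk D s)) | _ \<Rightarrow> 0)
     refl_eig"
proof (unfold_locales, goal_cases)
  case (1 w l)
  then show ?case by (auto simp: vec_letters_def)
next
  case (2 w l)
  then show ?case by (auto simp: vec_letters_def intro: grp_rels)
next
  case (3 l l')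
  then show ?case by (auto simp: vec_letters_def intro: comm_rels_cong)
next
  case (4 s)
  then show ?case by (rule refl_eig)
next
  case (5 s)
  then show ?case by (rule refl_eig_root_of_unity)
next
  case (6 s l i)
  then obtain y where y: "l = Vec y" by (auto simp: vec_letters_def)
  let ?k = "alpha D s y" and ?m = "refl_eig s ^ i"
  have "gen (Vec ((s ^^ i) y)) \<doteq> gen (Vec y) + gen (Vec (scl D ((?m - 1) / 2 * ?k) (alpha_chk D s)))"
    unfolding refl_power[OF 6(1)] by (rule vec_rels)
  also have "\<dots> \<doteq> gen (Vec y) + scalar ((?m - 1) / 2 * ?k) * gen (Vec (alpha_chk D s))"
    by (intro cong_add cong_refl vec_rels)
  also have "(?m - 1) / 2 * ?k = ?m * (?k / 2) - ?k / 2" by (simp add: field_simps)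
  finally show ?case
    by (simp add: y scalar_simps(2) algebra_simps)
next
  case (7 s l i)
  then obtain y where y: "l = Vec y" by (auto simp: vec_letters_def)
  show ?case
    using alpha_pairing[OF 7(1)] alpha_covector[OF 7(1)]
    by (simp add: y refl_power[OF 7(1)] covectors_iff field_simps)
next
  case (8 s l)
  then obtain y where y: "l = Vec y" by (auto simp: vec_letters_def)
  have "gen (Vec (alpha_chk D s)) * gen (Vec y) \<doteq> gen (Vec y) * gen (Vec (alpha_chk D s))"
    by (rule comm_rels_cong)
  then show ?case
    by (simp add: y cong_def algebra_simps scalar_norm)
qed

context
  assumes t_mem: "gen Par_t \<in> J"
begin

lemma vec_cov_rel_mod_t:
  assumes "x \<in> covectors D"
  shows "gen (Vec y) * gen (Cov x) - gen (Cov x) * gen (Vec y) \<doteq> - refl_sum x y"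
proof -
  have "gen (Vec y) * gen (Cov x) - gen (Cov x) * gen (Vec y) \<doteq> gen Par_t * scalar (x y) - refl_sum x y"
    by (rule vec_cov_rel[OF assms])
  also have "\<dots> \<doteq> 0 * scalar (x y) - refl_sum x y"
    using t_mem by (intro cong_diff cong_mult cong_refl) (simp add: cong_zero_iff)
  finally show ?thesis by simp
qed

lemma scaled_par_c_central:
  "s \<in> reflections D \<Longrightarrow> (par_c s * scalar a) * q \<doteq> q * (par_c s * scalar a)"
  using cong_mult[OF cong_refl[of "scalar a"] par_c_central[of s q]]
  by (simp add: scalar_norm mult.assoc) (metis mult.assoc scalar_commutes)

theorem cov_invariant_central:
  assumes p: "p \<in> free_carrier (cov_letters D)" and inv: "\<And>w. w \<in> grp D \<Longrightarrow> tensor_act w p \<doteq> p"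
  shows "p * q - q * p \<in> J"
proof -
  let ?phi = "\<lambda>s g. case g of Cov x \<Rightarrow> x (alpha_chk D s) | _ \<Rightarrow> 0"
  interpret letter_family D J "cov_letters D" ?phi
     "\<lambda>s. gen (Cov (alpha D s))"
     "\<lambda>s g. case g of Cov x \<Rightarrow> gen (Cov x) - scalar (x (alpha_chk D s) / 2) * gen (Cov (alpha D s)) | _ \<Rightarrow> 0"
     "\<lambda>s. inverse (refl_eig s)"
    by (rule cov_letter_family)
  show ?thesis
  proof (rule central_memI)
    fix w assume "w \<in> grp D"
    then show "p * gen (Grp w) - gen (Grp w) * p \<in> J"
      by (intro invariant_commutes_grp[OF p inv])
  next
    fix x assume "x \<in> covectors D"
    then show "p * gen (Cov x) - gen (Cov x) * p \<in> J"
      by (intro invariant_commutes_family[OF p inv]) (auto simp: cov_letters_def)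
  next
    fix y
    show "p * gen (Vec y) - gen (Vec y) * p \<in> J"
    proof (rule invariant_commutes_dual[OF p, where kap = "\<lambda>s. par_c s * scalar (- alpha D s y)"])
      fix l assume "l \<in> cov_letters D"
      then obtain x where x: "l = Cov x" "x \<in> covectors D" by (auto simp: cov_letters_def)
      have "- refl_sum x y = (\<Sum>s\<in>reflections D. par_c s * scalar (- alpha D s y) * scalar (?phi s l) * gen (Grp s))"
        by (simp add: refl_sum_def x scalar_norm scalar_simps(4) mult.assoc sum_negf mult.commute)
      with vec_cov_rel_mod_t[OF x(2), of y] x(1)
      show "gen (Vec y) * gen l - gen l * gen (Vec y) \<doteq>
          (\<Sum>s\<in>reflections D. par_c s * scalar (- alpha D s y) * scalar (?phi s l) * gen (Grp s))"
        by simp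
    qed (rule inv scaled_par_c_central; assumption)+
  qed
qed

theorem vec_invariant_central:
  assumes p: "p \<in> free_carrier vec_letters" and inv: "\<And>w. w \<in> grp D \<Longrightarrow> tensor_act w p \<doteq> p"
  shows "p * q - q * p \<in> J"
proof -
  let ?phi = "\<lambda>s g. case g of Vec y \<Rightarrow> alpha D s y | _ \<Rightarrow> 0"
  interpret letter_family D J vec_letters ?phi
     "\<lambda>s. gen (Vec (alpha_chk D s))"
     "\<lambda>s g. case g of Vec y \<Rightarrow> gen (Vec y) - scalar (alpha D s y / 2) * gen (Vec (alpha_chk D s)) | _ \<Rightarrow> 0"
     refl_eig
    by (rule vec_letter_family)
  show ?thesis
  proof (rule central_memI)
    fix w assume "w \<in> grp D"
    then show "p * gen (Grp w) - gen (Grp w) * p \<in> J"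
      by (intro invariant_commutes_grp[OF p inv])
  next
    fix y
    show "p * gen (Vec y) - gen (Vec y) * p \<in> J"
      by (intro invariant_commutes_family[OF p inv]) (auto simp: vec_letters_def)
  next
    fix x assume x: "x \<in> covectors D"
    show "p * gen (Cov x) - gen (Cov x) * p \<in> J"
    proof (rule invariant_commutes_dual[OF p, where kap = "\<lambda>s. par_c s * scalar (x (alpha_chk D s))"])
      fix l :: "'v letter" assume "l \<in> vec_letters"
      then obtain y where y: "l = Vec y" by (auto simp: vec_letters_def)
      have "refl_sum x y = (\<Sum>s\<in>reflections D. par_c s * scalar (x (alpha_chk D s)) * scalar (?phi s l) * gen (Grp s))"
        by (simp add: refl_sum_def y scalar_norm mult.assoc)
      with cong_uminus[OF vec_cov_rel_mod_t[OF x, of y]] y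
      show "gen (Cov x) * gen l - gen l * gen (Cov x) \<doteq>
          (\<Sum>s\<in>reflections D. par_c s * scalar (x (alpha_chk D s)) * scalar (?phi s l) * gen (Grp s))"
        by simp
    qed (rule inv scaled_par_c_central; assumption)+
  qed
qed

theorem euler_central: "euler * q - q * euler \<in> J"
proof (rule central_memI)
  show "euler * gen (Vec y) - gen (Vec y) * euler \<in> J" for y
    by (rule cong_mem[OF euler_vec]) (intro uminus_mem mult_right_mem t_mem)
  show "euler * gen (Cov x) - gen (Cov x) * euler \<in> J" if "x \<in> covectors D" for x
    by (rule cong_mem[OF euler_cov[OF that]]) (intro mult_right_mem t_mem)
qed (rule euler_grp)

end

end

section \<open>Passing between tensors and cosets\<close>

lemma the_elem_image_const:
  assumes "p \<in> X" "\<And>q. q \<in> X \<Longrightarrow> f q = y" shows "the_elem (f ` X) = y"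
proof -
  have "f ` X = {y}" using assms by auto
  then show ?thesis by simp
qed

definition proj_letters :: "'g set \<Rightarrow> 'g free_algebra \<Rightarrow> 'g free_algebra" where
  "proj_letters G = keep_words (\<lambda>u. set (letters u) \<subseteq> G)"

lemma proj_letters_simps:
  "proj_letters G (p + q) = proj_letters G p + proj_letters G q"
  "proj_letters G (p - q) = proj_letters G p - proj_letters G q"
  "proj_letters G (p * q) = proj_letters G p * proj_letters G q"
  "proj_letters G 0 = 0"
  by (simp_all add: proj_letters_def keep_words_add keep_words_diff keep_words_mult letters_plus_word)

lemma proj_letters_carrier [simp]: "proj_letters G p \<in> free_carrier G"
  by (auto simp: proj_letters_def free_carrier_def keys_keep_words)

lemma proj_letters_id: "p \<in> free_carrier G \<Longrightarrow> proj_letters G p = p"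
  unfolding proj_letters_def by (rule keep_words_id) (auto simp: free_carrier_def)

lemma proj_letters_foreign: "g \<notin> G \<Longrightarrow> proj_letters G (gen g) = 0"
  by (simp add: proj_letters_def gen_def keep_words_single)

abbreviation tensors :: "'v::ab_group_add refl_data \<Rightarrow> 'v tensor set" where
  "tensors D \<equiv> free_carrier (all_letters D)"

text \<open>Foreign letters are deleted first; otherwise the result would be an ideal of \<open>tensors D\<close>
  only, not of the ring of all tensors.\<close>

definition univ_preimage :: "'v::ab_group_add refl_data \<Rightarrow> 'v univ_elem set \<Rightarrow> 'v tensor set" where
  "univ_preimage D I = {p. univ_cls D (proj_letters (all_letters D) p) \<in> I}"

definition t_ideal :: "'v::ab_group_add refl_data \<Rightarrow> 'v univ_elem set" where
  "t_ideal D = Idl\<^bsub>univ_alg D\<^esub> {univ_t D}"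

lemma genideal_cong_subset:
  assumes "two_sided_ideal J" "S \<subseteq> J" "S \<subseteq> free_carrier G"
  shows "Idl\<^bsub>free_alg G\<^esub> S \<subseteq> J"
proof -
  interpret two_sided_ideal J by fact
  have "ideal {p \<in> free_carrier G. p \<in> J} (free_alg G)"
    by (rule ideal_free_algI) (auto intro: zero_mem add_mem mult_left_mem mult_right_mem)
  from ring.genideal_minimal[OF ring_free_alg this, of S] show ?thesis using assms by auto
qed

context refl_group
begin

lemma univ_ideal_ideal: "ideal (univ_ideal D) (free_alg (all_letters D))"
  unfolding univ_ideal_def
  by (rule ring.genideal_ideal[OF ring_free_alg])
    (simp add: carrier_free_alg smash_rels_carrier commutation_rels_carrier)

lemma rels_in_univ_ideal: "smash_rels D \<union> commutation_rels D \<subseteq> univ_ideal D"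
  unfolding univ_ideal_def
  by (rule ring.genideal_self[OF ring_free_alg])
    (simp add: carrier_free_alg smash_rels_carrier commutation_rels_carrier)

lemma univ_ideal_carrier: "univ_ideal D \<subseteq> tensors D"
  using ideal.Icarr[OF univ_ideal_ideal] by (auto simp: carrier_free_alg)

lemma ring_univ: "ring (univ_alg D)"
  unfolding univ_alg_def by (rule ideal.quotient_is_ring[OF univ_ideal_ideal])

lemma univ_cls_hom: "ring_hom_ring (free_alg (all_letters D)) (univ_alg D) (univ_cls D)"
proof -
  have "univ_cls D = (+>\<^bsub>free_alg (all_letters D)\<^esub>) (univ_ideal D)"
    by (rule ext) (simp add: univ_cls_def)
  then show ?thesis
    unfolding univ_alg_def by (simp add: ideal.rcos_ring_hom_ring[OF univ_ideal_ideal])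
qed

sublocale univ: ring_hom_ring "free_alg (all_letters D)" "univ_alg D" "univ_cls D"
  rewrites "carrier (free_alg (all_letters D)) = tensors D"
    and "monoid.mult (free_alg (all_letters D)) = (*)" and "one (free_alg (all_letters D)) = 1"
    and "zero (free_alg (all_letters D)) = 0" and "add (free_alg (all_letters D)) = (+)"
  by (rule univ_cls_hom) (simp_all add: carrier_free_alg)

lemma univ_carrier: "carrier (univ_alg D) = univ_cls D ` tensors D"
  unfolding univ_alg_def FactRing_def A_RCOSETS_def'
  by (auto simp: univ_cls_def carrier_free_alg)

lemma univ_cls_closed [simp]: "p \<in> tensors D \<Longrightarrow> univ_cls D p \<in> carrier (univ_alg D)"
  by (simp add: univ_carrier)

lemma univ_cls_uminus: "p \<in> tensors D \<Longrightarrow> univ_cls D (- p) = \<ominus>\<^bsub>univ_alg D\<^esub> univ_cls D p"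
  using univ.hom_a_inv[of p] free_alg_a_inv[of p "all_letters D"] by simp

lemma univ_cls_diff:
  "p \<in> tensors D \<Longrightarrow> q \<in> tensors D \<Longrightarrow> univ_cls D (p - q) = univ_cls D p \<ominus>\<^bsub>univ_alg D\<^esub> univ_cls D q"
  using univ.hom_add[of p "- q"] by (simp add: univ_cls_uminus a_minus_def)

lemma univ_cls_eq_iff:
  "p \<in> tensors D \<Longrightarrow> q \<in> tensors D \<Longrightarrow> univ_cls D p = univ_cls D q \<longleftrightarrow> p - q \<in> univ_ideal D"
  using ring.quotient_eq_iff_same_a_r_cos[OF ring_free_alg univ_ideal_ideal, of p q]
  by (simp add: univ_cls_def carrier_free_alg free_alg_a_minus)

lemma univ_cls_rep: "z \<in> carrier (univ_alg D) \<Longrightarrow> \<exists>p\<in>tensors D. z = univ_cls D p"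
  by (auto simp: univ_carrier)

lemma univ_preimage_cong:
  assumes "ideal I (univ_alg D)"
  shows "cherednik_congruence D (univ_preimage D I)"
proof -
  interpret I: ideal I "univ_alg D" by fact
  have rels: "r \<in> univ_preimage D I" if "r \<in> univ_ideal D" for r
  proof -
    have r: "r \<in> tensors D" using that univ_ideal_carrier by blast
    then have "univ_cls D r = univ_cls D 0"
      using that by (subst univ_cls_eq_iff) auto
    then show ?thesis
      using r by (simp add: univ_preimage_def proj_letters_id)
  qed
  show ?thesis
  proof unfold_locales
    show "smash_rels D \<subseteq> univ_preimage D I" "commutation_rels D \<subseteq> univ_preimage D I"
      using rels_in_univ_ideal rels by auto
  qed (auto simp: univ_preimage_def proj_letters_simps proj_letters_foreign I.I_l_closed I.I_r_closed)
qed

lemma univ_preimage_iff: "p \<in> tensors D \<Longrightarrow> p \<in> univ_preimage D I \<longleftrightarrow> univ_cls D p \<in> I"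
  by (simp add: univ_preimage_def proj_letters_id)

lemma univ_t_carrier: "univ_t D \<in> carrier (univ_alg D)"
  unfolding univ_t_def by (simp add: univ_carrier)

lemma t_ideal_ideal: "ideal (t_ideal D) (univ_alg D)"
  unfolding t_ideal_def by (rule univ.S.genideal_ideal) (simp add: univ_t_carrier)

lemma t_in_preimage: "gen Par_t \<in> univ_preimage D (t_ideal D)"
  by (subst univ_preimage_iff)
    (auto simp: t_ideal_def univ_t_def[symmetric] intro: univ.S.genideal_self' univ_t_carrier)

lemma poisson_centerI:
  assumes p: "p \<in> tensors D" and c: "\<And>q. q \<in> tensors D \<Longrightarrow> p * q - q * p \<in> univ_preimage D (t_ideal D)"
  shows "univ_cls D p \<in> poisson_center D"
proof -
  interpret I: ideal "t_ideal D" "univ_alg D" by (rule t_ideal_ideal)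
  let ?Q = "univ_alg D Quot t_ideal D" and ?c = "\<lambda>a. t_ideal D +>\<^bsub>univ_alg D\<^esub> a"
  have car: "carrier ?Q = ?c ` carrier (univ_alg D)"
    by (auto simp: FactRing_def A_RCOSETS_def')
  have "?c (univ_cls D p) \<otimes>\<^bsub>?Q\<^esub> a = a \<otimes>\<^bsub>?Q\<^esub> ?c (univ_cls D p)" if "a \<in> carrier ?Q" for a
  proof -
    from that car obtain b where b: "b \<in> carrier (univ_alg D)" "a = ?c b" by blast
    then obtain q where q: "q \<in> tensors D" "b = univ_cls D q" using univ_cls_rep by blast
    have "univ_cls D (p * q - q * p) \<in> t_ideal D"
      using c[OF q(1)] p q by (simp add: univ_preimage_iff)
    then have "(univ_cls D p \<otimes>\<^bsub>univ_alg D\<^esub> b) \<ominus>\<^bsub>univ_alg D\<^esub> (b \<otimes>\<^bsub>univ_alg D\<^esub> univ_cls D p) \<in> t_ideal D"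
      using p q by (simp add: univ_cls_diff)
    then have "?c (univ_cls D p \<otimes>\<^bsub>univ_alg D\<^esub> b) = ?c (b \<otimes>\<^bsub>univ_alg D\<^esub> univ_cls D p)"
      using p b by (subst univ.S.quotient_eq_iff_same_a_r_cos[OF t_ideal_ideal, symmetric]) auto
    then show ?thesis
      using p b by (simp add: FactRing_def I.rcoset_mult_add)
  qed
  then show ?thesis
    using p by (simp add: poisson_center_def Let_def t_ideal_def[symmetric] ring_center_def car)
qed

lemma cov_letters_tensors: "free_carrier (cov_letters D) \<subseteq> tensors D"
  and vec_letters_tensors: "free_carrier vec_letters \<subseteq> tensors D"
  by (auto simp: free_carrier_def all_letters_def)

lemma sym_rels_carrier:
  "cov_lin_rels D \<union> comm_rels (cov_letters D) \<subseteq> free_carrier (cov_letters D)"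
  "vec_lin_rels D \<union> comm_rels vec_letters \<subseteq> free_carrier vec_letters"
  unfolding cov_lin_rels_def vec_lin_rels_def comm_rels_def
  by (auto intro!: free_carrier_closed simp: cov_letters_def vec_letters_def covectors_closed)

lemma sym_ideal_subset:
  assumes "cherednik_congruence D J"
  shows "Idl\<^bsub>free_alg (cov_letters D)\<^esub> (cov_lin_rels D \<union> comm_rels (cov_letters D)) \<subseteq> J"
    "Idl\<^bsub>free_alg vec_letters\<^esub> (vec_lin_rels D \<union> comm_rels vec_letters) \<subseteq> J"
proof -
  interpret J: cherednik_congruence D J by fact
  have "cov_lin_rels D \<union> comm_rels (cov_letters D) \<subseteq> J"
    using J.rels_mem by (auto simp: smash_rels_def commutation_rels_def)
  then show "Idl\<^bsub>free_alg (cov_letters D)\<^esub> (cov_lin_rels D \<union> comm_rels (cov_letters D)) \<subseteq> J"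
    by (rule genideal_cong_subset[OF J.two_sided_ideal_axioms _ sym_rels_carrier(1)])
  have "vec_lin_rels D \<union> comm_rels vec_letters \<subseteq> J"
    using J.rels_mem by (auto simp: smash_rels_def commutation_rels_def)
  then show "Idl\<^bsub>free_alg vec_letters\<^esub> (vec_lin_rels D \<union> comm_rels vec_letters) \<subseteq> J"
    by (rule genideal_cong_subset[OF J.two_sided_ideal_axioms _ sym_rels_carrier(2)])
qed

text \<open>Cosets of the ideal that defines a symmetric algebra are handled through representatives.\<close>

lemma sym_alg_elem:
  assumes "X \<in> carrier (sym_alg L R)" "R \<union> comm_rels L \<subseteq> free_carrier L" "p \<in> X"
  shows "p \<in> free_carrier L" "q \<in> X \<Longrightarrow> q - p \<in> Idl\<^bsub>free_alg L\<^esub> (R \<union> comm_rels L)"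
proof -
  let ?I = "Idl\<^bsub>free_alg L\<^esub> (R \<union> comm_rels L)"
  have I: "ideal ?I (free_alg L)"
    by (rule ring.genideal_ideal[OF ring_free_alg]) (use assms in \<open>simp add: carrier_free_alg\<close>)
  obtain r where r: "r \<in> free_carrier L" "X = ?I +>\<^bsub>free_alg L\<^esub> r"
    using assms(1) by (auto simp: sym_alg_def FactRing_def A_RCOSETS_def' carrier_free_alg)
  have elem: "\<exists>i\<in>?I. q = i + r" if "q \<in> X" for q
    using that r by (auto simp: a_r_coset_def')
  have "?I \<subseteq> free_carrier L" using ideal.Icarr[OF I] by (auto simp: carrier_free_alg)
  then show "p \<in> free_carrier L" using elem[OF assms(3)] r(1) by auto
  show "q - p \<in> ?I" if q: "q \<in> X"
  proof -
    obtain i j where ij: "i \<in> ?I" "j \<in> ?I" "p = i + r" "q = j + r"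
      using elem[OF assms(3)] elem[OF q] by blast
    interpret I: ideal ?I "free_alg L" by (rule I)
    have "- i \<in> ?I"
      using I.I_l_closed[OF ij(1), of "-1"] by (simp add: carrier_free_alg)
    from additive_subgroup.a_closed[OF ideal.axioms(1)[OF I] ij(2) this] show ?thesis by (simp add: ij)
  qed
qed

lemma sym_invariantE:
  assumes "X \<in> sym_invariants D (cov_letters D) (cov_lin_rels D) \<or> X \<in> sym_invariants D vec_letters (vec_lin_rels D)"
  obtains L R where "X \<in> carrier (sym_alg L R)" "R \<union> comm_rels L \<subseteq> free_carrier L" "free_carrier L \<subseteq> tensors D"
    "\<And>w. w \<in> grp D \<Longrightarrow> tensor_act w ` X = X"
    "\<And>J. cherednik_congruence D J \<Longrightarrow> Idl\<^bsub>free_alg L\<^esub> (R \<union> comm_rels L) \<subseteq> J"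
    "(L, R) = (cov_letters D, cov_lin_rels D) \<or> (L, R) = (vec_letters, vec_lin_rels D)"
  using assms
proof
  assume "X \<in> sym_invariants D (cov_letters D) (cov_lin_rels D)"
  then show ?thesis
    using that[OF _ sym_rels_carrier(1) cov_letters_tensors _ sym_ideal_subset(1)]
    by (simp add: sym_invariants_def)
next
  assume "X \<in> sym_invariants D vec_letters (vec_lin_rels D)"
  then show ?thesis
    using that[OF _ sym_rels_carrier(2) vec_letters_tensors _ sym_ideal_subset(2)]
    by (simp add: sym_invariants_def)
qed

text \<open>A representative of an invariant class is invariant modulo the relations of the symmetric
  algebra, and these hold in \<open>univ_alg D\<close>.\<close>

lemma sym_invariant_poisson:
  assumes X: "X \<in> sym_invariants D (cov_letters D) (cov_lin_rels D) \<or> X \<in> sym_invariants D vec_letters (vec_lin_rels D)"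
    and p: "p \<in> X"
  shows "univ_cls D p \<in> poisson_center D"
proof -
  interpret J: cherednik_congruence D "univ_preimage D (t_ideal D)"
    by (rule univ_preimage_cong[OF t_ideal_ideal])
  from X show ?thesis
  proof (rule sym_invariantE)
    fix L R assume LR: "X \<in> carrier (sym_alg L R)" "R \<union> comm_rels L \<subseteq> free_carrier L" "free_carrier L \<subseteq> tensors D"
      "\<And>w. w \<in> grp D \<Longrightarrow> tensor_act w ` X = X"
      "\<And>J. cherednik_congruence D J \<Longrightarrow> Idl\<^bsub>free_alg L\<^esub> (R \<union> comm_rels L) \<subseteq> J"
      "(L, R) = (cov_letters D, cov_lin_rels D) \<or> (L, R) = (vec_letters, vec_lin_rels D)"
    have c: "J.cong (tensor_act w p) p" if w: "w \<in> grp D" for w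
    proof -
      have "tensor_act w p \<in> X" using LR(4)[OF w] p by blast
      from sym_alg_elem(2)[OF LR(1,2) p this] LR(5)[OF J.cherednik_congruence_axioms]
      show ?thesis by (auto simp: J.cong_def)
    qed
    have pc: "p \<in> free_carrier L" by (rule sym_alg_elem(1)[OF LR(1,2) p])
    show ?thesis
    proof (rule poisson_centerI)
      show "p \<in> tensors D" using pc LR(3) by blast
      show "p * q - q * p \<in> univ_preimage D (t_ideal D)" for q
        using LR(6) J.cov_invariant_central[OF t_in_preimage _ c] J.vec_invariant_central[OF t_in_preimage _ c] pc
        by blast
    qed
  qed
qed

lemma euler_tensor: "euler \<in> tensors D"
  unfolding euler_def
  by (intro free_carrier_closed sum_free_carrier)
    (auto simp: coord_covector dest: subsetD[OF reflections_subset])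

lemma euler_poisson: "univ_cls D euler \<in> poisson_center D"
proof -
  interpret J: cherednik_congruence D "univ_preimage D (t_ideal D)"
    by (rule univ_preimage_cong[OF t_ideal_ideal])
  show ?thesis
    by (intro poisson_centerI euler_tensor J.euler_central t_in_preimage)
qed

section \<open>The specialised algebra\<close>

lemma chered_ideal_ideal: "ideal (chered_ideal D c) (univ_alg D)"
  unfolding chered_ideal_def
  by (rule univ.S.genideal_ideal) auto

definition chered_preimage :: "'v param \<Rightarrow> 'v tensor set" where
  "chered_preimage c = univ_preimage D (chered_ideal D c)"

lemma chered_preimage_cong: "cherednik_congruence D (chered_preimage c)"
  unfolding chered_preimage_def by (rule univ_preimage_cong[OF chered_ideal_ideal])

lemma ring_chered: "ring (chered_alg D c)"
  unfolding chered_alg_def by (rule ideal.quotient_is_ring[OF chered_ideal_ideal])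

lemma chered_cls_simps:
  "chered_cls D c 1 = \<one>\<^bsub>chered_alg D c\<^esub>" "chered_cls D c 0 = \<zero>\<^bsub>chered_alg D c\<^esub>"
  "p \<in> tensors D \<Longrightarrow> chered_cls D c p \<in> carrier (chered_alg D c)"
  "p \<in> tensors D \<Longrightarrow> q \<in> tensors D \<Longrightarrow> chered_cls D c (p + q) = chered_cls D c p \<oplus>\<^bsub>chered_alg D c\<^esub> chered_cls D c q"
  "p \<in> tensors D \<Longrightarrow> q \<in> tensors D \<Longrightarrow> chered_cls D c (p * q) = chered_cls D c p \<otimes>\<^bsub>chered_alg D c\<^esub> chered_cls D c q"
proof -
  interpret Q: ring_hom_ring "univ_alg D" "chered_alg D c" "\<lambda>z. chered_ideal D c +>\<^bsub>univ_alg D\<^esub> z"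
    unfolding chered_alg_def using ideal.rcos_ring_hom_ring[OF chered_ideal_ideal] .
  show "chered_cls D c 1 = \<one>\<^bsub>chered_alg D c\<^esub>" "chered_cls D c 0 = \<zero>\<^bsub>chered_alg D c\<^esub>"
    "p \<in> tensors D \<Longrightarrow> chered_cls D c p \<in> carrier (chered_alg D c)"
    "p \<in> tensors D \<Longrightarrow> q \<in> tensors D \<Longrightarrow> chered_cls D c (p + q) = chered_cls D c p \<oplus>\<^bsub>chered_alg D c\<^esub> chered_cls D c q"
    "p \<in> tensors D \<Longrightarrow> q \<in> tensors D \<Longrightarrow> chered_cls D c (p * q) = chered_cls D c p \<otimes>\<^bsub>chered_alg D c\<^esub> chered_cls D c q"
    by (simp_all add: chered_cls_def)
qed

lemma chered_cls_eq_iff: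
  "p \<in> tensors D \<Longrightarrow> q \<in> tensors D \<Longrightarrow> chered_cls D c p = chered_cls D c q \<longleftrightarrow> p - q \<in> chered_preimage c"
  using univ.S.quotient_eq_iff_same_a_r_cos[OF chered_ideal_ideal, of "univ_cls D p" "univ_cls D q"]
  by (simp add: chered_cls_def chered_preimage_def univ_preimage_iff univ_cls_diff)

lemma chered_t: "gen Par_t - 1 \<in> chered_preimage c"
proof -
  have "univ_cls D (gen Par_t - 1) \<in> chered_ideal D c"
    unfolding chered_ideal_def
    by (rule subsetD[OF univ.S.genideal_self]) auto
  then show ?thesis
    by (simp add: chered_preimage_def univ_preimage_iff)
qed

lemma chered_cls_finsum:
  assumes "finite A" "\<And>i. i \<in> A \<Longrightarrow> f i \<in> tensors D"
  shows "chered_cls D c (sum f A) = (\<Oplus>\<^bsub>chered_alg D c\<^esub>i\<in>A. chered_cls D c (f i))"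
proof -
  interpret A: ring "chered_alg D c" by (rule ring_chered)
  show ?thesis using assms
    by (induction A rule: finite_induct) (auto simp: chered_cls_simps sum_free_carrier Pi_def)
qed

lemma sym_emb_eq:
  assumes X: "X \<in> sym_invariants D (cov_letters D) (cov_lin_rels D) \<or> X \<in> sym_invariants D vec_letters (vec_lin_rels D)"
    and p: "p \<in> X"
  shows "sym_emb D c X = chered_cls D c p"
  using X
proof (rule sym_invariantE)
  fix L R assume LR: "X \<in> carrier (sym_alg L R)" "R \<union> comm_rels L \<subseteq> free_carrier L" "free_carrier L \<subseteq> tensors D"
    "\<And>J. cherednik_congruence D J \<Longrightarrow> Idl\<^bsub>free_alg L\<^esub> (R \<union> comm_rels L) \<subseteq> J"
  have "chered_cls D c q = chered_cls D c p" if q: "q \<in> X" for q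
  proof -
    have "q - p \<in> chered_preimage c"
      by (rule subsetD[OF LR(4)[OF chered_preimage_cong] sym_alg_elem(2)[OF LR(1,2) p q]])
    moreover have "p \<in> tensors D" "q \<in> tensors D"
      by (rule subsetD[OF LR(3) sym_alg_elem(1)[OF LR(1,2) p]],
          rule subsetD[OF LR(3) sym_alg_elem(1)[OF LR(1,2) q]])
    ultimately show ?thesis by (simp add: chered_cls_eq_iff)
  qed
  with p show ?thesis unfolding sym_emb_def by (rule the_elem_image_const)
qed

lemma sym_alg_elem_ex:
  assumes "X \<in> carrier (sym_alg L R)" "R \<union> comm_rels L \<subseteq> free_carrier L"
  shows "\<exists>p\<in>X. p \<in> free_carrier L"
proof -
  let ?I = "Idl\<^bsub>free_alg L\<^esub> (R \<union> comm_rels L)"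
  have I: "ideal ?I (free_alg L)"
    by (rule ring.genideal_ideal[OF ring_free_alg]) (use assms in \<open>simp add: carrier_free_alg\<close>)
  have 0: "0 \<in> ?I"
    using additive_subgroup.zero_closed[OF ideal.axioms(1)[OF I]] by simp
  obtain r where r: "r \<in> free_carrier L" "X = ?I +>\<^bsub>free_alg L\<^esub> r"
    using assms(1) by (auto simp: sym_alg_def FactRing_def A_RCOSETS_def' carrier_free_alg)
  have "0 + r \<in> X" using 0 r by (auto simp: a_r_coset_def' simp del: add_0)
  with r show ?thesis by auto
qed

lemma sym_invariant_letters:
  "X \<in> sym_invariants D (cov_letters D) (cov_lin_rels D) \<Longrightarrow> \<exists>p\<in>X. p \<in> free_carrier (cov_letters D)"
  "X \<in> sym_invariants D vec_letters (vec_lin_rels D) \<Longrightarrow> \<exists>p\<in>X. p \<in> free_carrier vec_letters"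
  by (rule sym_alg_elem_ex[OF _ sym_rels_carrier(1)], simp add: sym_invariants_def,
      rule sym_alg_elem_ex[OF _ sym_rels_carrier(2)], simp add: sym_invariants_def)

end

section \<open>Homogeneous components\<close>

definition hcomp :: "nat \<Rightarrow> 'v tensor \<Rightarrow> 'v tensor" where
  "hcomp k = keep_words (\<lambda>u. word_deg u = k)"

definition homog :: "nat \<Rightarrow> 'v tensor \<Rightarrow> bool" where
  "homog d p \<longleftrightarrow> (\<forall>u\<in>Poly_Mapping.keys p. word_deg u = d)"

lemma word_deg_plus: "word_deg (u + v) = word_deg u + word_deg v"
  by (simp add: word_deg_def letters_plus_word)

lemma word_deg_zero: "word_deg 0 = 0"
  by (simp add: word_deg_def letters_zero_word)

lemma hcomp_simps:
  "hcomp k (p + q) = hcomp k p + hcomp k q" "hcomp k (p - q) = hcomp k p - hcomp k q" "hcomp k 0 = 0"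
  "hcomp k (- p) = - hcomp k p"
  by (simp_all add: hcomp_def keep_words_add keep_words_diff keep_words_uminus)

lemma hcomp_single: "hcomp k (Poly_Mapping.single u a) = (if word_deg u = k then Poly_Mapping.single u a else 0)"
  by (simp add: hcomp_def keep_words_single)

lemma hcomp_homog: "homog d p \<Longrightarrow> hcomp k p = (if k = d then p else 0)"
  by (auto simp: hcomp_def homog_def intro!: keep_words_id keep_words_none)

lemma hcomp_free_carrier: "p \<in> free_carrier G \<Longrightarrow> hcomp k p \<in> free_carrier G"
  unfolding hcomp_def by (rule keep_words_free_carrier)

lemma hcomp_mult: "hcomp n (p * q) = (\<Sum>i\<le>n. hcomp i p * hcomp (n - i) q)"
proof (induction p rule: word_sum_induct)
  case (3 u a)
  show ?case
  proof (induction q rule: word_sum_induct)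
    case (3 v b)
    have "(\<Sum>i\<le>n. hcomp i (Poly_Mapping.single u a) * hcomp (n - i) (Poly_Mapping.single v b)) =
        (\<Sum>i\<le>n. if i = word_deg u then (if word_deg v = n - i then Poly_Mapping.single (u + v) (a * b) else 0) else 0)"
      by (intro sum.cong refl) (auto simp: hcomp_single mult_single)
    also have "\<dots> = hcomp n (Poly_Mapping.single u a * Poly_Mapping.single v b)"
      by (auto simp: sum.delta mult_single hcomp_single word_deg_plus)
    finally show ?case by simp
  qed (simp_all add: hcomp_simps algebra_simps sum.distrib)
qed (simp_all add: hcomp_simps algebra_simps sum.distrib)

lemma homog_add: "homog d p \<Longrightarrow> homog d q \<Longrightarrow> homog d (p + q)"
  and homog_uminus: "homog d p \<Longrightarrow> homog d (- p)"
  using keys_add[of p q] by (auto simp: homog_def in_keys_iff)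

lemma homog_diff: "homog d p \<Longrightarrow> homog d q \<Longrightarrow> homog d (p - q)"
  using homog_add[OF _ homog_uminus, of d p q] by simp

lemma homog_mult: "homog d p \<Longrightarrow> homog e q \<Longrightarrow> homog (d + e) (p * q)"
  using keys_mult[of p q] by (fastforce simp: homog_def word_deg_plus)

lemma homog_gen: "homog (letter_deg g) (gen g)"
  by (simp add: homog_def gen_def word_deg_def)

lemma homog_scalar: "homog 0 (scalar a)"
  by (auto simp: homog_def scalar_def word_deg_zero split: if_splits)

lemma homog_one: "homog 0 1"
  by (auto simp: homog_def word_deg_zero)

lemma homog_zero: "homog d 0"
  by (simp add: homog_def)

lemma homog_sum: "(\<And>i. i \<in> A \<Longrightarrow> homog d (f i)) \<Longrightarrow> homog d (sum f A)"
  by (induction A rule: infinite_finite_induct) (auto intro: homog_add simp: homog_zero)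

lemma homog_gen': "letter_deg g = d \<Longrightarrow> homog d (gen g)"
  using homog_gen by blast

lemma homog_scalar_mult: "homog d p \<Longrightarrow> homog d (scalar a * p)"
  using homog_mult[OF homog_scalar, of d p a] by simp

lemma homog_mult_scalar: "homog d p \<Longrightarrow> homog d (p * scalar a)"
  using homog_mult[OF _ homog_scalar, of d p a] by simp

lemma homog_gen_gen: "letter_deg g + letter_deg g' = d \<Longrightarrow> homog d (gen g * gen g')"
  using homog_mult[OF homog_gen homog_gen] by blast

lemma smash_rels_homog: "r \<in> smash_rels D \<Longrightarrow> \<exists>d. homog d r"
  unfolding smash_rels_def vec_lin_rels_def cov_lin_rels_def
proof (elim UnE CollectE exE conjE insertE emptyE, goal_cases)
  case (1 p g)
  then show ?case
    by (auto intro!: exI[of _ "letter_deg p + letter_deg g"] homog_diff homog_gen_gen)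
next
  case (2 y y')
  show ?case unfolding 2(1) by (intro exI[of _ 1] homog_diff homog_gen') simp_all
next
  case (3 a y)
  show ?case unfolding 3(1) by (intro exI[of _ 1] homog_diff homog_gen' homog_scalar_mult) simp_all
next
  case (4 x x')
  show ?case unfolding 4(1) by (intro exI[of _ 1] homog_diff homog_gen') simp_all
next
  case (5 a x)
  show ?case unfolding 5(1) by (intro exI[of _ 1] homog_diff homog_gen' homog_scalar_mult) simp_all
next
  case 6
  show ?case unfolding 6(1) by (intro exI[of _ 0] homog_diff homog_gen' homog_one) simp_all
next
  case (7 w w')
  show ?case unfolding 7(1) by (intro exI[of _ 0] homog_diff homog_gen' homog_gen_gen) simp_all
next
  case (8 w y)
  show ?case unfolding 8(1) by (intro exI[of _ 1] homog_diff homog_gen_gen) simp_all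
next
  case (9 w x)
  show ?case unfolding 9(1) by (intro exI[of _ 1] homog_diff homog_gen_gen) simp_all
qed

lemma commutation_rels_homog: "r \<in> commutation_rels D \<Longrightarrow> homog 2 r"
  unfolding commutation_rels_def comm_rels_def
proof (elim UnE CollectE exE conjE, goal_cases)
  case (3 y x)
  have "homog 2 (gen (Par_c K) * scalar a * gen (Grp s))" for K a and s :: "'a \<Rightarrow> 'a"
    using homog_mult[OF homog_mult_scalar[OF homog_gen'[of "Par_c K" 2]] homog_gen'[of "Grp s" 0], of a]
    by simp
  then show ?case
    unfolding 3(1) by (intro homog_diff homog_gen_gen homog_sum homog_mult_scalar homog_gen') auto
qed (auto simp: cov_letters_def vec_letters_def intro!: homog_diff homog_gen_gen)

section \<open>The map to the Rees algebra\<close>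

lemma ring_UP: "ring R \<Longrightarrow> ring (UP R)"
  by (rule UP_ring.UP_ring) (simp add: UP_ring_def)

context refl_group
begin

text \<open>All defining relations are homogeneous for \<open>word_deg\<close>, in which the parameters have degree 2.\<close>

lemma hcomp_univ_ideal: "p \<in> univ_ideal D \<Longrightarrow> hcomp k p \<in> univ_ideal D"
proof -
  let ?K = "{p \<in> tensors D. \<forall>k. hcomp k p \<in> univ_ideal D}"
  interpret I: ideal "univ_ideal D" "free_alg (all_letters D)" by (rule univ_ideal_ideal)
  have 0: "0 \<in> univ_ideal D"
    using additive_subgroup.zero_closed[OF ideal.axioms(1)[OF univ_ideal_ideal]] by simp
  have add: "a + b \<in> univ_ideal D" if "a \<in> univ_ideal D" "b \<in> univ_ideal D" for a b
    using additive_subgroup.a_closed[OF ideal.axioms(1)[OF univ_ideal_ideal] that] by simp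
  have sum: "sum f A \<in> univ_ideal D" if "\<And>i. i \<in> A \<Longrightarrow> f i \<in> univ_ideal D" for f :: "nat \<Rightarrow> _" and A
    using that by (induction A rule: infinite_finite_induct) (auto simp: 0 add)
  have l: "x * a \<in> univ_ideal D" if "a \<in> univ_ideal D" "x \<in> tensors D" for a x
    using I.I_l_closed[OF that(1), of x] that(2) by (simp add: carrier_free_alg)
  have r: "a * x \<in> univ_ideal D" if "a \<in> univ_ideal D" "x \<in> tensors D" for a x
    using I.I_r_closed[OF that(1), of x] that(2) by (simp add: carrier_free_alg)
  have "ideal ?K (free_alg (all_letters D))"
  proof (rule ideal_free_algI)
    fix a x assume a: "a \<in> ?K" and x: "x \<in> tensors D"
    show "x * a \<in> ?K"
      using a x by (auto simp: hcomp_mult intro!: sum l hcomp_free_carrier)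
    show "a * x \<in> ?K"
      using a x by (auto simp: hcomp_mult intro!: sum r hcomp_free_carrier)
  qed (auto simp: hcomp_simps 0 add)
  moreover have "smash_rels D \<union> commutation_rels D \<subseteq> ?K"
  proof
    fix r assume r: "r \<in> smash_rels D \<union> commutation_rels D"
    then obtain d where "homog d r" using smash_rels_homog commutation_rels_homog by blast
    then have "hcomp k r \<in> univ_ideal D" for k
      using r rels_in_univ_ideal 0 by (auto simp: hcomp_homog)
    then show "r \<in> ?K" using r smash_rels_carrier commutation_rels_carrier by auto
  qed
  ultimately have "univ_ideal D \<subseteq> ?K"
    unfolding univ_ideal_def by (rule ring.genideal_minimal[OF ring_free_alg])
  then show "p \<in> univ_ideal D \<Longrightarrow> hcomp k p \<in> univ_ideal D" by blast
qed

lemma univ_ideal_chered: "p \<in> univ_ideal D \<Longrightarrow> p \<in> chered_preimage c"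
proof -
  assume p: "p \<in> univ_ideal D"
  then have pt: "p \<in> tensors D" using univ_ideal_carrier by blast
  have "univ_cls D p = univ_cls D 0" using p pt by (subst univ_cls_eq_iff) auto
  then show ?thesis
    using pt additive_subgroup.zero_closed[OF ideal.axioms(1)[OF chered_ideal_ideal]]
    by (simp add: chered_preimage_def univ_preimage_iff)
qed

lemma word_prod_tensor: "set gs \<subseteq> all_letters D \<Longrightarrow> Poly_Mapping.single (Word gs) a \<in> tensors D"
  by (rule single_free_carrier) simp

text \<open>A word of degree \<open>d\<close> goes to \<open>hbar\<^sup>d\<close> times its class, so the coefficient of \<open>hbar\<^sup>k\<close> collects
  the words of degree \<open>k\<close>.\<close>

lemma rees_tensor_eq:
  assumes p: "p \<in> tensors D"
  shows "rees_tensor D c p = (\<lambda>k. chered_cls D c (hcomp k p))"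
    "rees_tensor D c p \<in> carrier (UP (chered_alg D c))"
proof -
  let ?A = "chered_alg D c" and ?P = "UP (chered_alg D c)"
  interpret A: ring ?A by (rule ring_chered)
  interpret PR: ring ?P by (rule ring_UP[OF ring_chered])
  interpret P: UP_ring ?A ?P by unfold_locales
  let ?mon = "\<lambda>u. up_ring.monom ?P (chered_cls D c (scalar (Poly_Mapping.lookup p u))) 0 \<otimes>\<^bsub>?P\<^esub>
       foldr (\<lambda>g r. rees_letter D c g \<otimes>\<^bsub>?P\<^esub> r) (letters u) \<one>\<^bsub>?P\<^esub>"
  have fold: "foldr (\<lambda>g r. rees_letter D c g \<otimes>\<^bsub>?P\<^esub> r) gs \<one>\<^bsub>?P\<^esub> =
      up_ring.monom ?P (chered_cls D c (word_prod gs)) (word_deg (Word gs))"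
    if "set gs \<subseteq> all_letters D" for gs
    using that
  proof (induction gs)
    case Nil
    then show ?case by (simp add: zero_word_def[symmetric] word_deg_zero chered_cls_simps)
  next
    case (Cons g gs)
    then have "gen g \<in> tensors D" "word_prod gs \<in> tensors D"
      by (simp_all add: word_prod_tensor)
    with Cons show ?case
      by (simp add: rees_letter_def single_Cons_word chered_cls_simps word_deg_def)
  qed
  have mon: "?mon u = up_ring.monom ?P (chered_cls D c (Poly_Mapping.single u (Poly_Mapping.lookup p u))) (word_deg u)"
    if "u \<in> Poly_Mapping.keys p" for u
  proof -
    have u: "set (letters u) \<subseteq> all_letters D" using that p by (auto simp: free_carrier_def)
    have "scalar (Poly_Mapping.lookup p u) \<in> tensors D" "word_prod (letters u) \<in> tensors D"
      using u by (auto intro: single_free_carrier)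
    then have "?mon u = up_ring.monom ?P (chered_cls D c (scalar (Poly_Mapping.lookup p u) * word_prod (letters u))) (word_deg u)"
      unfolding fold[OF u]
      using P.monom_mult[of "chered_cls D c (scalar (Poly_Mapping.lookup p u))" "chered_cls D c (word_prod (letters u))" 0 "word_deg u"]
      by (simp add: chered_cls_simps del: P.monom_mult)
    also have "scalar (Poly_Mapping.lookup p u) * word_prod (letters u) = Poly_Mapping.single u (Poly_Mapping.lookup p u)"
      by (simp add: scalar_def mult_single)
    finally show ?thesis .
  qed
  have cl: "chered_cls D c (Poly_Mapping.single u (Poly_Mapping.lookup p u)) \<in> carrier ?A"
    if "u \<in> Poly_Mapping.keys p" for u
    using that p by (intro chered_cls_simps single_free_carrier) (auto simp: free_carrier_def)
  have main: "(\<Oplus>\<^bsub>?P\<^esub>u\<in>S. ?mon u) \<in> carrier ?P \<and>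
     (\<forall>k. up_ring.coeff ?P (\<Oplus>\<^bsub>?P\<^esub>u\<in>S. ?mon u) k =
        chered_cls D c (hcomp k (\<Sum>u\<in>S. Poly_Mapping.single u (Poly_Mapping.lookup p u))))"
    if "finite S" "S \<subseteq> Poly_Mapping.keys p" for S
    using that
  proof (induction S rule: finite_induct)
    case empty
    then show ?case by (simp add: hcomp_simps chered_cls_simps)
  next
    case (insert u S)
    then have u: "u \<in> Poly_Mapping.keys p" by auto
    have mc: "?mon v \<in> carrier ?P" if "v \<in> Poly_Mapping.keys p" for v
      unfolding mon[OF that] by (rule P.monom_closed[OF cl[OF that]])
    have t: "Poly_Mapping.single v (Poly_Mapping.lookup p v) \<in> tensors D" if "v \<in> Poly_Mapping.keys p" for v
      using that p by (intro single_free_carrier) (auto simp: free_carrier_def)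
    have ts: "(\<Sum>u\<in>S. Poly_Mapping.single u (Poly_Mapping.lookup p u)) \<in> tensors D"
      using insert by (intro sum_free_carrier t) auto
    have eq: "(\<Oplus>\<^bsub>?P\<^esub>v\<in>insert u S. ?mon v) = ?mon u \<oplus>\<^bsub>?P\<^esub> (\<Oplus>\<^bsub>?P\<^esub>v\<in>S. ?mon v)"
      using insert mc by (intro PR.finsum_insert) auto
    have "up_ring.coeff ?P (?mon u) k = chered_cls D c (hcomp k (Poly_Mapping.single u (Poly_Mapping.lookup p u)))" for k
      unfolding mon[OF u] using cl[OF u] by (simp add: hcomp_single chered_cls_simps)
    then show ?case
      unfolding eq using insert mc[OF u] t[OF u] ts
      by (simp add: hcomp_simps chered_cls_simps hcomp_free_carrier)
  qed
  have exp: "(\<Sum>u\<in>Poly_Mapping.keys p. Poly_Mapping.single u (Poly_Mapping.lookup p u)) = p"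
    using word_expansion[of p] by (simp add: scalar_def mult_single)
  have R: "rees_tensor D c p = (\<Oplus>\<^bsub>?P\<^esub>u\<in>Poly_Mapping.keys p. ?mon u)"
    by (simp add: rees_tensor_def Let_def)
  show car: "rees_tensor D c p \<in> carrier ?P"
    unfolding R using main[OF finite_keys order_refl] by blast
  have "up_ring.coeff ?P (rees_tensor D c p) k = chered_cls D c (hcomp k p)" for k
    unfolding R using main[OF finite_keys order_refl] exp by simp
  then show "rees_tensor D c p = (\<lambda>k. chered_cls D c (hcomp k p))"
    using car by (simp add: UP_def fun_eq_iff)
qed

lemma rees_univ_eq:
  assumes p: "p \<in> tensors D"
  shows "rees_univ D c (univ_cls D p) = (\<lambda>k. chered_cls D c (hcomp k p))"
proof -
  have "rees_tensor D c q = (\<lambda>k. chered_cls D c (hcomp k p))" if q: "q \<in> univ_cls D p" for q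
  proof -
    obtain j where j: "j \<in> univ_ideal D" "q = j + p"
      using q by (auto simp: univ_cls_def a_r_coset_def')
    then have jt: "j \<in> tensors D" using univ_ideal_carrier by blast
    have "chered_cls D c (hcomp k q) = chered_cls D c (hcomp k p)" for k
      using univ_ideal_chered[OF hcomp_univ_ideal[OF j(1)]] jt p
      by (subst chered_cls_eq_iff) (auto simp: j hcomp_simps hcomp_free_carrier)
    then show ?thesis using jt p j by (subst rees_tensor_eq) auto
  qed
  moreover have "p \<in> univ_cls D p"
  proof -
    have "0 \<in> univ_ideal D"
      using additive_subgroup.zero_closed[OF ideal.axioms(1)[OF univ_ideal_ideal]] by simp
    then show ?thesis by (auto simp: univ_cls_def a_r_coset_def' intro!: bexI[of _ 0])
  qed
  ultimately show ?thesis unfolding rees_univ_def by (intro the_elem_image_const)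
qed

text \<open>\<open>P\<close> is a sequence of representatives in the free algebra of the coefficients of \<open>q\<close>.\<close>

definition univ_coeffs :: "(nat \<Rightarrow> 'v univ_elem) \<Rightarrow> (nat \<Rightarrow> 'v tensor) \<Rightarrow> bool" where
  "univ_coeffs q P \<longleftrightarrow> q \<in> carrier (UP (univ_alg D)) \<and> (\<forall>i. P i \<in> tensors D \<and> q i = univ_cls D (P i))"

lemma univ_coeffs_ex:
  assumes "q \<in> carrier (UP (univ_alg D))" shows "\<exists>P. univ_coeffs q P"
proof -
  have "q i \<in> carrier (univ_alg D)" for i
    using assms by (auto simp: UP_def up_def Pi_def)
  then have "\<forall>i. \<exists>P. P \<in> tensors D \<and> q i = univ_cls D P"
    using univ_cls_rep by blast
  then show ?thesis using assms unfolding univ_coeffs_def by metis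
qed

definition rees_eval :: "'v param \<Rightarrow> (nat \<Rightarrow> 'v univ_elem) \<Rightarrow> nat \<Rightarrow> 'v chered_elem" where
  "rees_eval c = eval (univ_alg D) (UP (chered_alg D c)) (rees_univ D c)
     (up_ring.monom (UP (chered_alg D c)) \<one>\<^bsub>chered_alg D c\<^esub> 1)"

lemma monom_shift:
  assumes "ring R" "a \<in> carrier R" "x \<in> carrier (UP R)"
  shows "up_ring.coeff (UP R) (up_ring.monom (UP R) a m \<otimes>\<^bsub>UP R\<^esub> x) k =
      (if m \<le> k then a \<otimes>\<^bsub>R\<^esub> x (k - m) else \<zero>\<^bsub>R\<^esub>)"
    "up_ring.coeff (UP R) (x \<otimes>\<^bsub>UP R\<^esub> up_ring.monom (UP R) a m) k =
      (if m \<le> k then x (k - m) \<otimes>\<^bsub>R\<^esub> a else \<zero>\<^bsub>R\<^esub>)"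
proof -
  interpret R: ring R by fact
  interpret P: UP_ring R "UP R" by unfold_locales
  have x: "x i \<in> carrier R" "up_ring.coeff (UP R) x i = x i" for i
    using assms(3) by (auto simp: UP_def up_def Pi_def)
  have "(\<Oplus>\<^bsub>R\<^esub>i\<in>{..k}. (if m = i then a else \<zero>\<^bsub>R\<^esub>) \<otimes>\<^bsub>R\<^esub> x (k - i)) =
      (\<Oplus>\<^bsub>R\<^esub>i\<in>{..k}. if m = i then a \<otimes>\<^bsub>R\<^esub> x (k - i) else \<zero>\<^bsub>R\<^esub>)"
    using assms(2) x by (intro R.finsum_cong') auto
  also have "\<dots> = (if m \<le> k then a \<otimes>\<^bsub>R\<^esub> x (k - m) else \<zero>\<^bsub>R\<^esub>)"
  proof (cases "m \<le> k")
    case True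
    then show ?thesis using assms(2) x by (subst R.finsum_singleton[of m]) auto
  next
    case False
    then have "(\<Oplus>\<^bsub>R\<^esub>i\<in>{..k}. if m = i then a \<otimes>\<^bsub>R\<^esub> x (k - i) else \<zero>\<^bsub>R\<^esub>) = (\<Oplus>\<^bsub>R\<^esub>i\<in>{..k}. \<zero>\<^bsub>R\<^esub>)"
      by (intro R.finsum_cong') auto
    with False show ?thesis by simp
  qed
  finally show "up_ring.coeff (UP R) (up_ring.monom (UP R) a m \<otimes>\<^bsub>UP R\<^esub> x) k =
      (if m \<le> k then a \<otimes>\<^bsub>R\<^esub> x (k - m) else \<zero>\<^bsub>R\<^esub>)"
    using assms by (simp add: x)
  have "(\<Oplus>\<^bsub>R\<^esub>i\<in>{..k}. x i \<otimes>\<^bsub>R\<^esub> (if m = k - i then a else \<zero>\<^bsub>R\<^esub>)) =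
      (\<Oplus>\<^bsub>R\<^esub>i\<in>{..k}. if m \<le> k \<and> k - m = i then x i \<otimes>\<^bsub>R\<^esub> a else \<zero>\<^bsub>R\<^esub>)"
    using assms(2) x by (intro R.finsum_cong') auto
  also have "\<dots> = (if m \<le> k then x (k - m) \<otimes>\<^bsub>R\<^esub> a else \<zero>\<^bsub>R\<^esub>)"
  proof (cases "m \<le> k")
    case True
    then have "(\<Oplus>\<^bsub>R\<^esub>i\<in>{..k}. if m \<le> k \<and> k - m = i then x i \<otimes>\<^bsub>R\<^esub> a else \<zero>\<^bsub>R\<^esub>) =
       (\<Oplus>\<^bsub>R\<^esub>i\<in>{..k}. if k - m = i then x i \<otimes>\<^bsub>R\<^esub> a else \<zero>\<^bsub>R\<^esub>)"
      by simp
    also have "\<dots> = x (k - m) \<otimes>\<^bsub>R\<^esub> a"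
      using assms(2) x True by (subst R.finsum_singleton[of "k - m"]) auto
    finally show ?thesis using True by simp
  qed simp
  finally show "up_ring.coeff (UP R) (x \<otimes>\<^bsub>UP R\<^esub> up_ring.monom (UP R) a m) k =
      (if m \<le> k then x (k - m) \<otimes>\<^bsub>R\<^esub> a else \<zero>\<^bsub>R\<^esub>)"
    using assms by (simp add: x)
qed

text \<open>The summand \<open>q\<^sub>i hbar\<^sup>i\<close> contributes the component of degree \<open>k - i\<close> of \<open>q\<^sub>i\<close> to the coefficient of
  \<open>hbar\<^sup>k\<close>.\<close>

lemma rees_eval_eq:
  assumes q: "univ_coeffs q P"
  shows "rees_eval c q = (\<lambda>k. chered_cls D c (\<Sum>i\<le>k. hcomp (k - i) (P i)))"
    "rees_eval c q \<in> carrier (UP (chered_alg D c))"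
proof -
  let ?A = "chered_alg D c" and ?P = "UP (chered_alg D c)" and ?H = "univ_alg D"
  interpret A: ring ?A by (rule ring_chered)
  interpret PR: ring ?P by (rule ring_UP[OF ring_chered])
  interpret P: UP_ring ?A ?P by unfold_locales
  interpret H: ring ?H by (rule ring_univ)
  interpret PH: UP_ring ?H "UP ?H" by unfold_locales
  have qc: "q \<in> carrier (UP ?H)" and Pt: "P i \<in> tensors D" and qP: "q i = univ_cls D (P i)"
    and qco: "up_ring.coeff (UP ?H) q i = q i" for i
    using q by (auto simp: univ_coeffs_def UP_def)
  let ?h = "up_ring.monom ?P \<one>\<^bsub>?A\<^esub> 1"
  have pow: "?h [^]\<^bsub>?P\<^esub> i = up_ring.monom ?P \<one>\<^bsub>?A\<^esub> i" for i :: nat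
  proof (induction i)
    case (Suc i)
    then show ?case using P.monom_one_Suc[of i] by simp
  qed simp
  let ?r = "\<lambda>i. rees_univ D c (q i)"
  have rc: "?r i \<in> carrier ?P" for i
    using rees_tensor_eq[OF Pt[of i], of c] unfolding qP rees_univ_eq[OF Pt] by simp
  have rco: "up_ring.coeff ?P (?r i \<otimes>\<^bsub>?P\<^esub> up_ring.monom ?P \<one>\<^bsub>?A\<^esub> i) k =
      (if i \<le> k then chered_cls D c (hcomp (k - i) (P i)) else \<zero>\<^bsub>?A\<^esub>)" for i k
    using monom_shift(2)[OF A.ring_axioms A.one_closed rc[of i], of i k] Pt
    by (simp add: qP rees_univ_eq chered_cls_simps hcomp_free_carrier)
  have E: "rees_eval c q = (\<Oplus>\<^bsub>?P\<^esub>i\<in>{..deg ?H q}. ?r i \<otimes>\<^bsub>?P\<^esub> up_ring.monom ?P \<one>\<^bsub>?A\<^esub> i)"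
    using qc by (simp add: rees_eval_def eval_def qco pow[simplified])
  show Ec: "rees_eval c q \<in> carrier ?P"
    unfolding E using rc by (intro PR.finsum_closed) auto
  have beyond: "chered_cls D c (hcomp k (P i)) = \<zero>\<^bsub>?A\<^esub>" if "deg ?H q < i" for i k
  proof -
    have "univ_cls D (P i) = univ_cls D 0"
      using PH.deg_aboveD[OF that qc] qco qP by simp
    then have "P i \<in> univ_ideal D" using Pt univ_cls_eq_iff[of "P i" 0] by simp
    then have "hcomp k (P i) - 0 \<in> chered_preimage c"
      using univ_ideal_chered hcomp_univ_ideal by simp
    then show ?thesis
      using chered_cls_eq_iff[of "hcomp k (P i)" 0 c] Pt by (simp add: hcomp_free_carrier chered_cls_simps)
  qed
  have "up_ring.coeff ?P (rees_eval c q) k = chered_cls D c (\<Sum>i\<le>k. hcomp (k - i) (P i))" for k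
  proof -
    have "up_ring.coeff ?P (rees_eval c q) k =
       (\<Oplus>\<^bsub>?A\<^esub>i\<in>{..deg ?H q}. if i \<le> k then chered_cls D c (hcomp (k - i) (P i)) else \<zero>\<^bsub>?A\<^esub>)"
      unfolding E using rc by (subst P.coeff_finsum) (auto simp: rco)
    also have "\<dots> = (\<Oplus>\<^bsub>?A\<^esub>i\<in>{..deg ?H q}. chered_cls D c (if i \<le> k then hcomp (k - i) (P i) else 0))"
      using Pt by (intro A.finsum_cong') (auto simp: chered_cls_simps hcomp_free_carrier)
    also have "\<dots> = chered_cls D c (\<Sum>i\<le>deg ?H q. if i \<le> k then hcomp (k - i) (P i) else 0)"
      using Pt by (intro chered_cls_finsum[symmetric]) (auto simp: hcomp_free_carrier)
    also have "(\<Sum>i\<le>deg ?H q. if i \<le> k then hcomp (k - i) (P i) else 0) =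
        (\<Sum>i\<in>{..deg ?H q} \<inter> {..k}. hcomp (k - i) (P i))"
      by (rule sum.mono_neutral_cong_right) auto
    also have "chered_cls D c \<dots> = chered_cls D c (\<Sum>i\<le>k. hcomp (k - i) (P i))"
    proof -
      have split: "(\<Sum>i\<le>k. hcomp (k - i) (P i)) = (\<Sum>i\<in>{..deg ?H q} \<inter> {..k}. hcomp (k - i) (P i)) +
          (\<Sum>i\<in>{..k} - {..deg ?H q}. hcomp (k - i) (P i))"
        by (subst sum.union_disjoint[symmetric]) (auto intro!: sum.cong)
      have "chered_cls D c (\<Sum>i\<in>{..k} - {..deg ?H q}. hcomp (k - i) (P i)) =
          (\<Oplus>\<^bsub>?A\<^esub>i\<in>{..k} - {..deg ?H q}. chered_cls D c (hcomp (k - i) (P i)))"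
        using Pt by (intro chered_cls_finsum) (auto simp: hcomp_free_carrier)
      also have "\<dots> = (\<Oplus>\<^bsub>?A\<^esub>i\<in>{..k} - {..deg ?H q}. \<zero>\<^bsub>?A\<^esub>)"
        by (intro A.finsum_cong') (auto simp: beyond)
      finally have "chered_cls D c (\<Sum>i\<in>{..k} - {..deg ?H q}. hcomp (k - i) (P i)) = \<zero>\<^bsub>?A\<^esub>" by simp
      then show ?thesis
        unfolding split using Pt
        by (simp add: chered_cls_simps sum_free_carrier hcomp_free_carrier)
    qed
    finally show ?thesis .
  qed
  then show "rees_eval c q = (\<lambda>k. chered_cls D c (\<Sum>i\<le>k. hcomp (k - i) (P i)))"
    using Ec by (simp add: UP_def fun_eq_iff)
qed

lemma hcomp_mult_t: "hcomp k (p * gen Par_t) = (if 2 \<le> k then hcomp (k - 2) p * gen Par_t else 0)"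
proof (induction p rule: word_sum_induct)
  case (3 u a)
  have "word_deg (u + Word [Par_t]) = word_deg u + 2"
    by (simp add: word_deg_plus) (simp add: word_deg_def)
  then show ?case
    by (auto simp: gen_def mult_single hcomp_single)
qed (auto simp: hcomp_simps algebra_simps)

definition ext_gen :: "nat \<Rightarrow> 'v univ_elem" where
  "ext_gen = up_ring.monom (UP (univ_alg D)) (univ_t D) 0
     \<ominus>\<^bsub>UP (univ_alg D)\<^esub> up_ring.monom (UP (univ_alg D)) \<one>\<^bsub>univ_alg D\<^esub> 2"

lemma univ_t_central: "a \<in> carrier (univ_alg D) \<Longrightarrow> univ_t D \<otimes>\<^bsub>univ_alg D\<^esub> a = a \<otimes>\<^bsub>univ_alg D\<^esub> univ_t D"
proof -
  assume "a \<in> carrier (univ_alg D)"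
  then obtain p where p: "p \<in> tensors D" "a = univ_cls D p" using univ_cls_rep by blast
  interpret z: cherednik_congruence D "univ_preimage D {\<zero>\<^bsub>univ_alg D\<^esub>}"
    by (rule univ_preimage_cong[OF univ.S.zeroideal])
  have "gen Par_t * p - p * gen Par_t \<in> univ_preimage D {\<zero>\<^bsub>univ_alg D\<^esub>}"
    using z.par_t_central[of p] by (simp add: z.cong_def)
  then have "univ_cls D (gen Par_t * p - p * gen Par_t) = univ_cls D 0"
    using p by (subst (asm) univ_preimage_iff) auto
  then have "gen Par_t * p - p * gen Par_t \<in> univ_ideal D"
    using p univ_cls_eq_iff[of "gen Par_t * p - p * gen Par_t" 0] by (simp del: univ.hom_zero)
  then have "univ_cls D (gen Par_t * p) = univ_cls D (p * gen Par_t)"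
    using p univ_cls_eq_iff[of "gen Par_t * p" "p * gen Par_t"] by (simp del: univ.hom_mult)
  then show ?thesis using p by (simp add: univ_t_def)
qed

text \<open>Since \<open>t - hbar\<^sup>2\<close> is central, its ideal consists of its multiples.\<close>

lemma ext_ideal_subset:
  "ext_ideal D \<subseteq> {r \<otimes>\<^bsub>UP (univ_alg D)\<^esub> ext_gen | r. r \<in> carrier (UP (univ_alg D))}"
  (is "_ \<subseteq> ?K")
proof -
  let ?H = "univ_alg D" and ?P = "UP (univ_alg D)"
  interpret H: ring ?H by (rule ring_univ)
  interpret PR: ring ?P by (rule ring_UP[OF ring_univ])
  interpret P: UP_ring ?H ?P by unfold_locales
  have t: "up_ring.monom ?P (univ_t D) 0 \<in> carrier ?P" "up_ring.monom ?P \<one>\<^bsub>?H\<^esub> 2 \<in> carrier ?P"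
    using univ_t_carrier by simp_all
  then have g: "ext_gen \<in> carrier ?P" by (simp add: ext_gen_def)
  have xi: "x i \<in> carrier ?H" if "x \<in> carrier ?P" for x i
    using that by (auto simp: UP_def up_def Pi_def)
  have central: "ext_gen \<otimes>\<^bsub>?P\<^esub> x = x \<otimes>\<^bsub>?P\<^esub> ext_gen" if x: "x \<in> carrier ?P" for x
  proof -
    have 1: "up_ring.monom ?P (univ_t D) 0 \<otimes>\<^bsub>?P\<^esub> x = x \<otimes>\<^bsub>?P\<^esub> up_ring.monom ?P (univ_t D) 0"
      using x t xi[OF x] univ_t_central
      by (intro P.up_eqI) (auto simp only: monom_shift[OF ring_univ univ_t_carrier x] intro!: PR.m_closed)
    have 2: "up_ring.monom ?P \<one>\<^bsub>?H\<^esub> 2 \<otimes>\<^bsub>?P\<^esub> x = x \<otimes>\<^bsub>?P\<^esub> up_ring.monom ?P \<one>\<^bsub>?H\<^esub> 2"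
      using x t xi[OF x]
      by (intro P.up_eqI) (auto simp only: monom_shift[OF ring_univ univ.S.one_closed x] univ.S.l_one univ.S.r_one intro!: PR.m_closed)
    show ?thesis
      unfolding ext_gen_def a_minus_def using x t
      by (simp add: PR.l_distr PR.r_distr PR.l_minus PR.r_minus 1 2)
  qed
  have "ideal ?K ?P"
  proof (rule idealI)
    show "ring ?P" by (rule PR.ring_axioms)
    show "subgroup ?K (add_monoid ?P)"
    proof
      show "?K \<subseteq> carrier (add_monoid ?P)" using g by auto
      show "\<one>\<^bsub>add_monoid ?P\<^esub> \<in> ?K" using g by (auto intro!: exI[of _ "\<zero>\<^bsub>?P\<^esub>"] simp: PR.l_null)
    next
      fix x y assume "x \<in> ?K" "y \<in> ?K"
      then obtain a b where "a \<in> carrier ?P" "b \<in> carrier ?P" "x = a \<otimes>\<^bsub>?P\<^esub> ext_gen" "y = b \<otimes>\<^bsub>?P\<^esub> ext_gen" by auto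
      then show "x \<otimes>\<^bsub>add_monoid ?P\<^esub> y \<in> ?K"
        using g by (auto intro!: exI[of _ "a \<oplus>\<^bsub>?P\<^esub> b"] simp: PR.l_distr)
    next
      fix x assume "x \<in> ?K"
      then obtain a where a: "a \<in> carrier ?P" "x = a \<otimes>\<^bsub>?P\<^esub> ext_gen" by auto
      then have "inv\<^bsub>add_monoid ?P\<^esub> x = (\<ominus>\<^bsub>?P\<^esub> a) \<otimes>\<^bsub>?P\<^esub> ext_gen"
        using g PR.l_minus[of a ext_gen] by (simp add: a_inv_def)
      then show "inv\<^bsub>add_monoid ?P\<^esub> x \<in> ?K" using a PR.a_inv_closed by blast
    qed
  next
    fix a x assume "a \<in> ?K" and x: "x \<in> carrier ?P"
    then obtain r where r: "r \<in> carrier ?P" "a = r \<otimes>\<^bsub>?P\<^esub> ext_gen" by auto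
    have "x \<otimes>\<^bsub>?P\<^esub> a = (x \<otimes>\<^bsub>?P\<^esub> r) \<otimes>\<^bsub>?P\<^esub> ext_gen"
      using r x g by (simp add: PR.m_assoc)
    then show "x \<otimes>\<^bsub>?P\<^esub> a \<in> ?K" using r x by blast
    have "a \<otimes>\<^bsub>?P\<^esub> x = (r \<otimes>\<^bsub>?P\<^esub> x) \<otimes>\<^bsub>?P\<^esub> ext_gen"
      using r x g by (simp add: PR.m_assoc central)
    then show "a \<otimes>\<^bsub>?P\<^esub> x \<in> ?K" using r x by blast
  qed
  moreover have "{ext_gen} \<subseteq> ?K"
    using g PR.l_one[OF g] by (auto intro!: exI[of _ "\<one>\<^bsub>?P\<^esub>"])
  ultimately show ?thesis
    unfolding ext_ideal_def Let_def ext_gen_def[symmetric] by (rule PR.genideal_minimal)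
qed

lemma ext_ideal_coeffs:
  assumes "e \<in> ext_ideal D"
  obtains R where "\<And>n. R n \<in> tensors D"
    "univ_coeffs e (\<lambda>n. R n * gen Par_t - (if 2 \<le> n then R (n - 2) else 0))"
proof -
  let ?H = "univ_alg D" and ?P = "UP (univ_alg D)"
  interpret H: ring ?H by (rule ring_univ)
  interpret PR: ring ?P by (rule ring_UP[OF ring_univ])
  interpret P: UP_ring ?H ?P by unfold_locales
  obtain r where r: "r \<in> carrier ?P" "e = r \<otimes>\<^bsub>?P\<^esub> ext_gen"
    using ext_ideal_subset assms by blast
  obtain R where R: "univ_coeffs r R" using univ_coeffs_ex[OF r(1)] by blast
  have Rt: "R n \<in> tensors D" "r n = univ_cls D (R n)" for n using R by (auto simp: univ_coeffs_def)
  have t: "up_ring.monom ?P (univ_t D) 0 \<in> carrier ?P" "up_ring.monom ?P \<one>\<^bsub>?H\<^esub> 2 \<in> carrier ?P"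
    using univ_t_carrier by simp_all
  have ec: "e \<in> carrier ?P" using r t by (simp add: ext_gen_def)
  have e: "e = r \<otimes>\<^bsub>?P\<^esub> up_ring.monom ?P (univ_t D) 0 \<ominus>\<^bsub>?P\<^esub> r \<otimes>\<^bsub>?P\<^esub> up_ring.monom ?P \<one>\<^bsub>?H\<^esub> 2"
    using r t unfolding ext_gen_def a_minus_def by (simp add: PR.r_distr PR.r_minus)
  have "e n = univ_cls D (R n * gen Par_t - (if 2 \<le> n then R (n - 2) else 0))" for n
  proof -
    have "e n = up_ring.coeff ?P e n" using ec by (simp add: UP_def)
    also have "\<dots> = r n \<otimes>\<^bsub>?H\<^esub> univ_t D \<ominus>\<^bsub>?H\<^esub> (if 2 \<le> n then r (n - 2) \<otimes>\<^bsub>?H\<^esub> \<one>\<^bsub>?H\<^esub> else \<zero>\<^bsub>?H\<^esub>)"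
      unfolding e using r(1) t monom_shift(2)[OF ring_univ univ_t_carrier r(1), of 0 n]
        monom_shift(2)[OF ring_univ univ.S.one_closed r(1), of 2 n]
      by (subst P.coeff_minus) simp_all
    also have "\<dots> = univ_cls D (R n * gen Par_t - (if 2 \<le> n then R (n - 2) else 0))"
      using Rt by (simp add: univ_cls_diff univ_t_def)
    finally show ?thesis .
  qed
  then have "univ_coeffs e (\<lambda>n. R n * gen Par_t - (if 2 \<le> n then R (n - 2) else 0))"
    using ec Rt unfolding univ_coeffs_def by auto
  with Rt show thesis using that by blast
qed

text \<open>The multiples of \<open>t - hbar\<^sup>2\<close> evaluate to zero: multiplication by \<open>t\<close>, which is 1 in the specialised
  algebra, raises the degree by 2, as does multiplication by \<open>hbar\<^sup>2\<close>.\<close>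

lemma rees_sum_ext_ideal:
  assumes R: "\<And>n. R n \<in> tensors D"
  shows "(\<Sum>i\<le>k. hcomp (k - i) (R i * gen Par_t - (if 2 \<le> i then R (i - 2) else 0))) \<in> chered_preimage c"
proof -
  interpret J: cherednik_congruence D "chered_preimage c" by (rule chered_preimage_cong)
  show ?thesis
  proof (cases "2 \<le> k")
    case False
    then have "hcomp (k - i) (R i * gen Par_t - (if 2 \<le> i then R (i - 2) else 0)) = 0" if "i \<le> k" for i
      using that by (auto simp: hcomp_simps hcomp_mult_t)
    then have "(\<Sum>i\<le>k. hcomp (k - i) (R i * gen Par_t - (if 2 \<le> i then R (i - 2) else 0))) = 0"
      by (intro sum.neutral) auto
    then show ?thesis by (simp add: J.zero_mem)
  next
    case True
    then obtain m where m: "k = m + 2" by (metis add.commute le_Suc_ex)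
    have "(\<Sum>i\<le>k. hcomp (k - i) (R i * gen Par_t)) = (\<Sum>i\<le>m. hcomp (m - i) (R i) * gen Par_t)"
    proof -
      have "(\<Sum>i\<le>k. hcomp (k - i) (R i * gen Par_t)) = (\<Sum>i\<le>m. hcomp (k - i) (R i * gen Par_t))"
        by (intro sum.mono_neutral_right) (auto simp: m hcomp_mult_t)
      also have "\<dots> = (\<Sum>i\<le>m. hcomp (m - i) (R i) * gen Par_t)"
        by (intro sum.cong refl) (auto simp: m hcomp_mult_t)
      finally show ?thesis .
    qed
    moreover have "(\<Sum>i\<le>k. hcomp (k - i) (if 2 \<le> i then R (i - 2) else 0)) = (\<Sum>i\<le>m. hcomp (m - i) (R i))"
    proof -
      have "(\<Sum>i\<le>k. hcomp (k - i) (if 2 \<le> i then R (i - 2) else 0)) = (\<Sum>i\<in>{2..k}. hcomp (k - i) (R (i - 2)))"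
        by (intro sum.mono_neutral_cong_right) (auto simp: hcomp_simps)
      also have "\<dots> = (\<Sum>i\<le>m. hcomp (m - i) (R i))"
        by (rule sum.reindex_bij_witness[of _ "\<lambda>i. i + 2" "\<lambda>i. i - 2"]) (auto simp: m)
      finally show ?thesis .
    qed
    ultimately have "(\<Sum>i\<le>k. hcomp (k - i) (R i * gen Par_t - (if 2 \<le> i then R (i - 2) else 0))) =
       (\<Sum>i\<le>m. hcomp (m - i) (R i)) * (gen Par_t - 1)"
      by (simp add: hcomp_simps sum_subtractf algebra_simps sum_distrib_right)
    then show ?thesis using J.mult_left_mem[OF chered_t] by simp
  qed
qed

lemma rees_map_eq:
  assumes q: "univ_coeffs q P"
  shows "rees_map D c (ext_cls D q) = (\<lambda>k. chered_cls D c (\<Sum>i\<le>k. hcomp (k - i) (P i)))"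
    "rees_map D c (ext_cls D q) \<in> carrier (UP (chered_alg D c))"
proof -
  interpret PR: ring "UP (univ_alg D)" by (rule ring_UP[OF ring_univ])
  have qc: "q \<in> carrier (UP (univ_alg D))" and Pt: "\<And>i. P i \<in> tensors D" and qP: "\<And>i. q i = univ_cls D (P i)"
    using q by (auto simp: univ_coeffs_def)
  have "rees_eval c x = rees_eval c q" if x: "x \<in> ext_cls D q" for x
  proof -
    obtain e where e: "e \<in> ext_ideal D" "x = e \<oplus>\<^bsub>UP (univ_alg D)\<^esub> q"
      using x by (auto simp: ext_cls_def a_r_coset_def')
    obtain R where Rt: "\<And>n. R n \<in> tensors D" and
      R: "univ_coeffs e (\<lambda>n. R n * gen Par_t - (if 2 \<le> n then R (n - 2) else 0))"
      using ext_ideal_coeffs[OF e(1)] by blast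
    let ?E = "\<lambda>n. R n * gen Par_t - (if 2 \<le> n then R (n - 2) else 0)"
    have Et: "?E n \<in> tensors D" for n using Rt by auto
    have ec: "e \<in> carrier (UP (univ_alg D))" using R by (simp add: univ_coeffs_def)
    have "x n = e n \<oplus>\<^bsub>univ_alg D\<^esub> q n" for n
      using ec qc by (simp add: e UP_def)
    then have xE: "univ_coeffs x (\<lambda>n. ?E n + P n)"
      using R q ec qc Et Pt unfolding univ_coeffs_def by (auto simp: e)
    have "chered_cls D c (\<Sum>i\<le>k. hcomp (k - i) (?E i + P i)) = chered_cls D c (\<Sum>i\<le>k. hcomp (k - i) (P i))" for k
    proof (subst chered_cls_eq_iff)
      have "(\<Sum>i\<le>k. hcomp (k - i) (?E i + P i)) - (\<Sum>i\<le>k. hcomp (k - i) (P i)) = (\<Sum>i\<le>k. hcomp (k - i) (?E i))"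
        by (simp add: hcomp_simps sum.distrib)
      then show "(\<Sum>i\<le>k. hcomp (k - i) (?E i + P i)) - (\<Sum>i\<le>k. hcomp (k - i) (P i)) \<in> chered_preimage c"
        using rees_sum_ext_ideal[OF Rt] by simp
    qed (intro sum_free_carrier hcomp_free_carrier free_carrier_closed(4) Et Pt)+
    then show ?thesis
      unfolding rees_eval_eq(1)[OF xE] rees_eval_eq(1)[OF q] by simp
  qed
  moreover have "q \<in> ext_cls D q"
  proof -
    interpret H: ring "univ_alg D" by (rule ring_univ)
    interpret P: UP_ring "univ_alg D" "UP (univ_alg D)" by unfold_locales
    have "ideal (ext_ideal D) (UP (univ_alg D))"
      unfolding ext_ideal_def Let_def
      by (rule PR.genideal_ideal) (simp add: univ_t_carrier)
    then have "\<zero>\<^bsub>UP (univ_alg D)\<^esub> \<in> ext_ideal D"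
      by (rule additive_subgroup.zero_closed[OF ideal.axioms(1)])
    then show ?thesis
      using qc by (auto simp: ext_cls_def a_r_coset_def' intro!: bexI[of _ "\<zero>\<^bsub>UP (univ_alg D)\<^esub>"])
  qed
  ultimately have "rees_map D c (ext_cls D q) = rees_eval c q"
    unfolding rees_map_def rees_eval_def[symmetric] by (intro the_elem_image_const)
  then show "rees_map D c (ext_cls D q) = (\<lambda>k. chered_cls D c (\<Sum>i\<le>k. hcomp (k - i) (P i)))"
    "rees_map D c (ext_cls D q) \<in> carrier (UP (chered_alg D c))"
    using rees_eval_eq[OF q] by simp_all
qed

lemma ext_carrier: "carrier (ext_alg D) = ext_cls D ` carrier (UP (univ_alg D))"
  unfolding ext_alg_def FactRing_def A_RCOSETS_def' ext_cls_def by auto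

lemma letter_order_le_deg: "letter_order g \<le> letter_deg g"
  by (cases g) auto

lemma word_order_le_deg: "word_order u \<le> word_deg u"
  unfolding word_order_def word_deg_def by (intro sum_list_mono letter_order_le_deg)

lemma rees_map_carrier:
  assumes "X \<in> carrier (ext_alg D)"
  shows "rees_map D c X \<in> carrier (UP (chered_alg D c))" "rees_map D c X i \<in> chered_filt D c i"
proof -
  obtain q where q: "q \<in> carrier (UP (univ_alg D))" "X = ext_cls D q"
    using assms ext_carrier by blast
  obtain P where P: "univ_coeffs q P" using univ_coeffs_ex[OF q(1)] by blast
  then have Pt: "P i \<in> tensors D" for i by (simp add: univ_coeffs_def)
  show "rees_map D c X \<in> carrier (UP (chered_alg D c))" using rees_map_eq(2)[OF P] q(2) by simp
  have "word_order u \<le> i" if u: "u \<in> Poly_Mapping.keys (\<Sum>j\<le>i. hcomp (i - j) (P j))" for u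
  proof -
    obtain j where "j \<le> i" "u \<in> Poly_Mapping.keys (hcomp (i - j) (P j))"
      using subsetD[OF keys_sum u] by auto
    then have "word_deg u = i - j" by (auto simp: hcomp_def keys_keep_words)
    then show ?thesis using word_order_le_deg[of u] by simp
  qed
  moreover have "(\<Sum>j\<le>i. hcomp (i - j) (P j)) \<in> tensors D"
    by (intro sum_free_carrier hcomp_free_carrier Pt)
  ultimately show "rees_map D c X i \<in> chered_filt D c i"
    unfolding q(2) rees_map_eq(1)[OF P] chered_filt_def by (auto simp: carrier_free_alg)
qed

lemma rees_map_emb:
  assumes p: "p \<in> tensors D"
  shows "rees_map D c (ext_emb D (univ_cls D p)) = (\<lambda>k. chered_cls D c (hcomp k p))"
    "rees_map D c (ext_emb D (univ_cls D p)) \<in> carrier (UP (chered_alg D c))"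
proof -
  interpret H: ring "univ_alg D" by (rule ring_univ)
  interpret P: UP_ring "univ_alg D" "UP (univ_alg D)" by unfold_locales
  let ?q = "up_ring.monom (UP (univ_alg D)) (univ_cls D p) 0"
  have "?q i = univ_cls D (if i = 0 then p else 0)" for i
    using p by (simp add: UP_def)
  then have q: "univ_coeffs ?q (\<lambda>i. if i = 0 then p else 0)"
    using p unfolding univ_coeffs_def by simp
  have "(\<Sum>i\<le>k. hcomp (k - i) (if i = 0 then p else 0)) = hcomp k p" for k
  proof -
    have "(\<Sum>i\<le>k. hcomp (k - i) (if i = 0 then p else 0)) = (\<Sum>i\<in>{0}. hcomp (k - i) p)"
      by (intro sum.mono_neutral_cong_right) (auto simp: hcomp_simps)
    then show ?thesis by simp
  qed
  then show "rees_map D c (ext_emb D (univ_cls D p)) = (\<lambda>k. chered_cls D c (hcomp k p))"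
    "rees_map D c (ext_emb D (univ_cls D p)) \<in> carrier (UP (chered_alg D c))"
    using rees_map_eq[OF q, of c] by (simp_all add: ext_emb_def)
qed

end

section \<open>Weights of an operator on a filtered space\<close>

locale complex_space = abelian_group M for M :: "('m, 'z) ring_scheme" (structure) +
  fixes sc :: "complex \<Rightarrow> 'm \<Rightarrow> 'm"
  assumes sc_closed [simp]: "m \<in> carrier M \<Longrightarrow> sc a m \<in> carrier M"
    and sc_add_right: "m \<in> carrier M \<Longrightarrow> n \<in> carrier M \<Longrightarrow> sc a (m \<oplus> n) = sc a m \<oplus> sc a n"
    and sc_add_left: "m \<in> carrier M \<Longrightarrow> sc (a + b) m = sc a m \<oplus> sc b m"
    and sc_mult: "m \<in> carrier M \<Longrightarrow> sc (a * b) m = sc a (sc b m)"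
    and sc_one [simp]: "m \<in> carrier M \<Longrightarrow> sc 1 m = m"
begin

lemma sc_zero_left [simp]: "m \<in> carrier M \<Longrightarrow> sc 0 m = \<zero>"
  using sc_add_left[of m 0 0] by (simp add: add.l_cancel_one')

lemma sc_zero_right [simp]: "sc a \<zero> = \<zero>"
  using sc_add_right[of \<zero> \<zero> a] by (simp add: add.l_cancel_one')

lemma sc_uminus: "m \<in> carrier M \<Longrightarrow> sc (- 1) m = \<ominus> m"
proof -
  assume m: "m \<in> carrier M"
  have "sc (- 1) m \<oplus> m = sc (- 1 + 1) m" using m by (simp only: sc_add_left sc_one)
  also have "\<dots> = \<zero>" using m by simp
  finally show ?thesis using m by (simp add: minus_equality)
qed

lemma finsum_sc:
  "finite A \<Longrightarrow> m \<in> carrier M \<Longrightarrow> (\<Oplus>i\<in>A. sc (h i) m) = sc (\<Sum>i\<in>A. h i) m"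
  by (induction A rule: finite_induct) (auto simp: sc_add_left Pi_def)

definition lin :: "('m \<Rightarrow> 'm) \<Rightarrow> bool" where
  "lin T \<longleftrightarrow> (\<forall>m\<in>carrier M. T m \<in> carrier M) \<and>
     (\<forall>m\<in>carrier M. \<forall>n\<in>carrier M. T (m \<oplus> n) = T m \<oplus> T n) \<and>
     (\<forall>a. \<forall>m\<in>carrier M. T (sc a m) = sc a (T m))"

lemma linD:
  assumes "lin T"
  shows "m \<in> carrier M \<Longrightarrow> T m \<in> carrier M"
    "m \<in> carrier M \<Longrightarrow> n \<in> carrier M \<Longrightarrow> T (m \<oplus> n) = T m \<oplus> T n"
    "m \<in> carrier M \<Longrightarrow> T (sc a m) = sc a (T m)"
  using assms by (auto simp: lin_def)

lemma lin_zero: "lin T \<Longrightarrow> T \<zero> = \<zero>"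
  using linD(3)[of T \<zero> 0] linD(1)[of T \<zero>] by simp

lemma lin_comp: "lin T \<Longrightarrow> lin U \<Longrightarrow> lin (\<lambda>m. T (U m))"
  by (simp add: lin_def)

lemma lin_power: "lin T \<Longrightarrow> lin (T ^^ k)"
  by (induction k) (auto simp: lin_def)

inductive_set cspan :: "'m set \<Rightarrow> 'm set" for X where
  zero: "\<zero> \<in> cspan X"
| step: "x \<in> X \<Longrightarrow> m \<in> cspan X \<Longrightarrow> sc a x \<oplus> m \<in> cspan X"

lemma cspan_carrier:
  assumes "X \<subseteq> carrier M" "m \<in> cspan X" shows "m \<in> carrier M"
  using assms(2,1) by induction auto

lemma cspan_base: "X \<subseteq> carrier M \<Longrightarrow> x \<in> X \<Longrightarrow> x \<in> cspan X"
  using cspan.step[OF _ cspan.zero, of x X 1] by auto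

lemma cspan_add:
  assumes "X \<subseteq> carrier M" "m \<in> cspan X" "n \<in> cspan X" shows "m \<oplus> n \<in> cspan X"
  using assms(2)
proof induction
  case (step x m a)
  then have "x \<in> carrier M" "m \<in> carrier M" "n \<in> carrier M"
    using assms(1,3) by (auto dest: cspan_carrier)
  with cspan.step[OF step(1,3), of a] show ?case by (simp add: a_assoc)
qed (use assms in \<open>simp add: cspan_carrier\<close>)

lemma cspan_sc:
  assumes "X \<subseteq> carrier M" "m \<in> cspan X" shows "sc b m \<in> cspan X"
  using assms(2)
proof induction
  case (step x m a)
  then have "x \<in> carrier M" "m \<in> carrier M"
    using assms(1) by (auto dest: cspan_carrier)
  with cspan.step[OF step(1,3), of "b * a"] show ?case by (simp add: sc_add_right sc_mult)
qed (simp add: cspan.zero)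

lemma cspan_mono: "m \<in> cspan X \<Longrightarrow> X \<subseteq> Y \<Longrightarrow> m \<in> cspan Y"
  by (induction rule: cspan.induct) (auto intro: cspan.intros)

lemma cspan_lin_image:
  assumes "m \<in> cspan X" "X \<subseteq> carrier M" "Y \<subseteq> carrier M" "lin T" "\<And>x. x \<in> X \<Longrightarrow> T x \<in> cspan Y"
  shows "T m \<in> cspan Y"
  using assms(1)
proof induction
  case zero
  then show ?case by (simp add: lin_zero assms cspan.zero)
next
  case (step x m a)
  then have "x \<in> carrier M" "m \<in> carrier M"
    using assms(2) by (auto dest: cspan_carrier)
  with step show ?case
    using assms by (simp add: linD[OF assms(4)] cspan_add cspan_sc)
qed

lemma cspan_insert:
  assumes "m \<in> cspan (insert e X)" "e \<in> carrier M" "X \<subseteq> carrier M"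
  shows "\<exists>b. \<exists>g\<in>cspan X. m = sc b e \<oplus> g"
  using assms(1)
proof induction
  case zero
  then show ?case using assms by (intro exI[of _ 0] bexI[of _ \<zero>]) (auto intro: cspan.zero)
next
  case (step x m a)
  then obtain b g where g: "g \<in> cspan X" "m = sc b e \<oplus> g" by blast
  then have gc: "g \<in> carrier M" using assms(3) cspan_carrier by blast
  show ?case
  proof (cases "x = e")
    case True
    then have "sc a x \<oplus> m = sc (a + b) e \<oplus> g"
      using g gc assms(2) by (simp add: sc_add_left a_assoc)
    with g show ?thesis by blast
  next
    case False
    then have x: "x \<in> X" using step(1) by simp
    then have "sc a x \<oplus> m = sc b e \<oplus> (sc a x \<oplus> g)"
      using g gc assms by (simp add: subsetD a_lcomm)
    with cspan.step[OF x g(1), of a] show ?thesis by blast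
  qed
qed

text \<open>Induction on the spanning set: if \<open>e\<close> occurs in some \<open>f r\<close>, subtracting multiples of \<open>f r\<close>
  eliminates it from the remaining vectors.\<close>

lemma dependent_if_card_gt:
  assumes "finite X" "X \<subseteq> carrier M" "finite I" "card X < card I" "\<And>i. i \<in> I \<Longrightarrow> f i \<in> cspan X"
  shows "\<exists>c. (\<exists>i\<in>I. c i \<noteq> 0) \<and> (\<Oplus>i\<in>I. sc (c i) (f i)) = \<zero>"
  using assms
proof (induction X arbitrary: I f rule: finite_induct)
  case empty
  have "f i = \<zero>" if "i \<in> I" for i
    using empty.prems(4)[OF that] by (auto elim: cspan.cases)
  then have "(\<Oplus>i\<in>I. sc 1 (f i)) = (\<Oplus>i\<in>I. \<zero>)"
    by (intro finsum_cong') auto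
  then have "(\<Oplus>i\<in>I. sc 1 (f i)) = \<zero>" by simp
  moreover obtain i where "i \<in> I" using empty.prems(3) by fastforce
  ultimately show ?case by (intro exI[of _ "\<lambda>_. 1"]) auto
next
  case (insert e X)
  have e: "e \<in> carrier M" and X: "X \<subseteq> carrier M" using insert.prems by auto
  have "\<forall>i\<in>I. \<exists>b g. g \<in> cspan X \<and> f i = sc b e \<oplus> g"
    using cspan_insert[OF insert.prems(4) e X] by blast
  then obtain b g where g: "\<And>i. i \<in> I \<Longrightarrow> g i \<in> cspan X" "\<And>i. i \<in> I \<Longrightarrow> f i = sc (b i) e \<oplus> g i"
    by metis
  have gc: "g i \<in> carrier M" if "i \<in> I" for i using g(1)[OF that] X cspan_carrier by blast
  have fc: "f i \<in> carrier M" if "i \<in> I" for i using g(2)[OF that] gc[OF that] e by simp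
  show ?case
  proof (cases "\<forall>i\<in>I. b i = 0")
    case True
    then have "f i \<in> cspan X" if "i \<in> I" for i
      using g[OF that] gc[OF that] e that by simp
    moreover have "card X < card I" using insert.prems insert.hyps by simp
    ultimately show ?thesis using insert.IH[OF X insert.prems(2)] by blast
  next
    case False
    then obtain r where r: "r \<in> I" "b r \<noteq> 0" by blast
    let ?k = "\<lambda>i. - (b i / b r)"
    let ?f = "\<lambda>i. f i \<oplus> sc (?k i) (f r)"
    have "?f i \<in> cspan X" if i: "i \<in> I - {r}" for i
    proof -
      have iI: "i \<in> I" using i by simp
      have "?f i = (sc (b i) e \<oplus> g i) \<oplus> (sc (?k i * b r) e \<oplus> sc (?k i) (g r))"
        using g(2)[OF iI] g(2)[OF r(1)] gc[OF r(1)] e by (simp only: sc_add_right sc_mult sc_closed)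
      also have "\<dots> = sc (b i + ?k i * b r) e \<oplus> (g i \<oplus> sc (?k i) (g r))"
        using gc[OF iI] gc[OF r(1)] e by (simp only: sc_add_left) (simp add: a_ac)
      also have "b i + ?k i * b r = 0" using r by simp
      finally have "?f i = g i \<oplus> sc (?k i) (g r)"
        using gc[OF iI] gc[OF r(1)] e by simp
      then show ?thesis
        using g(1)[OF iI] g(1)[OF r(1)] X by (simp add: cspan_add cspan_sc)
    qed
    moreover have "card X < card (I - {r})"
      using insert.prems insert.hyps r by simp
    ultimately obtain c where c: "\<exists>i\<in>I - {r}. c i \<noteq> 0" "(\<Oplus>i\<in>I - {r}. sc (c i) (?f i)) = \<zero>"
      using insert.IH[OF X, of "I - {r}" ?f] insert.prems(2) by blast
    let ?c = "c(r := \<Sum>i\<in>I - {r}. c i * ?k i)"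
    have fin: "finite (I - {r})" using insert.prems(2) by simp
    have "(\<Oplus>i\<in>I. sc (?c i) (f i)) = (\<Oplus>i\<in>insert r (I - {r}). sc (?c i) (f i))"
      using r by (simp add: insert_absorb)
    also have "\<dots> = sc (?c r) (f r) \<oplus> (\<Oplus>i\<in>I - {r}. sc (?c i) (f i))"
      using fin fc r by (intro finsum_insert) auto
    also have "(\<Oplus>i\<in>I - {r}. sc (?c i) (f i)) = (\<Oplus>i\<in>I - {r}. sc (c i) (f i))"
      using fc by (intro finsum_cong') auto
    also have "sc (?c r) (f r) = (\<Oplus>i\<in>I - {r}. sc (c i * ?k i) (f r))"
      using fin fc[OF r(1)] by (simp add: finsum_sc)
    also have "\<dots> \<oplus> (\<Oplus>i\<in>I - {r}. sc (c i) (f i)) = (\<Oplus>i\<in>I - {r}. sc (c i * ?k i) (f r) \<oplus> sc (c i) (f i))"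
      using fin fc r by (intro finsum_addf[symmetric]) auto
    also have "\<dots> = (\<Oplus>i\<in>I - {r}. sc (c i) (?f i))"
      using fc r by (intro finsum_cong') (auto simp: sc_add_right sc_mult[symmetric] a_comm)
    finally have "(\<Oplus>i\<in>I. sc (?c i) (f i)) = \<zero>" using c(2) by simp
    moreover have "\<exists>i\<in>I. ?c i \<noteq> 0" using c(1) by auto
    ultimately show ?thesis by blast
  qed
qed

end

locale operator_space = complex_space M sc for M :: "('m, 'z) ring_scheme" (structure) and sc +
  fixes E :: "'m \<Rightarrow> 'm"
  assumes lin_E: "lin E"
begin

lemma E_closed [simp]: "m \<in> carrier M \<Longrightarrow> E m \<in> carrier M"
  by (rule linD(1)[OF lin_E])

text \<open>\<open>apply_factors L m\<close> is \<open>\<Prod>(E - l)\<close> applied to \<open>m\<close>, the product being over the entries of \<open>L\<close>: if it is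
  zero, all weights of \<open>m\<close> occur in \<open>L\<close>.\<close>

fun apply_factors :: "complex list \<Rightarrow> 'm \<Rightarrow> 'm" where
  "apply_factors [] m = m"
| "apply_factors (l # L) m = apply_factors L (E m \<oplus> sc (- l) m)"

lemma lin_factor: "lin (\<lambda>m. E m \<oplus> sc (- l) m)"
proof -
  have "E m \<oplus> E n \<oplus> (sc (- l) m \<oplus> sc (- l) n) = E m \<oplus> sc (- l) m \<oplus> (E n \<oplus> sc (- l) n)"
    if "m \<in> carrier M" "n \<in> carrier M" for m n
    using that by (simp add: a_ac)
  then show ?thesis
    unfolding lin_def
    by (auto simp: linD[OF lin_E] sc_add_right sc_mult[symmetric] mult.commute)
qed

lemma lin_apply_factors: "lin (apply_factors L)"
proof (induction L)
  case Nil
  then show ?case by (simp add: lin_def)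
next
  case (Cons l L)
  from lin_comp[OF Cons lin_factor] show ?case by (simp add: lin_def)
qed

lemmas apply_factors_lin = linD[OF lin_apply_factors] lin_zero[OF lin_apply_factors]

lemma apply_factors_append: "apply_factors (L @ L') m = apply_factors L' (apply_factors L m)"
  by (induction L arbitrary: m) auto

lemma apply_factors_E: "m \<in> carrier M \<Longrightarrow> apply_factors L (E m) = E (apply_factors L m)"
proof (induction L arbitrary: m)
  case (Cons l L)
  then show ?case
    by (simp flip: linD(2,3)[OF lin_E])
qed simp

lemma apply_factors_commute:
  "m \<in> carrier M \<Longrightarrow> apply_factors L (apply_factors L' m) = apply_factors L' (apply_factors L m)"
proof (induction L' arbitrary: m)
  case (Cons l L')
  have "apply_factors L (E m \<oplus> sc (- l) m) = E (apply_factors L m) \<oplus> sc (- l) (apply_factors L m)"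
    using Cons.prems by (simp add: apply_factors_lin apply_factors_E)
  with Cons show ?case by simp
qed simp

lemma apply_factors_append_zero:
  assumes "m \<in> carrier M" "apply_factors L m = \<zero> \<or> apply_factors L' m = \<zero>"
  shows "apply_factors (L @ L') m = \<zero>"
  using assms apply_factors_commute[OF assms(1), of L L'] by (auto simp: apply_factors_append apply_factors_lin)

text \<open>Remove one factor \<open>E - l\<close> of the first product: what the other factors leave of \<open>m\<close> is an
  eigenvector for \<open>l\<close>, on which the second product acts by a nonzero scalar.\<close>

lemma disjoint_factors:
  assumes "m \<in> carrier M" "apply_factors L m = \<zero>" "apply_factors L' m = \<zero>" "set L \<inter> set L' = {}"
  shows "m = \<zero>"
  using assms
proof (induction L arbitrary: m)
  case (Cons l L)
  let ?n = "apply_factors L m"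
  have n: "?n \<in> carrier M" using Cons.prems by (simp add: apply_factors_lin)
  have "E ?n \<oplus> sc (- l) ?n = apply_factors L (E m \<oplus> sc (- l) m)"
    using Cons.prems(1) by (simp add: apply_factors_lin apply_factors_E)
  then have ev: "E ?n \<oplus> sc (- l) ?n = \<zero>" using Cons.prems(2) by simp
  have "?n = \<zero>"
  proof -
    have "sc l ?n \<oplus> sc (- l) ?n = \<zero>" using n by (simp flip: sc_add_left)
    with ev n have El: "E ?n = sc l ?n"
      by (metis E_closed add.right_cancel sc_closed)
    have "apply_factors K ?n = sc (\<Prod>k\<leftarrow>K. l - k) ?n" for K
    proof (induction K)
      case Nil
      then show ?case using n by simp
    next
      case (Cons k K)
      have "apply_factors (k # K) ?n = apply_factors K (sc (l - k) ?n)"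
        using n by (simp add: El flip: sc_add_left)
      also have "\<dots> = sc (l - k) (sc (\<Prod>k\<leftarrow>K. l - k) ?n)"
        using n Cons by (simp add: apply_factors_lin)
      finally show ?case using n by (simp add: sc_mult)
    qed
    moreover have "apply_factors L' ?n = \<zero>"
      using Cons.prems apply_factors_commute[of m L' L] by (simp add: apply_factors_lin)
    ultimately have z: "sc (\<Prod>k\<leftarrow>L'. l - k) ?n = \<zero>" by simp
    have "(\<Prod>k\<leftarrow>L'. l - k) \<noteq> 0" using Cons.prems(4) by (induction L') auto
    then have "?n = sc (inverse (\<Prod>k\<leftarrow>L'. l - k)) (sc (\<Prod>k\<leftarrow>L'. l - k) ?n)"
      using n by (simp flip: sc_mult)
    then show ?thesis using z by simp
  qed
  then show ?case using Cons.IH[OF Cons.prems(1) _ Cons.prems(3)] Cons.prems(4) by auto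
qed simp

text \<open>\<open>(E - (l + w)) T = T (E - l)\<close> for an operator \<open>T\<close> of weight \<open>w\<close>.\<close>

lemma shift_factors:
  assumes T: "lin T" "\<And>m. m \<in> carrier M \<Longrightarrow> E (T m) = T (E m) \<oplus> sc w (T m)" and m: "m \<in> carrier M"
  shows "apply_factors (map (\<lambda>l. l + w) L) (T m) = T (apply_factors L m)"
  using m
proof (induction L arbitrary: m)
  case (Cons l L)
  then have Tm: "T m \<in> carrier M" "T (E m) \<in> carrier M" using T(1) by (simp_all add: linD)
  have "E (T m) \<oplus> sc (- (l + w)) (T m) = T (E m) \<oplus> (sc w (T m) \<oplus> sc (- (l + w)) (T m))"
    using Cons.prems Tm by (simp add: T(2) a_assoc)
  also have "sc w (T m) \<oplus> sc (- (l + w)) (T m) = sc (- l) (T m)"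
    using Tm by (simp flip: sc_add_left)
  also have "T (E m) \<oplus> sc (- l) (T m) = T (E m \<oplus> sc (- l) m)"
    using Cons.prems T(1) by (simp add: linD)
  finally show ?case using Cons by simp
qed simp

fun list_eval :: "complex list \<Rightarrow> 'm \<Rightarrow> 'm" where
  "list_eval [] x = \<zero>"
| "list_eval (a # as) x = sc a x \<oplus> list_eval as (E x)"

definition peval :: "complex poly \<Rightarrow> 'm \<Rightarrow> 'm" where
  "peval p = list_eval (coeffs p)"

lemma peval_zero [simp]: "peval 0 x = \<zero>"
  by (simp add: peval_def)

lemma peval_pCons: "x \<in> carrier M \<Longrightarrow> peval (pCons a p) x = sc a x \<oplus> peval p (E x)"
  by (cases "a = 0 \<and> p = 0") (auto simp: peval_def cCons_def)

lemma lin_peval: "lin (peval p)"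
proof (induction p)
  case 0
  then show ?case by (simp add: lin_def)
next
  case (pCons a p)
  note IH = linD[OF pCons(2)]
  have "sc a m \<oplus> sc a n \<oplus> (peval p (E m) \<oplus> peval p (E n)) = sc a m \<oplus> peval p (E m) \<oplus> (sc a n \<oplus> peval p (E n))"
    if "m \<in> carrier M" "n \<in> carrier M" for m n
    using that IH(1) by (simp add: a_ac)
  then show ?case
    using IH by (auto simp: lin_def peval_pCons linD[OF lin_E] sc_add_right sc_mult[symmetric] mult.commute)
qed

lemmas peval_lin = linD[OF lin_peval]

lemma peval_add: "x \<in> carrier M \<Longrightarrow> peval (p + q) x = peval p x \<oplus> peval q x"
proof (induction p q arbitrary: x rule: poly_induct2)
  case (pCons a p b q)
  then have "peval p (E x) \<in> carrier M" "peval q (E x) \<in> carrier M" by (simp_all add: peval_lin)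
  with pCons show ?case by (simp add: peval_pCons sc_add_left a_ac)
qed simp

lemma peval_smult: "x \<in> carrier M \<Longrightarrow> peval (smult b p) x = sc b (peval p x)"
proof (induction p arbitrary: x)
  case (pCons a p)
  then have "peval p (E x) \<in> carrier M" by (simp add: peval_lin)
  with pCons show ?case by (simp add: peval_pCons sc_mult sc_add_right)
qed simp

lemma peval_monom: "x \<in> carrier M \<Longrightarrow> peval (monom a i) x = sc a ((E ^^ i) x)"
proof (induction i arbitrary: x)
  case 0
  then show ?case by (simp add: monom_0 peval_pCons)
next
  case (Suc i)
  then show ?case
    using linD(1)[OF lin_power[OF lin_E], of "E x" i]
    by (simp add: monom_Suc peval_pCons funpow_swap1)
qed

lemma peval_sum:
  assumes "x \<in> carrier M" "finite I"
  shows "peval (\<Sum>i\<in>I. monom (c i) i) x = (\<Oplus>i\<in>I. sc (c i) ((E ^^ i) x))"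
  using assms(2)
proof (induction I rule: finite_induct)
  case (insert i I)
  have "(E ^^ j) x \<in> carrier M" for j by (rule linD(1)[OF lin_power[OF lin_E] assms(1)])
  with insert show ?case by (simp add: peval_add peval_monom assms(1) Pi_def)
qed simp

text \<open>The fundamental theorem of algebra splits the annihilating polynomial into linear factors.\<close>

lemma factors_of_peval:
  assumes "p \<noteq> 0" "peval p x = \<zero>" "x \<in> carrier M"
  shows "\<exists>L. apply_factors L x = \<zero>"
  using assms
proof (induction "degree p" arbitrary: p x)
  case 0
  then obtain a where a: "p = [:a:]" by (metis degree_eq_zeroE)
  with 0 have "sc a x = \<zero>" "a \<noteq> 0" by (auto simp: peval_pCons)
  moreover have "x = sc (inverse a) (sc a x)" using 0(4) \<open>a \<noteq> 0\<close> by (simp flip: sc_mult)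
  ultimately have "apply_factors [] x = \<zero>" by simp
  then show ?case by blast
next
  case (Suc d)
  have "\<not> constant (poly p)" using Suc(2) by (simp add: constant_degree)
  then obtain z where "poly p z = 0" using fundamental_theorem_of_algebra by blast
  then obtain q where q: "p = [:- z, 1:] * q" using poly_eq_0_iff_dvd dvd_def by metis
  have q0: "q \<noteq> 0" using Suc(3) q by auto
  have deg: "d = degree q"
    using Suc(2) q0 unfolding q by (subst (asm) degree_mult_eq) auto
  have p: "p = smult (- z) q + pCons 0 q" unfolding q by simp
  have "peval p x = peval (smult (- z) q) x \<oplus> peval (pCons 0 q) x"
    unfolding p by (rule peval_add[OF Suc(5)])
  also have "\<dots> = sc (- z) (peval q x) \<oplus> peval q (E x)"
    unfolding peval_smult[OF Suc(5)] using Suc(5) by (simp add: peval_pCons peval_lin)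
  also have "\<dots> = peval q (E x \<oplus> sc (- z) x)"
    using Suc(5) by (simp add: peval_lin a_comm)
  finally have "peval q (E x \<oplus> sc (- z) x) = \<zero>" using Suc(4) by simp
  from Suc(1)[OF deg q0 this] Suc(5) obtain L where "apply_factors L (E x \<oplus> sc (- z) x) = \<zero>" by auto
  then have "apply_factors (z # L) x = \<zero>" by simp
  then show ?case by blast
qed

lemma factors_of_finite_span:
  assumes "finite X" "X \<subseteq> carrier M" "x \<in> carrier M" "\<And>k. (E ^^ k) x \<in> cspan X"
  shows "\<exists>L. apply_factors L x = \<zero>"
proof -
  obtain c where c: "\<exists>i\<in>{..card X}. c i \<noteq> 0" "(\<Oplus>i\<in>{..card X}. sc (c i) ((E ^^ i) x)) = \<zero>"
    using dependent_if_card_gt[OF assms(1,2), of "{..card X}" "\<lambda>i. (E ^^ i) x"] assms(4) by auto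
  let ?p = "\<Sum>i\<in>{..card X}. monom (c i) i"
  have "coeff ?p i = c i" if "i \<in> {..card X}" for i
    using that by (simp add: coeff_sum sum.delta)
  then have "?p \<noteq> 0" using c(1) by (metis coeff_0)
  moreover have "peval ?p x = \<zero>" using c(2) assms(3) by (simp add: peval_sum)
  ultimately show ?thesis using factors_of_peval assms(3) by blast
qed

end

text \<open>Finitely many homogeneous vectors \<open>G\<close> and operators \<open>(T, d)\<close> of degree \<open>d\<close> generate a filtration.
  The operators may be infinite in number; what keeps the filtration pieces finite dimensional is
  that those of degree 0 act through the finite set \<open>K0\<close> and the others are spanned by the finite
  set \<open>B1\<close>.\<close>

locale generated_filtration = operator_space M sc E
  for M :: "('m, 'z) ring_scheme" (structure) and sc E +
  fixes Ops :: "(('m \<Rightarrow> 'm) \<times> nat) set" and K0 B1 :: "('m \<Rightarrow> 'm) set" and G :: "('m \<times> int) set"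
  assumes ops: "(T, d) \<in> Ops \<Longrightarrow> lin T"
      "(T, d) \<in> Ops \<Longrightarrow> \<exists>w. \<bar>Re w\<bar> \<le> real d \<and> (\<forall>m\<in>carrier M. E (T m) = T (E m) \<oplus> sc w (T m))"
    and K0: "finite K0" "k \<in> K0 \<Longrightarrow> lin k" "\<exists>k\<in>K0. \<forall>m\<in>carrier M. k m = m"
    and B1: "finite B1" "T \<in> B1 \<Longrightarrow> lin T"
    and ops_zero: "(T, 0) \<in> Ops \<Longrightarrow> k \<in> K0 \<Longrightarrow> \<exists>a. \<exists>k'\<in>K0. \<forall>m\<in>carrier M. T (k m) = sc a (k' m)"
    and ops_Suc: "(T, Suc d) \<in> Ops \<Longrightarrow> m \<in> carrier M \<Longrightarrow> T m \<in> cspan ((\<lambda>B. B m) ` B1)"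
    and G: "finite G" "(x, e) \<in> G \<Longrightarrow> x \<in> carrier M"
begin

inductive gen_filt :: "int \<Rightarrow> 'm \<Rightarrow> bool" where
  gen: "(x, d) \<in> G \<Longrightarrow> gen_filt d x"
| zero: "gen_filt j \<zero>"
| add: "gen_filt j m \<Longrightarrow> gen_filt j n \<Longrightarrow> gen_filt j (m \<oplus> n)"
| mono: "gen_filt j m \<Longrightarrow> j \<le> k \<Longrightarrow> gen_filt k m"
| op: "gen_filt j m \<Longrightarrow> (T, d) \<in> Ops \<Longrightarrow> gen_filt (j + int d) (T m)"

lemma gen_filt_carrier: "gen_filt j m \<Longrightarrow> m \<in> carrier M"
  by (induction rule: gen_filt.induct) (auto simp: G ops linD)

fun spanning :: "nat \<Rightarrow> 'm set" where
  "spanning 0 = {k x | k x d. k \<in> K0 \<and> (x, d) \<in> G}"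
| "spanning (Suc n) = spanning n \<union> {k (B x) | k B x. k \<in> K0 \<and> B \<in> B1 \<and> x \<in> spanning n}"

lemma spanning_finite: "finite (spanning n)"
proof (induction n)
  case 0
  have "spanning 0 = (\<lambda>(k, x). k x) ` (K0 \<times> fst ` G)" by force
  then show ?case using K0(1) G(1) by simp
next
  case (Suc n)
  have "{k (B x) | k B x. k \<in> K0 \<and> B \<in> B1 \<and> x \<in> spanning n} = (\<lambda>(k, B, x). k (B x)) ` (K0 \<times> B1 \<times> spanning n)"
    by force
  then show ?case using K0(1) B1(1) Suc by simp
qed

lemma spanning_carrier: "spanning n \<subseteq> carrier M"
  by (induction n) (auto simp: K0 B1 G linD)

lemma spanning_mono: "n \<le> n' \<Longrightarrow> spanning n \<subseteq> spanning n'"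
  by (rule lift_Suc_mono_le) auto

lemma spanning_op_zero:
  assumes T: "(T, 0) \<in> Ops" and x: "x \<in> spanning n"
  shows "T x \<in> cspan (spanning n)"
  using x
proof (induction n)
  case 0
  then obtain k y d where y: "x = k y" "k \<in> K0" "(y, d) \<in> G" by auto
  obtain a k' where k': "k' \<in> K0" "T (k y) = sc a (k' y)"
    using ops_zero[OF T y(2)] G(2)[OF y(3)] by blast
  have "k' y \<in> spanning 0" using k' y by auto
  then show ?case
    unfolding y(1) k'(2) by (intro cspan_sc cspan_base spanning_carrier)
next
  case (Suc n)
  show ?case
  proof (cases "x \<in> spanning n")
    case True
    from Suc.IH[OF True] show ?thesis by (rule cspan_mono) auto
  next
    case False
    then obtain k B y where y: "x = k (B y)" "k \<in> K0" "B \<in> B1" "y \<in> spanning n"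
      using Suc.prems by auto
    have "B y \<in> carrier M" using y spanning_carrier B1(2) linD(1) by blast
    then obtain a k' where k': "k' \<in> K0" "T (k (B y)) = sc a (k' (B y))"
      using ops_zero[OF T y(2)] by blast
    have "k' (B y) \<in> spanning (Suc n)" using k' y by auto
    then show ?thesis
      unfolding y(1) k'(2) by (intro cspan_sc cspan_base spanning_carrier)
  qed
qed

lemma spanning_op_Suc:
  assumes T: "(T, Suc d) \<in> Ops" and x: "x \<in> spanning n"
  shows "T x \<in> cspan (spanning (n + Suc d))"
proof -
  have xc: "x \<in> carrier M" using x spanning_carrier by blast
  obtain k where k: "k \<in> K0" "\<And>m. m \<in> carrier M \<Longrightarrow> k m = m" using K0(3) by blast
  have "(\<lambda>B. B x) ` B1 \<subseteq> spanning (Suc n)"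
  proof
    fix y assume "y \<in> (\<lambda>B. B x) ` B1"
    then obtain B where B: "B \<in> B1" "y = B x" by blast
    then have "y = k (B x)" using k(2) B1(2) xc linD(1) by metis
    then show "y \<in> spanning (Suc n)" using B k(1) x by auto
  qed
  also have "spanning (Suc n) \<subseteq> spanning (n + Suc d)" by (rule spanning_mono) simp
  finally show ?thesis using cspan_mono[OF ops_Suc[OF T xc]] by blast
qed

text \<open>Below the least degree \<open>d0\<close> of a generator the filtration vanishes, and each operator of positive
  degree costs one step of \<open>spanning\<close>.\<close>

lemma gen_filt_spanned:
  assumes d0: "\<And>x d. (x, d) \<in> G \<Longrightarrow> d0 \<le> d"
  shows "gen_filt j m \<Longrightarrow> m \<in> cspan (if j < d0 then {} else spanning (nat (j - d0)))"
proof (induction rule: gen_filt.induct)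
  case (gen x d)
  obtain k where k: "k \<in> K0" "k x = x" using K0(3) G(2)[OF gen] by blast
  then have "x \<in> spanning 0"
    unfolding spanning.simps using gen by (intro CollectI exI[of _ k] exI[of _ x] exI[of _ d]) simp
  then have "x \<in> spanning (nat (d - d0))" using spanning_mono by blast
  then show ?case using d0[OF gen] cspan_base[OF spanning_carrier] by auto
next
  case (add j m n)
  then show ?case by (intro cspan_add) (auto dest: subsetD[OF spanning_carrier])
next
  case (mono j m k)
  show ?case
    by (rule cspan_mono[OF mono.IH]) (use mono.hyps in \<open>auto intro: subsetD[OF spanning_mono, rotated]\<close>)
next
  case (op j m T d)
  show ?case
  proof (cases "j < d0")
    case True
    then have "m = \<zero>" using op.IH by (auto elim: cspan.cases)
    then show ?thesis using lin_zero[OF ops(1)[OF op.hyps(2)]] by (simp add: cspan.zero)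
  next
    case False
    then have m: "m \<in> cspan (spanning (nat (j - d0)))" using op.IH by simp
    have n: "nat (j + int d - d0) = nat (j - d0) + d" using False by simp
    have "T x \<in> cspan (spanning (nat (j - d0) + d))" if "x \<in> spanning (nat (j - d0))" for x
      using that op.hyps(2) spanning_op_zero spanning_op_Suc by (cases d) auto
    then have "T m \<in> cspan (spanning (nat (j - d0) + d))"
      by (intro cspan_lin_image[OF m spanning_carrier spanning_carrier ops(1)[OF op.hyps(2)]])
    then show ?thesis using False n by simp
  qed
qed (simp add: cspan.zero)

text \<open>The generators have finitely many weights because \<open>E\<close> preserves a finite dimensional space
  containing them, and then the bound propagates along the inductive construction.\<close>

lemma weights_bounded:
  assumes stable: "\<And>j m. gen_filt j m \<Longrightarrow> gen_filt j (E m)"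
  shows "\<exists>C. \<forall>j m. gen_filt j m \<longrightarrow> (\<exists>L. apply_factors L m = \<zero> \<and> (\<forall>l\<in>set L. \<bar>Re l\<bar> \<le> real_of_int j + C))"
proof -
  obtain d0 where d0: "\<And>x d. (x, d) \<in> G \<Longrightarrow> d0 \<le> d"
  proof (cases "G = {}")
    case False
    have "Min (snd ` G) \<le> d" if "(x, d) \<in> G" for x d
      using that G(1) by (intro Min_le) force+
    then show thesis using that by blast
  qed (use that in blast)
  have gens: "\<exists>L. apply_factors L x = \<zero>" if g: "(x, d) \<in> G" for x d
  proof -
    have "gen_filt d ((E ^^ k) x)" for k
      by (induction k) (auto intro: gen_filt.gen[OF g] stable)
    then have "(E ^^ k) x \<in> cspan (spanning (nat (d - d0)))" for k
      using gen_filt_spanned[OF d0, where j = d and m = "(E ^^ k) x"] d0[OF g] by simp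
    then show ?thesis
      by (intro factors_of_finite_span[OF spanning_finite spanning_carrier G(2)[OF g]])
  qed
  then have "\<forall>g\<in>G. \<exists>L. apply_factors L (fst g) = \<zero>" by auto
  then obtain LL where LL: "\<And>g. g \<in> G \<Longrightarrow> apply_factors (LL g) (fst g) = \<zero>" by metis
  define C where "C = (\<Sum>g\<in>G. \<bar>real_of_int (snd g)\<bar> + (\<Sum>l\<in>set (LL g). \<bar>Re l\<bar>))"
  have C: "\<bar>Re l\<bar> \<le> real_of_int d + C" if g: "(x, d) \<in> G" and l: "l \<in> set (LL (x, d))" for x d l
  proof -
    have "\<bar>Re l\<bar> \<le> (\<Sum>l\<in>set (LL (x, d)). \<bar>Re l\<bar>)" using l by (intro member_le_sum) auto
    moreover have "\<bar>real_of_int (snd (x, d))\<bar> + (\<Sum>l\<in>set (LL (x, d)). \<bar>Re l\<bar>) \<le> C"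
      unfolding C_def using g G(1) by (intro member_le_sum) (auto intro: add_nonneg_nonneg sum_nonneg)
    ultimately show ?thesis by simp
  qed
  have "\<exists>L. apply_factors L m = \<zero> \<and> (\<forall>l\<in>set L. \<bar>Re l\<bar> \<le> real_of_int j + C)" if "gen_filt j m" for j m
    using that
  proof (induction rule: gen_filt.induct)
    case (gen x d)
    then show ?case using LL[OF gen] C[OF gen] by auto
  next
    case (zero j)
    then show ?case by (intro exI[of _ "[]"]) simp
  next
    case (add j m n)
    then obtain L L' where L: "apply_factors L m = \<zero>" "apply_factors L' n = \<zero>"
      "\<forall>l\<in>set L. \<bar>Re l\<bar> \<le> real_of_int j + C" "\<forall>l\<in>set L'. \<bar>Re l\<bar> \<le> real_of_int j + C" by blast
    have c: "m \<in> carrier M" "n \<in> carrier M" using add.hyps gen_filt_carrier by auto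
    then have "apply_factors (L @ L') (m \<oplus> n) = \<zero>"
      using L apply_factors_append_zero[of m L L'] apply_factors_append_zero[of n L L']
      by (simp add: apply_factors_lin)
    with L show ?case by (intro exI[of _ "L @ L'"]) auto
  next
    case (mono j m k)
    then show ?case by force
  next
    case (op j m T d)
    then obtain L where L: "apply_factors L m = \<zero>" "\<forall>l\<in>set L. \<bar>Re l\<bar> \<le> real_of_int j + C" by blast
    have c: "m \<in> carrier M" using op.hyps gen_filt_carrier by auto
    obtain w where w: "\<bar>Re w\<bar> \<le> real d" "\<And>m. m \<in> carrier M \<Longrightarrow> E (T m) = T (E m) \<oplus> sc w (T m)"
      using ops(2)[OF op.hyps(2)] by blast
    have "apply_factors (map (\<lambda>l. l + w) L) (T m) = \<zero>"
      using shift_factors[OF ops(1)[OF op.hyps(2)] w(2) c, of L] L(1) lin_zero[OF ops(1)[OF op.hyps(2)]] by simp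
    moreover have "\<bar>Re (l + w)\<bar> \<le> real_of_int (j + int d) + C" if "l \<in> set L" for l
      using L(2) that w(1) abs_triangle_ineq[of "Re l" "Re w"] by fastforce
    ultimately show ?case by (intro exI[of _ "map (\<lambda>l. l + w) L"]) auto
  qed
  then show ?thesis by blast
qed

end

section \<open>Local nilpotency\<close>

context operator_space
begin

text \<open>Each application of \<open>A\<^sub>d\<close> moves the weight by \<open>\<epsilon> d\<close> but the filtration degree only by \<open>d - 2\<close>, so that
  the weight eventually leaves the range allowed by the degree.  The number of steps needed does not
  depend on the sequence of the \<open>d\<close>, which allows to expand the power of \<open>A\<close> into compositions of the
  \<open>A\<^sub>d\<close>.\<close>

lemma locally_nilpotent:
  fixes F :: "int \<Rightarrow> 'm set" and A :: "'m \<Rightarrow> 'm" and Ad :: "nat \<Rightarrow> 'm \<Rightarrow> 'm" and \<epsilon> :: real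
  assumes F: "\<And>j. F j \<subseteq> carrier M" "(\<Union>j. F j) = carrier M"
    and bounded: "\<And>j m. m \<in> F j \<Longrightarrow> \<exists>L. apply_factors L m = \<zero> \<and> (\<forall>l\<in>set L. \<bar>Re l\<bar> \<le> real_of_int j + C)"
    and Ad: "\<And>d. lin (Ad d)" "\<And>d j m. m \<in> F j \<Longrightarrow> Ad d m \<in> F (j + int d - 2)"
      "\<And>d m. m \<in> carrier M \<Longrightarrow> E (Ad d m) = Ad d (E m) \<oplus> sc (of_real (\<epsilon> * real d)) (Ad d m)"
    and A: "\<And>m. m \<in> carrier M \<Longrightarrow> A m = (\<Oplus>d\<in>{..N}. Ad d m)" and \<epsilon>: "\<bar>\<epsilon>\<bar> = 1" and m: "m \<in> carrier M"
  shows "\<exists>k. (A ^^ k) m = \<zero>"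
proof -
  obtain j where j: "m \<in> F j" using F(2) m by blast
  obtain L where L: "apply_factors L m = \<zero>" using bounded[OF j] by blast
  (* what k steps can produce from m; e is the sum of the degrees d used *)
  define Z where "Z k = {n. \<exists>e::nat. n \<in> F (j + int e - 2 * int k) \<and>
      apply_factors (map (\<lambda>l. l + of_real (\<epsilon> * real e)) L) n = \<zero>}" for k :: nat
  have Zc: "Z k \<subseteq> carrier M" for k using F(1) by (auto simp: Z_def)
  have AdZ: "Ad d n \<in> Z (Suc k)" if n: "n \<in> Z k" for d n k
  proof -
    obtain e where e: "n \<in> F (j + int e - 2 * int k)"
      "apply_factors (map (\<lambda>l. l + of_real (\<epsilon> * real e)) L) n = \<zero>"
      using n by (auto simp: Z_def)
    have nc: "n \<in> carrier M" using e(1) F(1) by blast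
    have "apply_factors (map (\<lambda>l. l + of_real (\<epsilon> * real d)) (map (\<lambda>l. l + of_real (\<epsilon> * real e)) L)) (Ad d n) =
        Ad d (apply_factors (map (\<lambda>l. l + of_real (\<epsilon> * real e)) L) n)"
      by (rule shift_factors[OF Ad(1) Ad(3) nc])
    also have "\<dots> = \<zero>"
      unfolding e(2) by (rule lin_zero[OF Ad(1)])
    finally have fz: "apply_factors (map (\<lambda>l. l + of_real (\<epsilon> * real d)) (map (\<lambda>l. l + of_real (\<epsilon> * real e)) L)) (Ad d n) = \<zero>" .
    have mm: "map (\<lambda>l. l + of_real (\<epsilon> * real d)) (map (\<lambda>l. l + of_real (\<epsilon> * real e)) L) =
        map (\<lambda>l. l + complex_of_real (\<epsilon> * real (e + d))) L"
      by (simp add: algebra_simps)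
    have "Ad d n \<in> F (j + int (e + d) - 2 * int (Suc k))"
      using Ad(2)[OF e(1), of d] by (simp add: algebra_simps)
    with fz[unfolded mm] show ?thesis unfolding Z_def by blast
  qed
  have Adm: "Ad d n \<in> cspan (Z (Suc k))" if "n \<in> cspan (Z k)" for d n k
    by (rule cspan_lin_image[OF that Zc Zc Ad(1)]) (intro cspan_base Zc AdZ)
  have AZ: "A n \<in> cspan (Z (Suc k))" if n: "n \<in> cspan (Z k)" for n k
  proof -
    have nc: "n \<in> carrier M" by (rule cspan_carrier[OF Zc n])
    have "(\<Oplus>d\<in>I. Ad d n) \<in> cspan (Z (Suc k))" if "finite I" for I
      using that
      by (induction I rule: finite_induct)
        (auto simp: cspan.zero Pi_def linD[OF Ad(1)] nc intro!: cspan_add Zc Adm n)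
    then show ?thesis using A[OF nc] by simp
  qed
  have "m \<in> Z 0" using j L by (auto simp: Z_def intro!: exI[of _ 0])
  then have "m \<in> cspan (Z 0)" by (intro cspan_base Zc)
  then have pow: "(A ^^ k) m \<in> cspan (Z k)" for k
    by (induction k) (auto intro: AZ)
  define B where "B = (\<Sum>l\<in>set L. \<bar>Re l\<bar>)"
  obtain k :: nat where k: "real_of_int j + C + B < 2 * real k"
  proof -
    obtain k :: nat where "(real_of_int j + C + B) / 2 < real k" using reals_Archimedean2 by blast
    then show thesis using that[of k] by simp
  qed
  have zk: "n = \<zero>" if n: "n \<in> Z k" for n
  proof -
    obtain e where e: "n \<in> F (j + int e - 2 * int k)"
      "apply_factors (map (\<lambda>l. l + of_real (\<epsilon> * real e)) L) n = \<zero>"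
      using n by (auto simp: Z_def)
    obtain L' where L': "apply_factors L' n = \<zero>"
      "\<And>l. l \<in> set L' \<Longrightarrow> \<bar>Re l\<bar> \<le> real_of_int (j + int e - 2 * int k) + C"
      using bounded[OF e(1)] by blast
    show ?thesis
    proof (rule disjoint_factors[OF _ L'(1) e(2)])
      show "n \<in> carrier M" using n Zc by blast
      show "set L' \<inter> set (map (\<lambda>l. l + of_real (\<epsilon> * real e)) L) = {}"
      proof (rule ccontr)
        assume "set L' \<inter> set (map (\<lambda>l. l + of_real (\<epsilon> * real e)) L) \<noteq> {}"
        then obtain l where l: "l \<in> set L" "l + of_real (\<epsilon> * real e) \<in> set L'" by auto
        have "\<bar>Re l\<bar> \<le> B" unfolding B_def using l(1) by (intro member_le_sum) auto
        moreover have "\<bar>Re l + \<epsilon> * real e\<bar> \<le> real_of_int j + real e - 2 * real k + C"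
          using L'(2)[OF l(2)] by simp
        moreover have "real e \<le> \<bar>Re l + \<epsilon> * real e\<bar> + \<bar>Re l\<bar>"
          using abs_triangle_ineq4[of "Re l + \<epsilon> * real e" "Re l"] \<epsilon> by (simp add: abs_mult)
        ultimately show False using k by linarith
      qed
    qed
  qed
  have "n = \<zero>" if "n \<in> cspan (Z k)" for n
    using that
  proof induction
    case (step x m a)
    then show ?case using zk[OF step(1)] by simp
  qed simp
  then show ?thesis using pow by blast
qed

end

section \<open>Weights with respect to the Euler element\<close>

context refl_group
begin

text \<open>Demanded for all parameters at once, because both sides of a bimodule are needed.\<close>

definition has_weight :: "'v tensor \<Rightarrow> complex \<Rightarrow> bool" where
  "has_weight p w \<longleftrightarrow> (\<forall>c. euler * p - p * euler - scalar w * p \<in> chered_preimage c)"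

lemma has_weight_cov: "x \<in> covectors D \<Longrightarrow> has_weight (gen (Cov x)) 1"
  and has_weight_vec: "has_weight (gen (Vec y)) (- 1)"
proof -
  show "has_weight (gen (Cov x)) 1" if x: "x \<in> covectors D"
    unfolding has_weight_def
  proof
    fix c
    interpret J: cherednik_congruence D "chered_preimage c" by (rule chered_preimage_cong)
    have t: "J.cong (gen Par_t) 1" using chered_t by (simp add: J.cong_def)
    have "J.cong (euler * gen (Cov x) - gen (Cov x) * euler) (1 * gen (Cov x))"
      by (rule J.cong_trans[OF J.euler_cov[OF x] J.cong_mult[OF t J.cong_refl]])
    then show "euler * gen (Cov x) - gen (Cov x) * euler - scalar 1 * gen (Cov x) \<in> chered_preimage c"
      by (simp add: J.cong_def scalar_simps)
  qed
  show "has_weight (gen (Vec y)) (- 1)"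
    unfolding has_weight_def
  proof
    fix c
    interpret J: cherednik_congruence D "chered_preimage c" by (rule chered_preimage_cong)
    have t: "J.cong (gen Par_t) 1" using chered_t by (simp add: J.cong_def)
    have "J.cong (euler * gen (Vec y) - gen (Vec y) * euler) (- (1 * gen (Vec y)))"
      by (rule J.cong_trans[OF J.euler_vec J.cong_uminus[OF J.cong_mult[OF t J.cong_refl]]])
    then show "euler * gen (Vec y) - gen (Vec y) * euler - scalar (- 1) * gen (Vec y) \<in> chered_preimage c"
      by (simp add: J.cong_def scalar_simps)
  qed
qed

lemma has_weight_grp:
  assumes "w \<in> grp D" shows "has_weight (gen (Grp w)) 0"
  unfolding has_weight_def
proof
  fix c
  interpret J: cherednik_congruence D "chered_preimage c" by (rule chered_preimage_cong)
  show "euler * gen (Grp w) - gen (Grp w) * euler - scalar 0 * gen (Grp w) \<in> chered_preimage c"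
    using J.euler_grp[OF assms] by (simp add: scalar_simps)
qed

lemma has_weight_par:
  assumes "p \<in> par_letters D" shows "has_weight (gen p) 0"
  unfolding has_weight_def
proof
  fix c
  interpret J: cherednik_congruence D "chered_preimage c" by (rule chered_preimage_cong)
  show "euler * gen p - gen p * euler - scalar 0 * gen p \<in> chered_preimage c"
    using J.cong_sym[OF J.par_central[OF assms, of euler]] by (simp add: scalar_simps J.cong_def)
qed

lemma has_weight_scalar: "has_weight (scalar a) 0"
proof -
  have "0 \<in> chered_preimage c" for c
  proof -
    interpret J: cherednik_congruence D "chered_preimage c" by (rule chered_preimage_cong)
    show ?thesis by (rule J.zero_mem)
  qed
  then show ?thesis by (simp add: has_weight_def scalar_simps scalar_commutes)
qed

lemma has_weight_letter:
  assumes "g \<in> all_letters D"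
  shows "\<exists>w. \<bar>Re w\<bar> \<le> real (letter_order g) \<and> has_weight (gen g) w"
proof -
  interpret J: cherednik_congruence D "chered_preimage (\<lambda>_. 0)" by (rule chered_preimage_cong)
  from assms show ?thesis
  proof (cases rule: J.letter_cases)
    case 1
    then show ?thesis using has_weight_par by (intro exI[of _ 0]) auto
  next
    case (2 w)
    then show ?thesis using has_weight_grp by (intro exI[of _ 0]) auto
  next
    case (3 y)
    then show ?thesis using has_weight_vec by (intro exI[of _ "-1"]) auto
  next
    case (4 x)
    then show ?thesis using has_weight_cov by (intro exI[of _ 1]) auto
  qed
qed

lemma has_weight_add: "has_weight p w \<Longrightarrow> has_weight q w \<Longrightarrow> has_weight (p + q) w"
  and has_weight_mult: "has_weight p w \<Longrightarrow> has_weight q w' \<Longrightarrow> has_weight (p * q) (w + w')"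
  and has_weight_zero: "has_weight 0 w"
proof -
  have J: "cherednik_congruence D (chered_preimage c)" for c by (rule chered_preimage_cong)
  have JJ: "two_sided_ideal (chered_preimage c)" for c
    using J cherednik_congruence.axioms(2) by blast
  show "has_weight 0 w" using two_sided_ideal.zero_mem[OF JJ] by (simp add: has_weight_def)
  show "has_weight (p + q) w" if "has_weight p w" "has_weight q w"
    unfolding has_weight_def
  proof
    fix c
    have "euler * (p + q) - (p + q) * euler - scalar w * (p + q) =
        (euler * p - p * euler - scalar w * p) + (euler * q - q * euler - scalar w * q)"
      by (simp add: algebra_simps)
    then show "euler * (p + q) - (p + q) * euler - scalar w * (p + q) \<in> chered_preimage c"
      using that two_sided_ideal.add_mem[OF JJ] by (simp add: has_weight_def)
  qed
  show "has_weight (p * q) (w + w')" if "has_weight p w" "has_weight q w'"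
    unfolding has_weight_def
  proof
    fix c
    have "p * (scalar w' * q) = scalar w' * (p * q)" by (metis mult.assoc scalar_commutes)
    then have "euler * (p * q) - (p * q) * euler - scalar (w + w') * (p * q) =
        (euler * p - p * euler - scalar w * p) * q + p * (euler * q - q * euler - scalar w' * q)"
      by (simp add: algebra_simps scalar_simps)
    then show "euler * (p * q) - (p * q) * euler - scalar (w + w') * (p * q) \<in> chered_preimage c"
      using that two_sided_ideal.add_mem[OF JJ] two_sided_ideal.mult_left_mem[OF JJ]
        two_sided_ideal.mult_right_mem[OF JJ] by (simp add: has_weight_def)
  qed
qed

lemma has_weight_word:
  assumes "\<And>g. g \<in> set gs \<Longrightarrow> has_weight (gen g) w"
  shows "has_weight (Poly_Mapping.single (Word gs) a) (of_nat (length gs) * w)"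
  using assms
proof (induction gs)
  case Nil
  then show ?case by (simp add: single_Nil_word has_weight_scalar)
next
  case (Cons g gs)
  then have "has_weight (gen g * Poly_Mapping.single (Word gs) a) (w + of_nat (length gs) * w)"
    by (intro has_weight_mult) auto
  then show ?case by (simp add: single_Cons_word algebra_simps)
qed

lemma has_weight_hcomp:
  assumes p: "p \<in> free_carrier L"
    and L: "\<And>g. g \<in> L \<Longrightarrow> letter_deg g = 1 \<and> has_weight (gen g) w"
  shows "has_weight (hcomp d p) (of_nat d * w)"
proof (rule word_sum_induct[where p = "hcomp d p"])
  fix u a assume "u \<in> Poly_Mapping.keys (hcomp d p)"
  then have u: "u \<in> Poly_Mapping.keys p" "word_deg u = d" by (auto simp: hcomp_def keys_keep_words)
  then have s: "set (letters u) \<subseteq> L" using p by (auto simp: free_carrier_def)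
  have "(\<Sum>g\<leftarrow>letters u. letter_deg g) = (\<Sum>g\<leftarrow>letters u. 1)"
    using s L by (intro arg_cong[where f = sum_list] map_cong) auto
  then have "length (letters u) = d" using u(2) by (simp add: word_deg_def sum_list_triv)
  then show "has_weight (Poly_Mapping.single u a) (of_nat d * w)"
    using has_weight_word[of "letters u" w a] s L by auto
qed (auto intro: has_weight_zero has_weight_add)

lemma chered_par_c:
  assumes "K \<in> refl_classes D" shows "gen (Par_c K) - scalar (c K) \<in> chered_preimage c"
proof -
  have "univ_cls D (gen (Par_c K) - scalar (c K)) \<in> chered_ideal D c"
    unfolding chered_ideal_def
    by (rule subsetD[OF univ.S.genideal_self]) (use assms in auto)
  then show ?thesis using assms by (simp add: chered_preimage_def univ_preimage_iff)
qed

lemma euler_homog: "homog 2 euler"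
  unfolding euler_def
proof (intro homog_diff homog_sum)
  show "homog 2 (gen (Cov (coord b)) * gen (Vec b))" for b
    by (rule homog_gen_gen) simp
  show "homog 2 (scalar (1 / refl_coeff s) * gen (Par_c (conj_class D s)) * gen (Grp s))" for s
    using homog_mult[OF homog_scalar_mult[OF homog_gen'[of "Par_c (conj_class D s)" 2]] homog_gen'[of "Grp s" 0]]
    by simp
qed

end

section \<open>Harish-Chandra bimodules\<close>

locale hc_filtered_bimodule =
  refl_group D + chered_bimodule D c c' M + bimodule_filtration D c c' M F
  for D :: "'v::ab_group_add refl_data" and c c' :: "'v param"
    and M :: "('v chered_elem, 'v chered_elem, 'm) bimod" (structure) and F :: "int \<Rightarrow> 'm set" +
  assumes hc: "harish_chandra_bimodule D (rees_bimod D c c' M F) (rees_bracket D c c' M F) (rees_grading M F)"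
begin

definition Lm :: "'v tensor \<Rightarrow> 'm \<Rightarrow> 'm" where
  "Lm p m = lact M (chered_cls D c p) m"

definition Rm :: "'v tensor \<Rightarrow> 'm \<Rightarrow> 'm" where
  "Rm p m = ract M m (chered_cls D c' p)"

definition sc :: "complex \<Rightarrow> 'm \<Rightarrow> 'm" where
  "sc a = Lm (scalar a)"

lemma Lm_closed [simp]: "p \<in> tensors D \<Longrightarrow> m \<in> carrier M \<Longrightarrow> Lm p m \<in> carrier M"
  and Rm_closed [simp]: "p \<in> tensors D \<Longrightarrow> m \<in> carrier M \<Longrightarrow> Rm p m \<in> carrier M"
  by (simp_all add: Lm_def Rm_def lact_closed ract_closed chered_cls_simps)

lemma Lm_simps:
  "m \<in> carrier M \<Longrightarrow> Lm 1 m = m"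
  "p \<in> tensors D \<Longrightarrow> m \<in> carrier M \<Longrightarrow> n \<in> carrier M \<Longrightarrow> Lm p (m \<oplus> n) = Lm p m \<oplus> Lm p n"
  "p \<in> tensors D \<Longrightarrow> q \<in> tensors D \<Longrightarrow> m \<in> carrier M \<Longrightarrow> Lm (p + q) m = Lm p m \<oplus> Lm q m"
  "p \<in> tensors D \<Longrightarrow> q \<in> tensors D \<Longrightarrow> m \<in> carrier M \<Longrightarrow> Lm (p * q) m = Lm p (Lm q m)"
  by (simp_all add: Lm_def chered_cls_simps add_lact mult_lact lact_add one_lact)

lemma Rm_simps:
  "m \<in> carrier M \<Longrightarrow> Rm 1 m = m"
  "p \<in> tensors D \<Longrightarrow> m \<in> carrier M \<Longrightarrow> n \<in> carrier M \<Longrightarrow> Rm p (m \<oplus> n) = Rm p m \<oplus> Rm p n"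
  "p \<in> tensors D \<Longrightarrow> q \<in> tensors D \<Longrightarrow> m \<in> carrier M \<Longrightarrow> Rm (p + q) m = Rm p m \<oplus> Rm q m"
  "p \<in> tensors D \<Longrightarrow> q \<in> tensors D \<Longrightarrow> m \<in> carrier M \<Longrightarrow> Rm (p * q) m = Rm q (Rm p m)"
  by (simp_all add: Rm_def chered_cls_simps add_ract mult_ract ract_add one_ract)

lemma Rm_Lm: "p \<in> tensors D \<Longrightarrow> q \<in> tensors D \<Longrightarrow> m \<in> carrier M \<Longrightarrow> Rm p (Lm q m) = Lm q (Rm p m)"
  by (simp add: Lm_def Rm_def lact_ract chered_cls_simps)

lemma Lm_cong: "p \<in> tensors D \<Longrightarrow> q \<in> tensors D \<Longrightarrow> p - q \<in> chered_preimage c \<Longrightarrow> Lm p m = Lm q m"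
  and Rm_cong: "p \<in> tensors D \<Longrightarrow> q \<in> tensors D \<Longrightarrow> p - q \<in> chered_preimage c' \<Longrightarrow> Rm p m = Rm q m"
  by (simp_all add: Lm_def Rm_def flip: chered_cls_eq_iff)

lemma sc_Rm: "m \<in> carrier M \<Longrightarrow> sc a m = Rm (scalar a) m"
  by (simp add: sc_def Lm_def Rm_def scalar_central)

sublocale complex_space M sc
proof (unfold_locales)
  show "sc 1 m = m" if "m \<in> carrier M" for m
    using that by (simp add: sc_def scalar_simps Lm_simps)
qed (simp_all add: sc_def Lm_simps scalar_simps)

lemma lin_Lm: "p \<in> tensors D \<Longrightarrow> lin (Lm p)"
proof -
  assume p: "p \<in> tensors D"
  have "Lm p (sc a m) = sc a (Lm p m)" if "m \<in> carrier M" for a m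
  proof -
    have "Lm p (sc a m) = Lm (p * scalar a) m" using p that by (simp add: Lm_simps sc_def)
    also have "\<dots> = Lm (scalar a * p) m" by (metis scalar_commutes)
    finally show ?thesis using p that by (simp add: Lm_simps sc_def)
  qed
  then show ?thesis using p by (simp add: lin_def Lm_simps)
qed

lemma lin_Rm: "p \<in> tensors D \<Longrightarrow> lin (Rm p)"
  by (simp add: lin_def Rm_simps sc_def Rm_Lm)

lemma lin_cong:
  assumes "lin V" "\<And>m. m \<in> carrier M \<Longrightarrow> V' m = V m" shows "lin V'"
  using linD[OF assms(1)] assms(2) by (simp add: lin_def)

lemma lin_diff:
  assumes "lin T" "lin U" shows "lin (\<lambda>m. T m \<ominus>\<^bsub>M\<^esub> U m)"
proof -
  note T = linD[OF assms(1)] and U = linD[OF assms(2)]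
  have "T m \<oplus> T n \<oplus> (sc (- 1) (U m) \<oplus> sc (- 1) (U n)) = T m \<oplus> sc (- 1) (U m) \<oplus> (T n \<oplus> sc (- 1) (U n))"
    if "m \<in> carrier M" "n \<in> carrier M" for m n
    using that T(1) U(1) by (simp add: M.a_ac)
  then have "lin (\<lambda>m. T m \<oplus> sc (- 1) (U m))"
    using T U by (auto simp: lin_def sc_add_right mult.commute simp flip: sc_mult)
  moreover have "T m \<ominus>\<^bsub>M\<^esub> U m = T m \<oplus> sc (- 1) (U m)" if "m \<in> carrier M" for m
    using that U(1) by (simp add: a_minus_def sc_uminus)
  ultimately show ?thesis by (rule lin_cong)
qed

definition ad :: "'v tensor \<Rightarrow> 'm \<Rightarrow> 'm" where
  "ad p m = Lm p m \<ominus>\<^bsub>M\<^esub> Rm p m"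

lemma lin_ad: "p \<in> tensors D \<Longrightarrow> lin (ad p)"
  using lin_diff[OF lin_Lm lin_Rm] by (simp add: lin_def ad_def)

sublocale operator_space M sc "ad euler"
  by unfold_locales (rule lin_ad[OF euler_tensor])

text \<open>Right multiplication by the Euler element commutes with left multiplication by \<open>p\<close>.\<close>

lemma ad_Lm:
  assumes p: "p \<in> tensors D" and w: "has_weight p w" and m: "m \<in> carrier M"
  shows "ad euler (Lm p m) = Lm p (ad euler m) \<oplus> sc w (Lm p m)"
proof -
  note e = euler_tensor
  have "Lm euler (Lm p m) = Lm (euler * p) m" using p m e by (simp add: Lm_simps)
  also have "\<dots> = Lm (p * euler + scalar w * p) m"
    using w p e by (intro Lm_cong) (auto simp: has_weight_def diff_diff_eq)
  also have "\<dots> = Lm p (Lm euler m) \<oplus> sc w (Lm p m)"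
    using p m e by (simp add: Lm_simps sc_def)
  finally have 1: "Lm euler (Lm p m) = \<dots>" .
  have 2: "Rm euler (Lm p m) = Lm p (Rm euler m)" using p m e by (rule_tac Rm_Lm) auto
  have 3: "Lm p (ad euler m) = Lm p (Lm euler m) \<oplus> sc (- 1) (Lm p (Rm euler m))"
    using p m e linD[OF lin_Lm[OF p]] by (simp add: ad_def a_minus_def sc_uminus[symmetric])
  show ?thesis
    unfolding 3 unfolding ad_def 1 2 using p m e
    by (simp add: a_minus_def sc_uminus M.a_ac)
qed

lemma ad_Rm:
  assumes p: "p \<in> tensors D" and w: "has_weight p w" and m: "m \<in> carrier M"
  shows "ad euler (Rm p m) = Rm p (ad euler m) \<oplus> sc w (Rm p m)"
proof -
  note e = euler_tensor
  have 0: "Rm (scalar w * p) m = sc w (Rm p m)"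
    using p m linD[OF lin_Rm[OF p]] by (simp add: Rm_simps sc_Rm[symmetric])
  have "Rm p (Rm euler m) = Rm (euler * p) m" using p m e by (simp add: Rm_simps)
  also have "\<dots> = Rm (p * euler + scalar w * p) m"
    using w p e by (intro Rm_cong) (auto simp: has_weight_def diff_diff_eq)
  also have "\<dots> = Rm euler (Rm p m) \<oplus> sc w (Rm p m)"
    using p m e 0 by (simp add: Rm_simps)
  finally have 1: "Rm p (Rm euler m) = \<dots>" .
  have 2: "Lm euler (Rm p m) = Rm p (Lm euler m)" using p m e by (simp add: Rm_Lm)
  have 3: "Rm p (ad euler m) = Rm p (Lm euler m) \<oplus> sc (- 1) (Rm p (Rm euler m))"
    using p m e linD[OF lin_Rm[OF p]] by (simp add: ad_def a_minus_def sc_uminus[symmetric])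
  have c: "Rm euler (Rm p m) \<in> carrier M" "Rm p m \<in> carrier M" "Rm p (Lm euler m) \<in> carrier M"
    using p m e by simp_all
  have "sc (- 1) (Rm euler (Rm p m) \<oplus> sc w (Rm p m)) \<oplus> sc w (Rm p m) = sc (- 1) (Rm euler (Rm p m))"
    using c by (simp add: sc_add_right M.a_assoc flip: sc_mult sc_add_left)
  then show ?thesis
    unfolding 3 1 using c unfolding ad_def 2
    by (simp add: a_minus_def sc_uminus[symmetric] M.a_assoc)
qed

lemma ad_ad:
  assumes p: "p \<in> tensors D" and w: "has_weight p w" and m: "m \<in> carrier M"
  shows "ad euler (ad p m) = ad p (ad euler m) \<oplus> sc w (ad p m)"
proof -
  note lE = linD[OF lin_E]
  have c: "Lm p m \<in> carrier M" "Rm p m \<in> carrier M" "ad euler m \<in> carrier M"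
    "Lm p (ad euler m) \<in> carrier M" "Rm p (ad euler m) \<in> carrier M"
    using p m by simp_all
  have ad: "ad p n = Lm p n \<oplus> sc (- 1) (Rm p n)" if "n \<in> carrier M" for n
    using p that by (simp add: ad_def a_minus_def sc_uminus)
  have "ad euler (ad p m) = ad euler (Lm p m) \<oplus> sc (- 1) (ad euler (Rm p m))"
    using c lE by (simp add: ad[OF m])
  also have "\<dots> = (Lm p (ad euler m) \<oplus> sc w (Lm p m)) \<oplus>
      (sc (- 1) (Rm p (ad euler m)) \<oplus> sc w (sc (- 1) (Rm p m)))"
    unfolding ad_Lm[OF p w m] ad_Rm[OF p w m] using c by (simp add: sc_add_right flip: sc_mult)
  also have "\<dots> = ad p (ad euler m) \<oplus> sc w (ad p m)"
    unfolding ad[OF m] ad[OF c(3)] using c by (simp add: sc_add_right M.a_ac)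
  finally show ?thesis .
qed

subsection \<open>Consequences of the bracket being well-defined\<close>

abbreviation Rees :: "('v ext_elem, 'v ext_elem, int \<Rightarrow> 'm) bimod" where
  "Rees \<equiv> rees_bimod D c c' M F"

lemma F_carrier: "F j \<subseteq> carrier M"
  using filt_exhaustive by blast

definition delta :: "int \<Rightarrow> 'm \<Rightarrow> int \<Rightarrow> 'm" where
  "delta j m = (\<lambda>i. if i = j then m else \<zero>)"

text \<open>That \<open>F j\<close> contains zero and is closed under addition is read off from the group of the Rees
  bimodule, in which \<open>F j\<close> sits as the sequences concentrated at \<open>j\<close>.\<close>

lemma F_zero: "\<zero> \<in> F j"
proof -
  interpret H: harish_chandra_bimodule D Rees "rees_bracket D c c' M F" "rees_grading M F" by (rule hc)
  have "\<zero>\<^bsub>Rees\<^esub> \<in> carrier Rees" by (rule abelian_monoid.zero_closed) (rule H.M.abelian_monoid_axioms)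
  then show ?thesis by (auto simp: rees_bimod_def)
qed

lemma delta_carrier: "m \<in> F j \<Longrightarrow> delta j m \<in> carrier Rees"
  using F_zero by (auto simp: rees_bimod_def delta_def intro: finite_subset[of _ "{j}"])

lemma F_add: "m \<in> F j \<Longrightarrow> n \<in> F j \<Longrightarrow> m \<oplus> n \<in> F j"
proof -
  interpret H: harish_chandra_bimodule D Rees "rees_bracket D c c' M F" "rees_grading M F" by (rule hc)
  assume "m \<in> F j" "n \<in> F j"
  then have "delta j m \<oplus>\<^bsub>Rees\<^esub> delta j n \<in> carrier Rees"
    by (intro abelian_monoid.a_closed[OF H.M.abelian_monoid_axioms] delta_carrier)
  then have "(delta j m \<oplus>\<^bsub>Rees\<^esub> delta j n) j \<in> F j" by (simp add: rees_bimod_def)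
  then show ?thesis by (simp add: rees_bimod_def delta_def)
qed

lemma tensor_filtration:
  assumes "p \<in> tensors D" "\<forall>u\<in>Poly_Mapping.keys p. word_order u \<le> i" "m \<in> F j"
  shows "Lm p m \<in> F (j + int i)" "Rm p m \<in> F (j + int i)"
proof -
  have "chered_cls D a p \<in> chered_filt D a i" for a
    using assms unfolding chered_filt_def by (auto simp: carrier_free_alg)
  then show "Lm p m \<in> F (j + int i)" "Rm p m \<in> F (j + int i)"
    using filt_lact[of _ i m j] filt_ract[of _ i m j] assms(3) by (auto simp: Lm_def Rm_def add.commute)
qed

lemma scalar_order: "\<forall>u\<in>Poly_Mapping.keys (scalar a). word_order u \<le> 0"
  by (simp add: scalar_def word_order_def letters_zero_word)

lemma F_sc: "m \<in> F j \<Longrightarrow> sc a m \<in> F j"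
  using tensor_filtration(1)[OF free_carrier_closed(3) scalar_order] by (simp add: sc_def)

text \<open>The unit lies in all pieces of the filtration of the algebra.\<close>

lemma F_mono: "m \<in> F j \<Longrightarrow> j \<le> k \<Longrightarrow> m \<in> F k"
  using tensor_filtration(1)[of 1 "nat (k - j)" m j] F_carrier[of j]
  by (auto simp: word_order_def letters_zero_word Lm_simps)

lemma lact_zero: "m \<in> carrier M \<Longrightarrow> lact M \<zero>\<^bsub>chered_alg D c\<^esub> m = \<zero>"
  and ract_zero: "m \<in> carrier M \<Longrightarrow> ract M m \<zero>\<^bsub>chered_alg D c'\<^esub> = \<zero>"
proof -
  assume m: "m \<in> carrier M"
  have "sc 0 m = \<zero>" "Rm (scalar 0) m = \<zero>" using m sc_Rm[OF m, of 0] by simp_all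
  then show "lact M \<zero>\<^bsub>chered_alg D c\<^esub> m = \<zero>" "ract M m \<zero>\<^bsub>chered_alg D c'\<^esub> = \<zero>"
    by (simp_all add: sc_def Lm_def Rm_def scalar_simps chered_cls_simps)
qed

text \<open>Only the coefficient of \<open>hbar\<^sup>d\<close> of the Rees map can move position \<open>j\<close> to position \<open>j + d\<close>.\<close>

lemma rees_act_delta:
  assumes p: "p \<in> tensors D" and m: "m \<in> F j"
  shows "lact Rees (ext_emb D (univ_cls D p)) (delta j m) (j + int d) = Lm (hcomp d p) m"
    "ract Rees (delta j m) (ext_emb D (univ_cls D p)) (j + int d) = Rm (hcomp d p) m"
proof -
  have mc: "m \<in> carrier M" using m F_carrier by blast
  have hc: "hcomp i p \<in> tensors D" for i by (rule hcomp_free_carrier[OF p])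
  have aux: "(\<Oplus>i\<in>{..N}. T i (delta j m (j + int d - int i))) = T d m"
    if "\<And>i. lin (T i)" "N < d \<Longrightarrow> T d m = \<zero>" for N and T :: "nat \<Rightarrow> 'm \<Rightarrow> 'm"
  proof -
    have "(\<Oplus>i\<in>{..N}. T i (delta j m (j + int d - int i))) = (\<Oplus>i\<in>{..N}. if d = i then T i m else \<zero>)"
      using that(1) mc by (intro M.finsum_cong') (auto simp: delta_def lin_zero linD)
    also have "\<dots> = T d m"
    proof (cases "d \<le> N")
      case True
      then show ?thesis using that(1) mc by (subst M.finsum_singleton) (auto simp: linD)
    next
      case False
      then have "(\<Oplus>i\<in>{..N}. if d = i then T i m else \<zero>) = (\<Oplus>i\<in>{..N}. \<zero>)"
        by (intro M.finsum_cong') auto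
      with False that(2) show ?thesis by simp
    qed
    finally show ?thesis .
  qed
  have beyond: "chered_cls D a (hcomp d p) = \<zero>\<^bsub>chered_alg D a\<^esub>"
    if "deg (chered_alg D a) (\<lambda>k. chered_cls D a (hcomp k p)) < d" for a
  proof -
    interpret Ra: ring "chered_alg D a" by (rule ring_chered)
    interpret Pa: UP_ring "chered_alg D a" "UP (chered_alg D a)" by unfold_locales
    have car: "(\<lambda>k. chered_cls D a (hcomp k p)) \<in> carrier (UP (chered_alg D a))"
      using rees_map_emb[OF p, of a] by simp
    show ?thesis using Pa.deg_aboveD[OF that car] car by (simp add: UP_def)
  qed
  show "lact Rees (ext_emb D (univ_cls D p)) (delta j m) (j + int d) = Lm (hcomp d p) m"
    unfolding rees_bimod_def
    using aux[of "\<lambda>i. Lm (hcomp i p)" "deg (chered_alg D c) (\<lambda>k. chered_cls D c (hcomp k p))"] lin_Lm[OF hc] beyond mc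
    by (simp add: rees_map_emb[OF p] Let_def Lm_def lact_zero)
  show "ract Rees (delta j m) (ext_emb D (univ_cls D p)) (j + int d) = Rm (hcomp d p) m"
    unfolding rees_bimod_def
    using aux[of "\<lambda>i. Rm (hcomp i p)" "deg (chered_alg D c') (\<lambda>k. chered_cls D c' (hcomp k p))"] lin_Rm[OF hc] beyond mc
    by (simp add: rees_map_emb[OF p] Let_def Rm_def ract_zero)
qed

text \<open>That \<open>hbar\<^sup>-\<^sup>2 [p, m]\<close> preserves the Rees bimodule is read off at position \<open>j + d - 2\<close>.\<close>

lemma bracket_filtration:
  assumes p: "p \<in> tensors D" "univ_cls D p \<in> poisson_center D" and m: "m \<in> F j"
  shows "ad (hcomp d p) m \<in> F (j + int d - 2)"
proof -
  interpret H: harish_chandra_bimodule D Rees "rees_bracket D c c' M F" "rees_grading M F" by (rule hc)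
  have "rees_bracket D c c' M F (univ_cls D p) (delta j m) \<in> carrier Rees"
    by (rule H.br_closed[OF p(2) delta_carrier[OF m]])
  then have "rees_bracket D c c' M F (univ_cls D p) (delta j m) (j + int d - 2) \<in> F (j + int d - 2)"
    by (auto simp: rees_bimod_def)
  then show ?thesis
    using rees_act_delta[OF p(1) m, of d] by (simp add: rees_bracket_def Let_def ad_def)
qed

text \<open>The Euler element is homogeneous of degree 2.\<close>

lemma ad_euler_filtration: "m \<in> F j \<Longrightarrow> ad euler m \<in> F j"
  using bracket_filtration[OF euler_tensor euler_poisson, of m j 2] by (simp add: hcomp_homog[OF euler_homog])

subsection \<open>The filtration is generated by finitely many vectors\<close>

definition letter_ops :: "(('m \<Rightarrow> 'm) \<times> nat) set" where
  "letter_ops = {(Lm (gen g), letter_order g) | g. g \<in> all_letters D} \<union>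
     {(Rm (gen g), letter_order g) | g. g \<in> all_letters D} \<union> {(sc a, 0) | a. True}"

lemma letter_opsI:
  "g \<in> all_letters D \<Longrightarrow> (Lm (gen g), letter_order g) \<in> letter_ops"
  "g \<in> all_letters D \<Longrightarrow> (Rm (gen g), letter_order g) \<in> letter_ops"
  "(sc a, 0) \<in> letter_ops"
  by (auto simp: letter_ops_def)

lemma letter_opsE:
  assumes "(T, d) \<in> letter_ops"
  obtains g where "g \<in> all_letters D" "T = Lm (gen g)" "d = letter_order g"
  | g where "g \<in> all_letters D" "T = Rm (gen g)" "d = letter_order g"
  | a where "T = sc a" "d = 0"
  using assms by (auto simp: letter_ops_def)

definition grp_ops :: "('m \<Rightarrow> 'm) set" where
  "grp_ops = (\<lambda>(w, w') m. Lm (gen (Grp w)) (Rm (gen (Grp w')) m)) ` (grp D \<times> grp D)"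

definition basis_ops :: "('m \<Rightarrow> 'm) set" where
  "basis_ops = (\<Union>b\<in>hbasis. {Lm (gen (Vec b)), Lm (gen (Cov (coord b))), Rm (gen (Vec b)), Rm (gen (Cov (coord b)))})"

lemma Lm_par: "g \<in> par_letters D \<Longrightarrow> \<exists>a. \<forall>m. Lm (gen g) m = sc a m"
  and Rm_par: "g \<in> par_letters D \<Longrightarrow> \<exists>a. \<forall>m\<in>carrier M. Rm (gen g) m = sc a m"
proof -
  assume "g \<in> par_letters D"
  then consider "g = Par_t" | K where "g = Par_c K" "K \<in> refl_classes D"
    by (auto simp: par_letters_def)
  then have "\<exists>a. gen g - scalar a \<in> chered_preimage k \<and> gen g \<in> tensors D" for k :: "'v param"
    using chered_t chered_par_c by cases (auto intro: exI[of _ 1] simp: scalar_simps)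
  then obtain a where a: "\<And>k. gen g - scalar (a k) \<in> chered_preimage k" and g: "gen g \<in> tensors D"
    by metis
  show "\<exists>a. \<forall>m. Lm (gen g) m = sc a m"
    unfolding sc_def using Lm_cong[OF g free_carrier_closed(3) a] by blast
  show "\<exists>a. \<forall>m\<in>carrier M. Rm (gen g) m = sc a m"
    using Rm_cong[OF g free_carrier_closed(3) a] by (intro exI[of _ "a c'"]) (simp add: sc_Rm)
qed

lemma letter_order_zero:
  assumes "g \<in> all_letters D" "letter_order g = 0"
  shows "g \<in> par_letters D \<or> (\<exists>w\<in>grp D. g = Grp w)"
  using assms by (auto simp: all_letters_def vec_letters_def cov_letters_def)

lemma letter_order_Suc:
  assumes "g \<in> all_letters D" "letter_order g = Suc d"
  shows "(\<exists>y. g = Vec y) \<or> (\<exists>x\<in>covectors D. g = Cov x)"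
  using assms by (auto simp: all_letters_def vec_letters_def cov_letters_def par_letters_def)

lemma Lm_cspan:
  assumes "finite B" "\<And>b. b \<in> B \<Longrightarrow> y b \<in> tensors D" "\<And>b. b \<in> B \<Longrightarrow> Lm (y b) m \<in> X" "X \<subseteq> carrier M"
    and m: "m \<in> carrier M"
  shows "Lm (\<Sum>b\<in>B. scalar (h b) * y b) m \<in> cspan X"
  using assms(1-3)
proof (induction B rule: finite_induct)
  case empty
  have "Lm 0 m = sc 0 m" by (simp add: sc_def scalar_simps)
  then show ?case using m by (simp add: cspan.zero)
next
  case (insert b B)
  have "Lm (\<Sum>b\<in>insert b B. scalar (h b) * y b) m = sc (h b) (Lm (y b) m) \<oplus> Lm (\<Sum>b\<in>B. scalar (h b) * y b) m"
    using insert m by (simp add: Lm_simps sum_free_carrier sc_def)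
  then show ?case using insert by (simp add: cspan.step)
qed

lemma Rm_cspan:
  assumes "finite B" "\<And>b. b \<in> B \<Longrightarrow> y b \<in> tensors D" "\<And>b. b \<in> B \<Longrightarrow> Rm (y b) m \<in> X" "X \<subseteq> carrier M"
    and m: "m \<in> carrier M"
  shows "Rm (\<Sum>b\<in>B. scalar (h b) * y b) m \<in> cspan X"
  using assms(1-3)
proof (induction B rule: finite_induct)
  case empty
  have "Rm 0 m = sc 0 m" using m by (simp add: sc_Rm scalar_simps)
  then show ?case using m by (simp add: cspan.zero)
next
  case (insert b B)
  have "Rm (scalar (h b) * y b) m = sc (h b) (Rm (y b) m)"
    using insert m linD(3)[OF lin_Rm[of "y b"], of m "h b"] by (simp add: Rm_simps sc_Rm)
  then have "Rm (\<Sum>b\<in>insert b B. scalar (h b) * y b) m = sc (h b) (Rm (y b) m) \<oplus> Rm (\<Sum>b\<in>B. scalar (h b) * y b) m"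
    using insert m by (simp add: Rm_simps sum_free_carrier)
  then show ?case using insert by (simp add: cspan.step)
qed

lemma lin_sc: "lin (sc a)"
  using lin_Lm[of "scalar a"] by (simp add: sc_def)

text \<open>Group elements on either side form a finite set of operators, parameters act by scalars, and
  multiplication by a vector or covector is a combination of multiplications by basis elements.\<close>

lemma letter_ops_generated_filtration:
  assumes "finite G" "\<And>x e. (x, e) \<in> G \<Longrightarrow> x \<in> carrier M"
  shows "generated_filtration M sc (ad euler) letter_ops grp_ops basis_ops G"
proof (unfold_locales, goal_cases)
  case (1 T d)
  then show ?case by (auto simp: letter_ops_def intro: lin_Lm lin_Rm lin_sc)
next
  case (2 T d)
  then consider g where "g \<in> all_letters D" "T = Lm (gen g)" "d = letter_order g"
    | g where "g \<in> all_letters D" "T = Rm (gen g)" "d = letter_order g" | a where "T = sc a"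
    by (auto simp: letter_ops_def)
  then show ?case
  proof cases
    case 1
    obtain w where w: "\<bar>Re w\<bar> \<le> real (letter_order g)" "has_weight (gen g) w"
      using has_weight_letter[OF 1(1)] by blast
    have "gen g \<in> tensors D" using 1(1) by simp
    from ad_Lm[OF this w(2)] w(1) show ?thesis unfolding 1 by blast
  next
    case 2
    obtain w where w: "\<bar>Re w\<bar> \<le> real (letter_order g)" "has_weight (gen g) w"
      using has_weight_letter[OF 2(1)] by blast
    have "gen g \<in> tensors D" using 2(1) by simp
    from ad_Rm[OF this w(2)] w(1) show ?thesis unfolding 2 by blast
  next
    case 3
    have "ad euler (sc a m) = sc a (ad euler m) \<oplus> sc 0 (sc a m)" if "m \<in> carrier M" for m
      using that linD(3)[OF lin_E that] by simp
    then show ?thesis using 3 by (intro exI[of _ 0]) auto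
  qed
next
  case 3
  then show ?case using finite_grp by (simp add: grp_ops_def)
next
  case (4 k)
  then obtain w w' where w: "w \<in> grp D" "w' \<in> grp D" and k: "k = (\<lambda>m. Lm (gen (Grp w)) (Rm (gen (Grp w')) m))"
    by (auto simp: grp_ops_def)
  show ?case unfolding k by (rule lin_comp[OF lin_Lm lin_Rm]) (simp_all add: w)
next
  case 5
  have id: "gen (Grp id) - 1 \<in> chered_preimage a" for a
  proof -
    interpret J: cherednik_congruence D "chered_preimage a" by (rule chered_preimage_cong)
    show ?thesis by (rule J.smash_rels_mem)
  qed
  have "Lm (gen (Grp id)) (Rm (gen (Grp id)) m) = m" if "m \<in> carrier M" for m
    using that Lm_cong[OF _ free_carrier_closed(2) id] Rm_cong[OF _ free_carrier_closed(2) id]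
    by (simp add: grp_closed Lm_simps Rm_simps)
  then show ?case
    unfolding grp_ops_def by (intro bexI[of _ "\<lambda>m. Lm (gen (Grp id)) (Rm (gen (Grp id)) m)"])
      (auto intro!: image_eqI[of _ _ "(id, id)"] simp: grp_closed)
next
  case 6
  then show ?case using finite_hbasis by (simp add: basis_ops_def)
next
  case (7 T)
  then show ?case by (auto simp: basis_ops_def coord_covector intro!: lin_Lm lin_Rm)
next
  case (8 T k)
  obtain w w' where k: "w \<in> grp D" "w' \<in> grp D" "k = (\<lambda>m. Lm (gen (Grp w)) (Rm (gen (Grp w')) m))"
    using 8(2) by (auto simp: grp_ops_def)
  have kc: "k m \<in> carrier M" if "m \<in> carrier M" for m using that k by simp
  have mem: "(\<lambda>m. Lm (gen (Grp v)) (Rm (gen (Grp v')) m)) \<in> grp_ops" if "v \<in> grp D" "v' \<in> grp D" for v v'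
    using that unfolding grp_ops_def by (intro image_eqI[of _ _ "(v, v')"]) auto
  have grp: "gen (Grp v) * gen (Grp v') - gen (Grp (v \<circ> v')) \<in> chered_preimage a"
    if "v \<in> grp D" "v' \<in> grp D" for v v' a
  proof -
    interpret J: cherednik_congruence D "chered_preimage a" by (rule chered_preimage_cong)
    show ?thesis using that by (rule J.smash_rels_mem)
  qed
  from 8(1) consider a where "\<forall>m\<in>carrier M. T m = sc a m"
    | v where "v \<in> grp D" "T = Lm (gen (Grp v))" | v where "v \<in> grp D" "T = Rm (gen (Grp v))"
  proof -
    from 8(1) consider g where "g \<in> all_letters D" "letter_order g = 0" "T = Lm (gen g)"
      | g where "g \<in> all_letters D" "letter_order g = 0" "T = Rm (gen g)" | b where "T = sc b"
      unfolding letter_ops_def by auto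
    then show thesis
    proof cases
      case (1 g)
      from letter_order_zero[OF 1(1,2)] show thesis
      proof
        assume "g \<in> par_letters D"
        then obtain b where "\<forall>m. Lm (gen g) m = sc b m" using Lm_par by blast
        then show thesis using that(1)[of b] 1(3) by simp
      next
        assume "\<exists>w\<in>grp D. g = Grp w"
        then show thesis using that(2) 1(3) by blast
      qed
    next
      case (2 g)
      from letter_order_zero[OF 2(1,2)] show thesis
      proof
        assume "g \<in> par_letters D"
        then obtain b where "\<forall>m\<in>carrier M. Rm (gen g) m = sc b m" using Rm_par by blast
        then show thesis using that(1)[of b] 2(3) by simp
      next
        assume "\<exists>w\<in>grp D. g = Grp w"
        then show thesis using that(3) 2(3) by blast
      qed
    next
      case (3 b)
      then show thesis using that(1)[of b] by simp
    qed
  qed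
  then show ?case
  proof cases
    case 1
    then show ?thesis using 8(2) kc by blast
  next
    case 2
    have "T (k m) = Lm (gen (Grp (v \<circ> w))) (Rm (gen (Grp w')) m)" if m: "m \<in> carrier M" for m
    proof -
      have "T (k m) = Lm (gen (Grp v) * gen (Grp w)) (Rm (gen (Grp w')) m)"
        using 2 k m by (simp add: Lm_simps)
      also have "\<dots> = Lm (gen (Grp (v \<circ> w))) (Rm (gen (Grp w')) m)"
        using 2 k by (intro Lm_cong grp) (auto simp: grp_closed)
      finally show ?thesis .
    qed
    then show ?thesis
      using 2 k by (intro exI[of _ 1] bexI[OF _ mem[of "v \<circ> w" w']]) (auto simp: grp_closed)
  next
    case 3
    have "T (k m) = Lm (gen (Grp w)) (Rm (gen (Grp (w' \<circ> v))) m)" if m: "m \<in> carrier M" for m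
    proof -
      have "T (k m) = Lm (gen (Grp w)) (Rm (gen (Grp w') * gen (Grp v)) m)"
        using 3 k m by (simp add: Rm_simps Rm_Lm)
      also have "Rm (gen (Grp w') * gen (Grp v)) m = Rm (gen (Grp (w' \<circ> v))) m"
        using 3 k by (intro Rm_cong grp) (auto simp: grp_closed)
      finally show ?thesis .
    qed
    then show ?thesis
      using 3 k by (intro exI[of _ 1] bexI[OF _ mem[of w "w' \<circ> v"]]) (auto simp: grp_closed)
  qed
next
  case (9 T d m)
  let ?X = "(\<lambda>B. B m) ` basis_ops"
  have X: "?X \<subseteq> carrier M" using 9(2) by (auto simp: basis_ops_def coord_covector)
  have fin: "finite hbasis" by (rule finite_hbasis)
  have vec: "gen (Vec y) - (\<Sum>b\<in>hbasis. scalar (coord b y) * gen (Vec b)) \<in> chered_preimage a" for y a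
  proof -
    interpret J: cherednik_congruence D "chered_preimage a" by (rule chered_preimage_cong)
    show ?thesis using J.cong_sym[OF J.vec_expand[of y]] by (simp add: J.cong_def)
  qed
  have cov: "gen (Cov x) - (\<Sum>b\<in>hbasis. scalar (x b) * gen (Cov (coord b))) \<in> chered_preimage a"
    if "x \<in> covectors D" for x a
  proof -
    interpret J: cherednik_congruence D "chered_preimage a" by (rule chered_preimage_cong)
    show ?thesis using J.cong_sym[OF J.cov_expand[OF that]] by (simp add: J.cong_def)
  qed
  have sv: "(\<Sum>b\<in>hbasis. scalar (coord b y) * gen (Vec b)) \<in> tensors D" for y
    by (intro sum_free_carrier) auto
  have sx: "(\<Sum>b\<in>hbasis. scalar (x b) * gen (Cov (coord b))) \<in> tensors D" for x
    by (intro sum_free_carrier) (auto simp: coord_covector)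
  have gx: "gen (Cov x) \<in> tensors D" if "x \<in> covectors D" for x
    using that by simp
  have inX: "b \<in> hbasis \<Longrightarrow> Lm (gen (Vec b)) m \<in> ?X" "b \<in> hbasis \<Longrightarrow> Rm (gen (Vec b)) m \<in> ?X"
    "b \<in> hbasis \<Longrightarrow> Lm (gen (Cov (coord b))) m \<in> ?X" "b \<in> hbasis \<Longrightarrow> Rm (gen (Cov (coord b))) m \<in> ?X" for b
    by (auto simp: basis_ops_def)
  have Lv: "Lm (gen (Vec y)) m \<in> cspan ?X" for y
    unfolding Lm_cong[OF _ sv vec, of y m, simplified] using X 9(2) inX by (intro Lm_cspan fin) auto
  have Rv: "Rm (gen (Vec y)) m \<in> cspan ?X" for y
    unfolding Rm_cong[OF _ sv vec, of y m, simplified] using X 9(2) inX by (intro Rm_cspan fin) auto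
  have Lx: "Lm (gen (Cov x)) m \<in> cspan ?X" if x: "x \<in> covectors D" for x
    unfolding Lm_cong[OF gx[OF x] sx cov[OF x]]
    using X 9(2) inX by (intro Lm_cspan fin) (auto simp: coord_covector)
  have Rx: "Rm (gen (Cov x)) m \<in> cspan ?X" if x: "x \<in> covectors D" for x
    unfolding Rm_cong[OF gx[OF x] sx cov[OF x]]
    using X 9(2) inX by (intro Rm_cspan fin) (auto simp: coord_covector)
  from 9(1) obtain g where "g \<in> all_letters D" "letter_order g = Suc d" "T = Lm (gen g) \<or> T = Rm (gen g)"
    unfolding letter_ops_def by auto
  then show ?case using letter_order_Suc[of g d] Lv Rv Lx Rx by auto
qed (use assms in auto)


context
  fixes X :: "(int \<Rightarrow> 'm) set"
  assumes X: "finite X" "X \<subseteq> carrier Rees"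
    "\<Inter>{N. subbimodule (ext_alg D) (ext_alg D) Rees N \<and> X \<subseteq> N} = carrier Rees"
begin

definition homog_gens :: "('m \<times> int) set" where
  "homog_gens = {(f i, i) | f i. f \<in> X \<and> f i \<noteq> \<zero>}"

lemma homog_gens_filtration: "(x, e) \<in> homog_gens \<Longrightarrow> x \<in> F e"
  using X(2) by (auto simp: homog_gens_def rees_bimod_def)

lemma finite_homog_gens: "finite homog_gens"
proof (rule finite_subset)
  show "homog_gens \<subseteq> (\<Union>f\<in>X. (\<lambda>i. (f i, i)) ` {i. f i \<noteq> \<zero>})"
    by (auto simp: homog_gens_def)
  show "finite (\<Union>f\<in>X. (\<lambda>i. (f i, i)) ` {i. f i \<noteq> \<zero>})"
    using X(1,2) by (auto simp: rees_bimod_def)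
qed

interpretation gf: generated_filtration M sc "ad euler" letter_ops grp_ops basis_ops homog_gens
  by (rule letter_ops_generated_filtration[OF finite_homog_gens])
    (use homog_gens_filtration F_carrier in blast)

lemma gen_filt_letter:
  assumes "gf.gen_filt j m" "g \<in> all_letters D"
  shows "gf.gen_filt (j + int (letter_order g)) (Lm (gen g) m)"
    "gf.gen_filt (j + int (letter_order g)) (Rm (gen g) m)"
  by (rule gf.gen_filt.op[OF assms(1) letter_opsI(1)[OF assms(2)]],
      rule gf.gen_filt.op[OF assms(1) letter_opsI(2)[OF assms(2)]])

lemma gen_filt_sc: "gf.gen_filt j m \<Longrightarrow> gf.gen_filt j (sc a m)"
  using gf.gen_filt.op[OF _ letter_opsI(3), of j m a] by simp

lemma gen_filt_word:
  assumes "set gs \<subseteq> all_letters D" "gf.gen_filt j m"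
  shows "gf.gen_filt (j + int (word_order (Word gs))) (Lm (Poly_Mapping.single (Word gs) a) m)"
    "gf.gen_filt (j + int (word_order (Word gs))) (Rm (Poly_Mapping.single (Word gs) a) m)"
proof -
  show "gf.gen_filt (j + int (word_order (Word gs))) (Lm (Poly_Mapping.single (Word gs) a) m)"
    using assms
  proof (induction gs)
    case Nil
    then show ?case using gen_filt_sc[of j m a] by (simp add: single_Nil_word word_order_def sc_def)
  next
    case (Cons g gs)
    then have "Lm (Poly_Mapping.single (Word (g # gs)) a) m = Lm (gen g) (Lm (Poly_Mapping.single (Word gs) a) m)"
      using gf.gen_filt_carrier by (simp add: single_Cons_word Lm_simps word_prod_tensor)
    moreover have "gf.gen_filt (j + int (word_order (Word gs)) + int (letter_order g))
        (Lm (gen g) (Lm (Poly_Mapping.single (Word gs) a) m))"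
      using Cons by (intro gen_filt_letter) auto
    moreover have "j + int (word_order (Word gs)) + int (letter_order g) = j + int (word_order (Word (g # gs)))"
      by (simp add: word_order_def)
    ultimately show ?case by simp
  qed
  show "gf.gen_filt (j + int (word_order (Word gs))) (Rm (Poly_Mapping.single (Word gs) a) m)"
    using assms
  proof (induction gs arbitrary: j m)
    case Nil
    then show ?case using gen_filt_sc[of j m a] gf.gen_filt_carrier
      by (simp add: single_Nil_word word_order_def sc_Rm)
  next
    case (Cons g gs)
    then have "Rm (Poly_Mapping.single (Word (g # gs)) a) m = Rm (Poly_Mapping.single (Word gs) a) (Rm (gen g) m)"
      using gf.gen_filt_carrier by (simp add: single_Cons_word Rm_simps word_prod_tensor)
    moreover have "gf.gen_filt (j + int (letter_order g) + int (word_order (Word gs)))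
        (Rm (Poly_Mapping.single (Word gs) a) (Rm (gen g) m))"
      using Cons.prems by (intro Cons.IH gen_filt_letter) auto
    moreover have "j + int (letter_order g) + int (word_order (Word gs)) = j + int (word_order (Word (g # gs)))"
      by (simp add: word_order_def)
    ultimately show ?case by simp
  qed
qed

lemma gen_filt_tensor:
  assumes p: "p \<in> tensors D" and i: "\<forall>u\<in>Poly_Mapping.keys p. word_order u \<le> i" and m: "gf.gen_filt j m"
  shows "gf.gen_filt (j + int i) (Lm p m) \<and> gf.gen_filt (j + int i) (Rm p m)"
proof -
  have mc: "m \<in> carrier M" by (rule gf.gen_filt_carrier[OF m])
  have "p \<in> tensors D \<and> gf.gen_filt (j + int i) (Lm p m) \<and> gf.gen_filt (j + int i) (Rm p m)"
  proof (rule word_sum_induct[where p = p])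
    have "Lm 0 m = \<zero>" "Rm 0 m = \<zero>"
      using lact_zero[OF mc] ract_zero[OF mc] by (simp_all add: Lm_def Rm_def chered_cls_simps)
    then show "0 \<in> tensors D \<and> gf.gen_filt (j + int i) (Lm 0 m) \<and> gf.gen_filt (j + int i) (Rm 0 m)"
      by (simp add: gf.gen_filt.zero)
  next
    fix x y
    assume "x \<in> tensors D \<and> gf.gen_filt (j + int i) (Lm x m) \<and> gf.gen_filt (j + int i) (Rm x m)"
      "y \<in> tensors D \<and> gf.gen_filt (j + int i) (Lm y m) \<and> gf.gen_filt (j + int i) (Rm y m)"
    then show "x + y \<in> tensors D \<and> gf.gen_filt (j + int i) (Lm (x + y) m) \<and> gf.gen_filt (j + int i) (Rm (x + y) m)"
      using mc by (simp add: Lm_simps Rm_simps gf.gen_filt.add)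
  next
    fix u a assume u: "u \<in> Poly_Mapping.keys p"
    then have s: "set (letters u) \<subseteq> all_letters D" using p by (auto simp: free_carrier_def)
    have le: "j + int (word_order u) \<le> j + int i" using i u by simp
    show "Poly_Mapping.single u a \<in> tensors D \<and> gf.gen_filt (j + int i) (Lm (Poly_Mapping.single u a) m) \<and>
        gf.gen_filt (j + int i) (Rm (Poly_Mapping.single u a) m)"
      using gf.gen_filt.mono[OF gen_filt_word(1)[OF s m, of a], of "j + int i"]
        gf.gen_filt.mono[OF gen_filt_word(2)[OF s m, of a], of "j + int i"] le single_free_carrier[OF s]
      by simp
  qed
  then show ?thesis by blast
qed

lemma gen_filt_finsum:
  assumes "finite A" "\<And>i. i \<in> A \<Longrightarrow> gf.gen_filt j (h i)"
  shows "gf.gen_filt j (\<Oplus>i\<in>A. h i)"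
  using assms
proof (induction A rule: finite_induct)
  case empty
  then show ?case by (simp add: gf.gen_filt.zero)
next
  case (insert i A)
  then have "(\<Oplus>i\<in>insert i A. h i) = h i \<oplus> (\<Oplus>i\<in>A. h i)"
    using gf.gen_filt_carrier by (intro M.finsum_insert) auto
  then show ?case using insert by (simp add: gf.gen_filt.add)
qed

text \<open>The sequences whose entries lie in the generated filtration form a subbimodule of the Rees
  bimodule that contains its generators.\<close>

lemma filtration_generated: "m \<in> F j \<Longrightarrow> gf.gen_filt j m"
proof -
  interpret H: harish_chandra_bimodule D Rees "rees_bracket D c c' M F" "rees_grading M F" by (rule hc)
  let ?N = "{f \<in> carrier Rees. \<forall>j. gf.gen_filt j (f j)}"
  have "subgroup ?N (add_monoid Rees)"
  proof
    show "?N \<subseteq> carrier (add_monoid Rees)" by auto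
    show "\<one>\<^bsub>add_monoid Rees\<^esub> \<in> ?N"
      using abelian_monoid.zero_closed[OF H.M.abelian_monoid_axioms]
      by (auto simp: rees_bimod_def gf.gen_filt.zero)
  next
    fix f g assume fg: "f \<in> ?N" "g \<in> ?N"
    then have "f \<oplus>\<^bsub>Rees\<^esub> g \<in> carrier Rees"
      by (intro abelian_monoid.a_closed[OF H.M.abelian_monoid_axioms]) auto
    then show "f \<otimes>\<^bsub>add_monoid Rees\<^esub> g \<in> ?N"
      using fg by (auto simp: rees_bimod_def gf.gen_filt.add)
  next
    fix f assume f: "f \<in> ?N"
    then have fF: "f i \<in> F i" "f i \<in> carrier M" for i using F_carrier by (auto simp: rees_bimod_def)
    let ?h = "\<lambda>i. sc (- 1) (f i)"
    have "finite {i. f i \<noteq> \<zero>}" using f by (auto simp: rees_bimod_def)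
    then have "finite {i. ?h i \<noteq> \<zero>}" by (rule finite_subset[rotated]) auto
    then have h: "?h \<in> carrier Rees" using fF(1) F_sc by (auto simp: rees_bimod_def)
    have "?h \<oplus>\<^bsub>Rees\<^esub> f = \<zero>\<^bsub>Rees\<^esub>"
      using fF(2) by (simp add: rees_bimod_def sc_uminus M.l_neg)
    then have "\<ominus>\<^bsub>Rees\<^esub> f = ?h"
      using f h by (intro abelian_group.minus_equality[OF H.M.abelian_group_axioms]) auto
    then show "inv\<^bsub>add_monoid Rees\<^esub> f \<in> ?N"
      using f h gen_filt_sc by (auto simp: a_inv_def)
  qed
  moreover have "lact Rees Y f \<in> ?N \<and> ract Rees f Y \<in> ?N" if Y: "Y \<in> carrier (ext_alg D)" and f: "f \<in> ?N" for Y f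
  proof -
    have ex: "\<exists>q. q \<in> tensors D \<and> (\<forall>u\<in>Poly_Mapping.keys q. word_order u \<le> i) \<and> rees_map D a Y i = chered_cls D a q" for a i
      using rees_map_carrier(2)[OF Y, of a i] by (auto simp: chered_filt_def carrier_free_alg)
    have l: "gf.gen_filt k (lact M (rees_map D c Y i) (f (k - int i)))"
      and r: "gf.gen_filt k (ract M (f (k - int i)) (rees_map D c' Y i))" for k i
    proof -
      have fk: "gf.gen_filt (k - int i) (f (k - int i))" using f by simp
      obtain q where "q \<in> tensors D" "\<forall>u\<in>Poly_Mapping.keys q. word_order u \<le> i" "rees_map D c Y i = chered_cls D c q"
        using ex by blast
      then show "gf.gen_filt k (lact M (rees_map D c Y i) (f (k - int i)))"
        using gen_filt_tensor[of q i, OF _ _ fk] by (simp add: Lm_def)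
      obtain q where "q \<in> tensors D" "\<forall>u\<in>Poly_Mapping.keys q. word_order u \<le> i" "rees_map D c' Y i = chered_cls D c' q"
        using ex by blast
      then show "gf.gen_filt k (ract M (f (k - int i)) (rees_map D c' Y i))"
        using gen_filt_tensor[of q i, OF _ _ fk] by (simp add: Rm_def)
    qed
    have "lact Rees Y f \<in> carrier Rees" "ract Rees f Y \<in> carrier Rees"
      using Y f H.lact_closed H.ract_closed by auto
    moreover have "gf.gen_filt k (lact Rees Y f k)" "gf.gen_filt k (ract Rees f Y k)" for k
    proof -
      have "lact Rees Y f k = (\<Oplus>i\<in>{..deg (chered_alg D c) (rees_map D c Y)}. lact M (rees_map D c Y i) (f (k - int i)))"
        by (simp add: rees_bimod_def Let_def)
      then show "gf.gen_filt k (lact Rees Y f k)"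
        by (simp only:) (rule gen_filt_finsum[OF finite_atMost l])
      have "ract Rees f Y k = (\<Oplus>i\<in>{..deg (chered_alg D c') (rees_map D c' Y)}. ract M (f (k - int i)) (rees_map D c' Y i))"
        by (simp add: rees_bimod_def Let_def)
      then show "gf.gen_filt k (ract Rees f Y k)"
        by (simp only:) (rule gen_filt_finsum[OF finite_atMost r])
    qed
    ultimately show ?thesis by blast
  qed
  moreover have "X \<subseteq> ?N"
  proof
    fix f assume f: "f \<in> X"
    have "gf.gen_filt j (f j)" for j
    proof (cases "f j = \<zero>")
      case False
      then show ?thesis using f by (intro gf.gen_filt.gen) (auto simp: homog_gens_def)
    qed (simp add: gf.gen_filt.zero)
    with f X(2) show "f \<in> ?N" by auto
  qed
  ultimately have "subbimodule (ext_alg D) (ext_alg D) Rees ?N \<and> X \<subseteq> ?N"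
    unfolding subbimodule_def additive_subgroup_def by blast
  then have "carrier Rees \<subseteq> ?N" using X(3) by blast
  then have "gf.gen_filt j (delta j m j)" if "m \<in> F j" using delta_carrier[OF that] by blast
  then show "m \<in> F j \<Longrightarrow> gf.gen_filt j m" by (simp add: delta_def)
qed

lemma generated_filtration_subset: "gf.gen_filt j m \<Longrightarrow> m \<in> F j"
proof (induction rule: gf.gen_filt.induct)
  case (op j m T d)
  have g: "Lm (gen g) m \<in> F (j + int (letter_order g))" "Rm (gen g) m \<in> F (j + int (letter_order g))"
    if "g \<in> all_letters D" for g
  proof -
    have o: "\<forall>u\<in>Poly_Mapping.keys (gen g). word_order u \<le> letter_order g"
      by (simp add: gen_def word_order_def)
    have "gen g \<in> tensors D" using that by simp
    from tensor_filtration[OF this o op.IH]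
    show "Lm (gen g) m \<in> F (j + int (letter_order g))" "Rm (gen g) m \<in> F (j + int (letter_order g))" .
  qed
  from op.hyps(2) show ?case
  proof (cases rule: letter_opsE)
    case (1 h)
    show ?thesis unfolding 1(2,3) by (rule g(1)[OF 1(1)])
  next
    case (2 h)
    show ?thesis unfolding 2(2,3) by (rule g(2)[OF 2(1)])
  next
    case (3 a)
    then show ?thesis using F_sc[OF op.IH] by simp
  qed
next
  case (gen x d)
  then show ?case by (rule homog_gens_filtration)
next
  case (mono j m k)
  show ?case by (rule F_mono[OF mono.IH mono.hyps(2)])
qed (simp_all add: F_zero F_add)

lemma fin_gen: "fin_gen_bimodule (chered_alg D c) (chered_alg D c') M"
proof -
  let ?X = "fst ` homog_gens"
  have mem: "m \<in> N" if N: "subbimodule (chered_alg D c) (chered_alg D c') M N" "?X \<subseteq> N" and m: "gf.gen_filt j m" for N m j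
  proof -
    have NN: "additive_subgroup N M" "\<forall>a\<in>carrier (chered_alg D c). \<forall>n\<in>N. lact M a n \<in> N"
      "\<forall>b\<in>carrier (chered_alg D c'). \<forall>n\<in>N. ract M n b \<in> N"
      using N(1) by (auto simp: subbimodule_def)
    from m show "m \<in> N"
    proof (induction rule: gf.gen_filt.induct)
      case (gen x d)
      then have "x \<in> ?X" by (rule image_eqI[rotated]) simp
      then show ?case using N(2) by blast
    next
      case (zero j)
      show ?case by (rule additive_subgroup.zero_closed[OF NN(1)])
    next
      case (add j m n)
      show ?case by (rule additive_subgroup.a_closed[OF NN(1) add.IH])
    next
      case (mono j m k)
      show ?case by (rule mono.IH)
    next
      case (op j m T d)
      have LR: "Lm p m \<in> N" "Rm p m \<in> N" if "p \<in> tensors D" for p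
        unfolding Lm_def Rm_def using NN(2,3) op.IH chered_cls_simps(3)[OF that] by blast+
      from op.hyps(2) show ?case
        by (cases rule: letter_opsE) (simp_all add: LR sc_def)
    qed
  qed
  have sub: "carrier M \<subseteq> N" if "subbimodule (chered_alg D c) (chered_alg D c') M N" "?X \<subseteq> N" for N
  proof
    fix m assume "m \<in> carrier M"
    then obtain j where "m \<in> F j" using filt_exhaustive by blast
    then show "m \<in> N" by (intro mem[OF that] filtration_generated)
  qed
  have self: "subbimodule (chered_alg D c) (chered_alg D c') M (carrier M)"
    unfolding subbimodule_def
  proof (intro conjI ballI)
    show "additive_subgroup (carrier M) M" by (rule additive_subgroup.intro[OF M.add.subgroup_self])
  qed (simp_all add: lact_closed ract_closed)
  have X: "?X \<subseteq> carrier M"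
  proof
    fix x assume "x \<in> ?X"
    then obtain e where "(x, e) \<in> homog_gens" by (metis eq_fst_iff imageE)
    then show "x \<in> carrier M" using homog_gens_filtration F_carrier by blast
  qed
  have "\<Inter>{N. subbimodule (chered_alg D c) (chered_alg D c') M N \<and> ?X \<subseteq> N} = carrier M"
  proof (rule equalityI)
    show "carrier M \<subseteq> \<Inter>{N. subbimodule (chered_alg D c) (chered_alg D c') M N \<and> ?X \<subseteq> N}"
      by (rule Inter_greatest) (elim CollectE conjE, rule sub)
  qed (rule Inter_lower, rule CollectI, rule conjI[OF self X])
  with finite_imageI[OF finite_homog_gens] X show ?thesis
    unfolding fin_gen_bimodule_def by (intro exI[of _ ?X] conjI)
qed

lemma filtration_weights_bounded:
  "\<exists>C. \<forall>j. \<forall>m\<in>F j. \<exists>L. apply_factors L m = \<zero> \<and> (\<forall>l\<in>set L. \<bar>Re l\<bar> \<le> real_of_int j + C)"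
proof -
  have "gf.gen_filt j (ad euler m)" if "gf.gen_filt j m" for j m
    by (rule filtration_generated[OF ad_euler_filtration[OF generated_filtration_subset[OF that]]])
  from gf.weights_bounded[OF this] show ?thesis using filtration_generated by blast
qed

end

lemma fin_gen_and_weights:
  "fin_gen_bimodule (chered_alg D c) (chered_alg D c') M"
  "\<exists>C. \<forall>j. \<forall>m\<in>F j. \<exists>L. apply_factors L m = \<zero> \<and> (\<forall>l\<in>set L. \<bar>Re l\<bar> \<le> real_of_int j + C)"
proof -
  interpret H: harish_chandra_bimodule D Rees "rees_bracket D c c' M F" "rees_grading M F" by (rule hc)
  obtain X where "finite X" "X \<subseteq> carrier Rees"
    "\<Inter>{N. subbimodule (ext_alg D) (ext_alg D) Rees N \<and> X \<subseteq> N} = carrier Rees"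
    using H.fin_gen by (auto simp: fin_gen_bimodule_def)
  then show "fin_gen_bimodule (chered_alg D c) (chered_alg D c') M"
    "\<exists>C. \<forall>j. \<forall>m\<in>F j. \<exists>L. apply_factors L m = \<zero> \<and> (\<forall>l\<in>set L. \<bar>Re l\<bar> \<le> real_of_int j + C)"
    by (rule fin_gen, rule filtration_weights_bounded)
qed

lemma ad_sum:
  assumes "finite A" "\<And>i. i \<in> A \<Longrightarrow> p i \<in> tensors D" "m \<in> carrier M"
  shows "ad (sum p A) m = (\<Oplus>i\<in>A. ad (p i) m)"
  using assms(1,2)
proof (induction A rule: finite_induct)
  case empty
  show ?case
    using lact_zero[OF assms(3)] ract_zero[OF assms(3)] by (simp add: ad_def Lm_def Rm_def chered_cls_simps a_minus_def M.r_neg)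
next
  case (insert i A)
  have c: "ad (p k) m \<in> carrier M" if "k \<in> insert i A" for k
    using linD(1)[OF lin_ad assms(3)] insert.prems that by blast
  have t: "p i \<in> tensors D" "sum p A \<in> tensors D" using insert.prems by (auto intro: sum_free_carrier)
  have "ad (p i + sum p A) m = ad (p i) m \<oplus> ad (sum p A) m"
    using t assms(3) by (simp add: ad_def Lm_simps Rm_simps a_minus_def M.minus_add M.a_ac)
  then show ?case using insert c by (simp add: Pi_def)
qed

text \<open>The sign \<open>\<epsilon>\<close> is 1 for invariants of \<open>S\<hh>\<^sup>*\<close> and \<open>-1\<close> for those of \<open>S\<hh>\<close>.\<close>

lemma invariant_nilpotent:
  assumes p: "p \<in> free_carrier L" and pt: "p \<in> tensors D" and pc: "univ_cls D p \<in> poisson_center D"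
    and L: "\<And>g. g \<in> L \<Longrightarrow> letter_deg g = 1 \<and> has_weight (gen g) (of_real \<epsilon>)" and \<epsilon>: "\<bar>\<epsilon>\<bar> = 1"
  shows "loc_nilpotent_on (carrier M) \<zero> (ad p)"
  unfolding loc_nilpotent_on_def
proof
  fix m assume m: "m \<in> carrier M"
  obtain C where C: "\<And>j m. m \<in> F j \<Longrightarrow> \<exists>L. apply_factors L m = \<zero> \<and> (\<forall>l\<in>set L. \<bar>Re l\<bar> \<le> real_of_int j + C)"
    using fin_gen_and_weights(2) by blast
  have h: "hcomp d p \<in> tensors D" for d by (rule hcomp_free_carrier[OF pt])
  (* the 0 covers p = 0, for which there are no degrees *)
  define N where "N = Max (insert 0 (word_deg ` Poly_Mapping.keys p))"
  have N: "word_deg u \<le> N" if "u \<in> Poly_Mapping.keys p" for u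
    unfolding N_def using that by (intro Max_ge) auto
  have "p = (\<Sum>d\<le>N. hcomp d p)"
  proof (rule poly_mapping_eqI)
    fix u
    have "Poly_Mapping.lookup (\<Sum>d\<le>N. hcomp d p) u = (\<Sum>d\<le>N. if d = word_deg u then Poly_Mapping.lookup p u else 0)"
      by (auto simp: lookup_sum hcomp_def lookup_keep_words when_def intro!: sum.cong)
    also have "\<dots> = Poly_Mapping.lookup p u"
      using N[of u] by (auto simp: in_keys_iff)
    finally show "Poly_Mapping.lookup p u = Poly_Mapping.lookup (\<Sum>d\<le>N. hcomp d p) u" by simp
  qed
  then have A: "ad p n = (\<Oplus>d\<in>{..N}. ad (hcomp d p) n)" if "n \<in> carrier M" for n
    using ad_sum[of "{..N}" "\<lambda>d. hcomp d p" n] h that by simp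
  show "\<exists>n. (ad p ^^ n) m = \<zero>"
  proof (rule locally_nilpotent[where F = F and C = C and Ad = "\<lambda>d. ad (hcomp d p)" and N = N, OF F_carrier filt_exhaustive C _ _ _ A \<epsilon> m])
    show "lin (ad (hcomp d p))" for d by (rule lin_ad[OF h])
    show "ad (hcomp d p) m \<in> F (j + int d - 2)" if "m \<in> F j" for d j m
      by (rule bracket_filtration[OF pt pc that])
    show "ad euler (ad (hcomp d p) m) = ad (hcomp d p) (ad euler m) \<oplus> sc (of_real (\<epsilon> * real d)) (ad (hcomp d p) m)"
      if "m \<in> carrier M" for d m
    proof -
      have "has_weight (hcomp d p) (of_nat d * of_real \<epsilon>)" by (rule has_weight_hcomp[OF p L])
      from ad_ad[OF h this that] show ?thesis by (simp add: mult.commute)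
    qed
  qed
qed

lemma berest_etingof_ginzburg: "BEG_harish_chandra D c c' M"
proof -
  have eq: "ad_op D c c' M X = ad p"
    if "X \<in> sym_invariants D (cov_letters D) (cov_lin_rels D) \<or> X \<in> sym_invariants D vec_letters (vec_lin_rels D)" "p \<in> X" for X p
    by (rule ext) (simp only: ad_op_def ad_def Lm_def Rm_def sym_emb_eq[OF that])
  have cov: "loc_nilpotent_on (carrier M) \<zero> (ad_op D c c' M X)"
    if X: "X \<in> sym_invariants D (cov_letters D) (cov_lin_rels D)" for X
  proof -
    obtain p where p: "p \<in> X" "p \<in> free_carrier (cov_letters D)" using sym_invariant_letters(1)[OF X] by blast
    have "loc_nilpotent_on (carrier M) \<zero> (ad p)"
    proof (rule invariant_nilpotent[OF p(2) _ sym_invariant_poisson[OF _ p(1)], where \<epsilon> = 1])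
      show "p \<in> tensors D" using p(2) cov_letters_tensors by blast
      show "letter_deg g = 1 \<and> has_weight (gen g) (of_real 1)" if "g \<in> cov_letters D" for g
        using that by (auto simp: cov_letters_def has_weight_cov)
    qed (simp_all add: X)
    moreover have "ad_op D c c' M X = ad p" by (rule eq[OF _ p(1)]) (simp add: X)
    ultimately show ?thesis by simp
  qed
  have vec: "loc_nilpotent_on (carrier M) \<zero> (ad_op D c c' M X)"
    if X: "X \<in> sym_invariants D vec_letters (vec_lin_rels D)" for X
  proof -
    obtain p where p: "p \<in> X" "p \<in> free_carrier vec_letters" using sym_invariant_letters(2)[OF X] by blast
    have "loc_nilpotent_on (carrier M) \<zero> (ad p)"
    proof (rule invariant_nilpotent[OF p(2) _ sym_invariant_poisson[OF _ p(1)], where \<epsilon> = "- 1"])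
      show "p \<in> tensors D" using p(2) vec_letters_tensors by blast
      show "letter_deg g = 1 \<and> has_weight (gen g) (of_real (- 1))" if "g \<in> vec_letters" for g
        using that by (auto simp: vec_letters_def has_weight_vec)
    qed (simp_all add: X)
    moreover have "ad_op D c c' M X = ad p" by (rule eq[OF _ p(1)]) (simp add: X)
    ultimately show ?thesis by simp
  qed
  show ?thesis
    unfolding BEG_harish_chandra_def by (intro conjI ballI fin_gen_and_weights(1) cov vec)
qed

end

theorem corollary5p4p2:
  fixes D :: "'v::ab_group_add refl_data"
    and c c' :: "'v param"
    and M :: "('v chered_elem, 'v chered_elem, 'm) bimod"
  assumes "refl_group D"
    and "chered_bimodule D c c' M"
    and "\<exists>F. bimodule_filtration D c c' M F \<and>
      harish_chandra_bimodule D (rees_bimod D c c' M F) (rees_bracket D c c' M F)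
        (rees_grading M F)"
  shows "BEG_harish_chandra D c c' M"
proof -
  obtain F where F: "bimodule_filtration D c c' M F"
    "harish_chandra_bimodule D (rees_bimod D c c' M F) (rees_bracket D c c' M F) (rees_grading M F)"
    using assms(3) by blast
  have "hc_filtered_bimodule D c c' M F"
    by (rule hc_filtered_bimodule.intro[OF assms(1,2) F(1) hc_filtered_bimodule_axioms.intro[OF F(2)]])
  then show ?thesis by (rule hc_filtered_bimodule.berest_etingof_ginzburg)
qed

end
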